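(* Let $0<p\le 2$ and $2<q\le\infty$. Then: (a) For every complex Hilbert space $\mathcal K$, there is no complex-linear isometric embedding $\ell_q^2(\mathbb C)\to\mathcal S_p(\mathcal K)$. (b) Consequently, for every integer $m\ge 2$ and every (finite) positive integer $n$, there is no complex-linear isometric embedding $\mathcal S_q^m\to\mathcal S_p^n$. (c) More generally, if $\mathcal H$ and $\mathcal K$ are complex Hilbert spaces with $\dim\mathcal H\ge 2$, there is no complex-linear isometric embedding $\mathcal S_q(\mathcal H)\to\mathcal S_p(\mathcal K)$.
   Context: For a complex Hilbert space $\mathcal H$ and $0<p<\infty$, $\mathcal S_p(\mathcal H)$ is the space of compact operators $A$ on $\mathcal H$ with $\sum_j s_j(A)^p<\infty$, where $s_j(A)$ are the singular values of $A$ counted with multiplicity, equipped with the (quasi-)norm $\|A\|_p=(\sum_j s_j(A)^p)^{1/p}=(\operatorname{Tr}|A|^p)^{1/p}$. $\mathcal S_\infty(\mathcal H)$ is the space of compact operators with the operator norm. For $\mathcal H=\mathbb C^n$ one writes $\mathcal S_p^n$ (so $\mathcal S_p^n=M_n(\mathbb C)$ with $\|\cdot\|_p$). $\ell_q^2(\mathbb C)$ is $\mathbb C^2$ with $\|(a,b)\|_q=(|a|^q+|b|^q)^{1/q}$ for $q<\infty$ and $\|(a,b)\|_\infty=\max(|a|,|b|)$. A complex-linear isometric embedding is a complex-linear map $T$ with $\|Tx\|=\|x\|$ for all $x$ (with respect to the given (quasi-)norms). *)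

theory Defs
  imports "HOL-Analysis.Analysis" "HOL-Library.Function_Algebras"
begin

class complex_vector = ab_group_add +
  fixes scaleC :: "complex \<Rightarrow> 'a \<Rightarrow> 'a"  (infixr "*\<^sub>C" 75)
  assumes scaleC_add_right: "a *\<^sub>C (x + y) = a *\<^sub>C x + a *\<^sub>C y"
    and scaleC_add_left: "(a + b) *\<^sub>C x = a *\<^sub>C x + b *\<^sub>C x"
    and scaleC_scaleC: "a *\<^sub>C (b *\<^sub>C x) = (a * b) *\<^sub>C x"
    and scaleC_one: "1 *\<^sub>C x = x"

interpretation complex_vector: vector_space "scaleC :: complex \<Rightarrow> 'a \<Rightarrow> 'a::complex_vector"
  by standard (simp_all add: scaleC_add_right scaleC_add_left scaleC_scaleC scaleC_one)

text \<open>The inner product is linear in the first argument. Positivity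
  and definiteness follow from the last axiom and those of a norm
  (see \<open>cinner_self\<close> below).\<close>

class complex_inner = complex_vector + real_normed_vector +
  fixes cinner :: "'a \<Rightarrow> 'a \<Rightarrow> complex"
  assumes scaleR_scaleC: "r *\<^sub>R x = complex_of_real r *\<^sub>C x"
    and cinner_commute: "cinner x y = cnj (cinner y x)"
    and cinner_add_left: "cinner (x + y) z = cinner x z + cinner y z"
    and cinner_scaleC_left: "cinner (c *\<^sub>C x) y = c * cinner x y"
    and norm_eq_sqrt_cinner: "norm x = sqrt (Re (cinner x x))"

class chilbert_space = complex_inner + complete_space

lemma cinner_self: "cinner x x = complex_of_real ((norm x)\<^sup>2)"
  for x :: "'a::complex_inner"
proof -
  have "0 \<le> sqrt (Re (cinner x x))"
    using norm_ge_zero[of x] by (simp add: norm_eq_sqrt_cinner)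
  then have "Re (cinner x x) = (norm x)\<^sup>2"
    by (simp add: norm_eq_sqrt_cinner)
  moreover have "Im (cinner x x) = 0"
    using arg_cong[OF cinner_commute[of x x], of Im] by simp
  ultimately show ?thesis
    by (simp add: complex_eq_iff)
qed

instantiation complex :: complex_inner
begin
definition scaleC_complex_def: "c *\<^sub>C x = c * (x::complex)"
definition cinner_complex_def: "cinner x y = x * cnj y"
instance
  by standard
    (simp_all add: scaleC_complex_def cinner_complex_def algebra_simps scaleR_conv_of_real
      cmod_def power2_eq_square)
end

instance complex :: chilbert_space ..

instantiation prod :: (complex_vector, complex_vector) complex_vector
begin
definition scaleC_prod_def: "c *\<^sub>C x = (c *\<^sub>C fst x, c *\<^sub>C snd x)"
instance
  by standard
    (simp_all add: scaleC_prod_def prod_eq_iff scaleC_add_right scaleC_add_left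
      scaleC_scaleC scaleC_one)
end

instantiation "fun" :: (type, complex_vector) complex_vector
begin
definition scaleC_fun_def: "c *\<^sub>C f = (\<lambda>x. c *\<^sub>C f x)"
instance
  by standard
    (simp_all add: scaleC_fun_def fun_eq_iff scaleC_add_right scaleC_add_left
      scaleC_scaleC scaleC_one)
end

instantiation vec :: (complex_vector, finite) complex_vector
begin
definition scaleC_vec_def: "c *\<^sub>C x = (\<chi> i. c *\<^sub>C (x $ i))"
instance
  by standard
    (simp_all add: scaleC_vec_def vec_eq_iff scaleC_add_right scaleC_add_left
      scaleC_scaleC scaleC_one)
end

instantiation vec :: (complex_inner, finite) complex_inner
begin
definition cinner_vec_def: "cinner x y = (\<Sum>i\<in>UNIV. cinner (x $ i) (y $ i))"
instance
proof
  fix r :: real and c :: complex and x y z :: "'a ^ 'b"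
  show "r *\<^sub>R x = complex_of_real r *\<^sub>C x"
    by (simp add: vec_eq_iff scaleC_vec_def scaleR_scaleC)
  show "cinner x y = cnj (cinner y x)"
    unfolding cinner_vec_def cnj_sum by (rule sum.cong[OF refl], rule cinner_commute)
  show "cinner (x + y) z = cinner x z + cinner y z"
    by (simp add: cinner_vec_def cinner_add_left sum.distrib)
  show "cinner (c *\<^sub>C x) y = c * cinner x y"
    by (simp add: cinner_vec_def scaleC_vec_def cinner_scaleC_left sum_distrib_left)
  show "norm x = sqrt (Re (cinner x x))"
    by (simp add: norm_vec_def L2_set_def cinner_vec_def cinner_self del: of_real_power)
qed
end

instance vec :: (chilbert_space, finite) chilbert_space ..

text \<open>Unlike \<open>complex_vector.dim\<close>, which is \<open>0\<close> on infinite-dimensional sets,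
  this takes the value \<open>\<infinity>\<close> there.\<close>

definition cdim :: "'a::complex_vector set \<Rightarrow> enat" where
  "cdim S = (if \<exists>B. finite B \<and> S \<subseteq> complex_vector.span B
             then enat (complex_vector.dim S) else \<infinity>)"

definition bounded_clinear :: "('a::complex_inner \<Rightarrow> 'b::complex_inner) \<Rightarrow> bool" where
  "bounded_clinear A \<longleftrightarrow> bounded_linear A \<and> (\<forall>c x. A (c *\<^sub>C x) = c *\<^sub>C A x)"

definition compact_operator :: "('a::chilbert_space \<Rightarrow> 'a) \<Rightarrow> bool" where
  "compact_operator A \<longleftrightarrow> bounded_clinear A \<and> compact (closure (A ` cball 0 1))"

definition cadjoint :: "('a::chilbert_space \<Rightarrow> 'a) \<Rightarrow> ('a \<Rightarrow> 'a)" where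
  "cadjoint A = (THE B. \<forall>x y. cinner (A x) y = cinner x (B y))"

definition singular_space :: "('a::chilbert_space \<Rightarrow> 'a) \<Rightarrow> real \<Rightarrow> 'a set" where
  "singular_space A s = {x. cadjoint A (A x) = complex_of_real (s\<^sup>2) *\<^sub>C x}"

text \<open>Only the nonzero singular values are collected: a zero singular value
  contributes nothing to a sum of \<open>p\<close>-th powers with \<open>p > 0\<close>.\<close>

definition singular_values :: "('a::chilbert_space \<Rightarrow> 'a) \<Rightarrow> real set" where
  "singular_values A = {s. 0 < s \<and> (\<exists>x \<in> singular_space A s. x \<noteq> 0)}"

definition schatten_sum :: "real \<Rightarrow> ('a::chilbert_space \<Rightarrow> 'a) \<Rightarrow> ennreal" where
  "schatten_sum p A =
     (\<Sum>\<^sub>\<infinity>s\<in>singular_values A. ennreal_of_enat (cdim (singular_space A s)) * ennreal (s powr p))"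

definition schatten_class :: "ereal \<Rightarrow> ('a::chilbert_space \<Rightarrow> 'a) set" where
  "schatten_class p =
     {A. compact_operator A \<and> (p \<noteq> \<infinity> \<longrightarrow> schatten_sum (real_of_ereal p) A < \<infinity>)}"

definition schatten_norm :: "ereal \<Rightarrow> ('a::chilbert_space \<Rightarrow> 'a) \<Rightarrow> real" where
  "schatten_norm p A =
     (if p = \<infinity> then onorm A
      else enn2real (schatten_sum (real_of_ereal p) A) powr (1 / real_of_ereal p))"

definition matrix_schatten_norm :: "ereal \<Rightarrow> complex ^ 'n ^ 'n \<Rightarrow> real" where
  "matrix_schatten_norm p M = schatten_norm p (\<lambda>x. M *v x)"

definition ell_norm :: "ereal \<Rightarrow> complex \<times> complex \<Rightarrow> real" where
  "ell_norm q v =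
     (if q = \<infinity> then max (cmod (fst v)) (cmod (snd v))
      else (cmod (fst v) powr real_of_ereal q + cmod (snd v) powr real_of_ereal q)
             powr (1 / real_of_ereal q))"

text \<open>The carriers \<open>V\<close> and \<open>W\<close> are meant to be complex linear subspaces, with (quasi-)norms
  \<open>nV\<close> and \<open>nW\<close>; no value of \<open>T\<close> outside \<open>V\<close> matters.\<close>

definition isometric_embedding ::
  "'v::complex_vector set \<Rightarrow> ('v \<Rightarrow> real) \<Rightarrow> 'w::complex_vector set \<Rightarrow> ('w \<Rightarrow> real)
    \<Rightarrow> ('v \<Rightarrow> 'w) \<Rightarrow> bool" where
  "isometric_embedding V nV W nW T \<longleftrightarrow>
     (\<forall>x\<in>V. T x \<in> W) \<and>
     (\<forall>x\<in>V. \<forall>y\<in>V. T (x + y) = T x + T y) \<and>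
     (\<forall>c. \<forall>x\<in>V. T (c *\<^sub>C x) = c *\<^sub>C T x) \<and>
     (\<forall>x\<in>V. nW (T x) = nV x)"

end

theory Submission
  imports Defs "Jordan_Normal_Form.Char_Poly" "HOL-Complex_Analysis.Complex_Analysis"
    "HOL-Real_Asymp.Real_Asymp"
begin

text \<open>Put \<open>A = T (1, 0)\<close> and \<open>B = T (0, 1)\<close>. If \<open>T\<close> were isometric, then \<open>Tr |A + zB|\<^sup>p\<close> would be at most
  \<open>1 + |z|\<^sup>w\<close> for some \<open>w > 2\<close> and small \<open>z\<close>. On the other hand, for \<open>p \<le> 2\<close> the mean of
  \<open>Tr |A + zB|\<^sup>p\<close> over the circle \<open>|z| = t\<close> exceeds \<open>Tr |A|\<^sup>p\<close> by at least a constant times \<open>t\<^sup>2\<close>, a contradiction.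

  For \<open>p < 2\<close> one writes \<open>Tr |X|\<^sup>p\<close> as an integral over \<open>s > 0\<close> of \<open>ln det (1 + s X\<^sup>* X)\<close> against
  \<open>s\<^bsup>-p/2-1\<^esup> ds\<close>; for \<open>p = 2\<close> one lets \<open>s\<close> tend to 0. With \<open>F = (1, sqrt s (A + zB))\<close> the determinant is
  \<open>det (F\<^sup>* F)\<close>, and \<open>|det (R\<^sup>* F)|\<^sup>2 \<le> det (R\<^sup>* R) det (F\<^sup>* F)\<close> for every \<open>R\<close>. For a suitable \<open>R\<close> depending on \<open>z\<close>,
  \<open>R\<^sup>* F\<close> is holomorphic on the circle with value \<open>S\<close> at 0, and \<open>R\<^sup>* R = S\<close>, where \<open>S\<close> is \<open>1 + s A\<^sup>* A\<close> plus a
  rank-one term of size \<open>t\<^sup>2\<close>; Jensen's inequality then bounds the mean of \<open>ln det (F\<^sup>* F)\<close>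
  below by \<open>ln det S\<close>. Infinite dimensions are reached by compressing to finitely many singular vectors of \<open>A\<close>,
  which does not increase \<open>Tr |A + zB|\<^sup>p\<close>.\<close>

subsection \<open>Determinants and positive quadratic forms\<close>

text \<open>For \<open>p < 1\<close> there is no triangle inequality, so log-determinants take the
  place of the norm throughout. If \<open>R\<close> were the value of F at 0, then S would be 1 + s
  A^* A and only the mean-value inequality without any gain would result. The gain comes from
  tilting \<open>R\<close> into the orthogonal complement of the range of F(0): the vector (-sqrt s
  A^* c, c) is orthogonal to every (w, sqrt s A w), so the terms with the conjugate of z cancel,
  while the tilt paired with the term z B of F produces z times its conjugate, which is the constant
  t^2 on the circle. For c one takes B x with some x not killed by B. A gain of order t^2 suffices
  because the p-th power of the norm of (1, z) exceeds 1 by O(|z|^w) with w > 2. The values p < 2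
  are those for which ln (1 + s) is integrable against s^(-p/2-1) at 0. The statements about S_q
  reduce to the one about the two-dimensional sequence space, because diagonal operators over two
  orthonormal vectors are an isometric copy of it.\<close>

definition fdet :: "nat \<Rightarrow> (nat \<Rightarrow> nat \<Rightarrow> complex) \<Rightarrow> complex" where
  "fdet n P = Determinant.det (mat n n (\<lambda>(i, j). P i j))"

text \<open>Matrices and vectors are functions on \<open>nat\<close> of which only the indices below
  \<open>n\<close> count. The size is then an ordinary term, as it has to be: it will be the number
  of chosen singular vectors plus one.\<close>

definition app :: "nat \<Rightarrow> (nat \<Rightarrow> nat \<Rightarrow> complex) \<Rightarrow> (nat \<Rightarrow> complex) \<Rightarrow> nat \<Rightarrow> complex" where
  "app n P x i = (\<Sum>j<n. P i j * x j)"

definition qform :: "nat \<Rightarrow> (nat \<Rightarrow> nat \<Rightarrow> complex) \<Rightarrow> (nat \<Rightarrow> complex) \<Rightarrow> complex" where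
  "qform n P x = (\<Sum>i<n. app n P x i * cnj (x i))"

text \<open>Over the complex numbers a form with real values comes from a Hermitian matrix, so the
  condition on the imaginary part replaces one on the entries.\<close>

definition pos_def :: "nat \<Rightarrow> (nat \<Rightarrow> nat \<Rightarrow> complex) \<Rightarrow> bool" where
  "pos_def n P \<longleftrightarrow> (\<forall>x. (\<exists>i<n. x i \<noteq> 0) \<longrightarrow> Im (qform n P x) = 0 \<and> 0 < Re (qform n P x))"

lemma fdet_cong: "(\<And>i j. i < n \<Longrightarrow> j < n \<Longrightarrow> P i j = Q i j) \<Longrightarrow> fdet n P = fdet n Q"
  unfolding fdet_def by (rule arg_cong[of _ _ Determinant.det]) (auto intro!: eq_matI)

lemma fdet_leibniz:
  "fdet n P = (\<Sum>\<pi> | \<pi> permutes {0..<n}. signof \<pi> * (\<Prod>i = 0..<n. P i (\<pi> i)))"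
  unfolding fdet_def by (subst det_def'[of _ n]) (auto intro!: sum.cong prod.cong)

lemma continuous_on_fdet [continuous_intros]:
  assumes "\<And>i j. i < n \<Longrightarrow> j < n \<Longrightarrow> continuous_on T (\<lambda>t. P t i j)"
  shows "continuous_on T (\<lambda>t. fdet n (P t))"
  unfolding fdet_leibniz
  by (auto intro!: continuous_intros assms dest: permutes_in_image)

lemma fdet_cnj_transpose: "fdet n (\<lambda>i j. cnj (P j i)) = cnj (fdet n P)"
proof -
  have "fdet n (\<lambda>i j. cnj (P j i)) = fdet n (\<lambda>i j. cnj (P i j))"
    unfolding fdet_def
    by (subst det_transpose[symmetric, of _ n]) (auto intro!: arg_cong[of _ _ Determinant.det] eq_matI)
  also have "\<dots> = cnj (fdet n P)"
    unfolding fdet_leibniz by (auto simp: cnj_sum sign_def intro!: sum.cong)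
  finally show ?thesis .
qed

lemma fdet_diagonal: "fdet n (\<lambda>i j. if i = j then d i else 0) = (\<Prod>i<n. d i)"
  unfolding fdet_def
  by (subst det_upper_triangular[of _ n])
     (auto simp: upper_triangular_def prod_list_diag_prod atLeast0LessThan)

lemma fdet_mult:
  "fdet n (\<lambda>i j. \<Sum>k<n. P i k * Q k j) = fdet n P * fdet n Q"
proof -
  have "mat n n (\<lambda>(i, j). \<Sum>k<n. P i k * Q k j) = mat n n (\<lambda>(i, j). P i j) * mat n n (\<lambda>(i, j). Q i j)"
    by (auto intro!: eq_matI simp: scalar_prod_def atLeast0LessThan)
  then show ?thesis
    unfolding fdet_def by (simp add: det_mult[of _ n])
qed

lemma app_mult: "app n (\<lambda>i j. \<Sum>k<n. P i k * Q k j) x i = app n P (app n Q x) i"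
  unfolding app_def sum_distrib_left sum_distrib_right
  by (subst sum.swap) (simp add: mult.assoc)

text \<open>\<open>K\<close> is P^-1 Q. An eigenvector of \<open>K\<close> for e satisfies Q x = e P
  x; in this way comparisons of quadratic forms become comparisons of determinants.\<close>

lemma fdet_right_quotient:
  assumes "fdet n P \<noteq> 0"
  obtains K where "\<forall>i<n. \<forall>j<n. Q i j = (\<Sum>k<n. P i k * K k j)"
proof -
  define M where "M = mat n n (\<lambda>(i, j). P i j)"
  have M: "M \<in> carrier_mat n n" by (simp add: M_def)
  from det_non_zero_imp_unit[OF M] assms have "M \<in> Units (ring_mat TYPE(complex) n ())"
    by (simp add: fdet_def M_def)
  then obtain R where R: "R \<in> carrier_mat n n" "M * R = 1\<^sub>m n"
    by (auto simp: Units_def ring_mat_def)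
  define N where "N = R * mat n n (\<lambda>(i, j). Q i j)"
  have N: "N \<in> carrier_mat n n" using R by (simp add: N_def)
  have "M * N = M * R * mat n n (\<lambda>(i, j). Q i j)"
    unfolding N_def by (rule assoc_mult_mat[OF M R(1), symmetric, of _ n]) simp
  then have MN: "M * N = mat n n (\<lambda>(i, j). Q i j)" unfolding R(2) by simp
  have "Q i j = (\<Sum>k<n. P i k * N $$ (k, j))" if "i < n" "j < n" for i j
  proof -
    have "(M * N) $$ (i, j) = (\<Sum>k<n. P i k * N $$ (k, j))"
      using that N by (simp add: scalar_prod_def atLeast0LessThan M_def)
    with that show ?thesis unfolding MN by simp
  qed
  then show thesis by (intro that allI impI)
qed

lemma fdet_solve:
  assumes "fdet n P \<noteq> 0"
  obtains y where "\<And>i. i < n \<Longrightarrow> app n P y i = a i"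
proof -
  obtain K where K: "\<forall>i<n. \<forall>j<n. a i = (\<Sum>k<n. P i k * K k j)"
    using fdet_right_quotient[OF assms, of "\<lambda>i j. a i"] .
  show thesis
  proof (rule that)
    fix i assume "i < n"
    then have "0 < n" by simp
    with K[rule_format, OF \<open>i < n\<close>, of 0] show "app n P (\<lambda>k. K k 0) i = a i"
      by (simp add: app_def)
  qed
qed

text \<open>The characteristic polynomial splits, and \<open>es\<close> lists its roots with
  multiplicity. The product formula in \<open>z\<close> is the input for Jensen's inequality; the
  eigenvectors serve to locate the eigenvalues by means of quadratic forms.\<close>

lemma fdet_eigenvalues:
  obtains es where "length es = n"
    and "\<And>z. fdet n (\<lambda>i j. (if i = j then 1 else 0) + z * P i j) = (\<Prod>e\<leftarrow>es. 1 + z * e)"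
    and "fdet n P = prod_list es"
    and "\<And>e. e \<in> set es \<Longrightarrow> \<exists>x. (\<exists>i<n. x i \<noteq> 0) \<and> (\<forall>i<n. app n P x i = e * x i)"
proof -
  define M where "M = mat n n (\<lambda>(i, j). P i j)"
  have M: "M \<in> carrier_mat n n" by (simp add: M_def)
  obtain es where es: "char_poly M = (\<Prod>a\<leftarrow>es. [:- a, 1:])" "length es = n"
    using char_poly_factorized[OF M] by blast
  have char: "Determinant.det (- char_matrix M k) = (\<Prod>e\<leftarrow>es. k - e)" for k
  proof -
    have "Determinant.det (- char_matrix M k) = poly (char_poly M) k"
      using char_poly_matrix[OF M] by simp
    also have "\<dots> = (\<Prod>e\<leftarrow>es. k - e)"
      unfolding es(1) by (induction es) (simp_all add: poly_prod_list algebra_simps)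
    finally show ?thesis .
  qed
  have shift: "fdet n (\<lambda>i j. (if i = j then 1 else 0) + z * P i j) = (\<Prod>e\<leftarrow>es. 1 + z * e)" for z
  proof (cases "z = 0")
    case True
    have "(\<Prod>e\<leftarrow>es. 1 + z * e) = 1"
      unfolding True by (induction es) auto
    then show ?thesis using True fdet_diagonal[of n "\<lambda>_. 1"] by simp
  next
    case False
    \<comment> \<open>With k = -1/z the matrix 1 + z P is -z (k - P), so its determinant is (-z)^n
      times the characteristic polynomial at k.\<close>
    have "mat n n (\<lambda>(i, j). (if i = j then 1 else 0) + z * P i j) = (- z) \<cdot>\<^sub>m (- char_matrix M (- 1 / z))"
      using False by (auto intro!: eq_matI simp: char_matrix_def M_def algebra_simps)
    then have "fdet n (\<lambda>i j. (if i = j then 1 else 0) + z * P i j)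
        = (- z) ^ n * (\<Prod>e\<leftarrow>es. - 1 / z - e)"
      unfolding fdet_def using char[of "- 1 / z"] M by (simp add: char_matrix_def)
    also have "\<dots> = (\<Prod>e\<leftarrow>es. 1 + z * e)"
      unfolding es(2)[symmetric] using False
      by (induction es) (simp_all add: field_simps)
    finally show ?thesis .
  qed
  have "fdet n P = prod_list es"
  proof -
    have "Determinant.det M = (- 1) ^ n * Determinant.det (- char_matrix M 0)"
    proof -
      have "M = (- 1) \<cdot>\<^sub>m (- char_matrix M 0)"
        using M by (auto intro!: eq_matI simp: char_matrix_def)
      then have "Determinant.det M = Determinant.det ((- 1) \<cdot>\<^sub>m (- char_matrix M 0))" by simp
      then show ?thesis using M by (simp add: char_matrix_def)
    qed
    also have "\<dots> = prod_list es"
      unfolding char es(2)[symmetric] by (induction es) simp_all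
    finally show ?thesis by (simp add: fdet_def M_def)
  qed
  moreover have "\<exists>x. (\<exists>i<n. x i \<noteq> 0) \<and> (\<forall>i<n. app n P x i = e * x i)" if "e \<in> set es" for e
  proof -
    have "poly (char_poly M) e = 0"
      using that unfolding es(1) by (induction es) auto
    then have "eigenvalue M e" using eigenvalue_root_char_poly[OF M] by simp
    then obtain v where v: "v \<in> carrier_vec n" "v \<noteq> 0\<^sub>v n" "M *\<^sub>v v = e \<cdot>\<^sub>v v"
      using M unfolding eigenvalue_def eigenvector_def by auto
    have "\<exists>i<n. vec_index v i \<noteq> 0"
    proof (rule ccontr)
      assume "\<not> ?thesis"
      then have "v = 0\<^sub>v n" using v(1) by (intro eq_vecI) auto
      with v(2) show False by contradiction
    qed
    moreover have "app n P (vec_index v) i = e * vec_index v i" if "i < n" for i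
      using arg_cong[OF v(3), of "\<lambda>w. vec_index w i"] that v(1)
      by (simp add: app_def M_def scalar_prod_def atLeast0LessThan)
    ultimately show ?thesis by blast
  qed
  ultimately show thesis using that es(2) shift by blast
qed

lemma qform_eigen:
  assumes "\<And>i. i < n \<Longrightarrow> app n P x i = e * app n Q x i"
  shows "qform n P x = e * qform n Q x"
  using assms by (simp add: qform_def sum_distrib_left mult.assoc)

lemma prod_list_real_ge_1:
  assumes "\<And>e. e \<in> set es \<Longrightarrow> \<exists>r\<ge>1. e = complex_of_real r"
  obtains r where "prod_list es = complex_of_real r" "1 \<le> r"
  using assms
proof (induction es arbitrary: thesis)
  case Nil
  show ?case using Nil(1)[of 1] by simp
next
  case (Cons e es)
  obtain r where r: "prod_list es = complex_of_real r" "1 \<le> r"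
    using Cons.IH Cons.prems(2) by auto
  obtain q where q: "e = complex_of_real q" "1 \<le> q"
    using Cons.prems(2) by auto
  show ?case
    using Cons.prems(1)[of "q * r"] q r mult_mono[of 1 q 1 r] by simp
qed

lemma prod_list_real_pos:
  assumes "\<And>e. e \<in> set es \<Longrightarrow> \<exists>r>0. e = complex_of_real r"
  obtains r where "prod_list es = complex_of_real r" "0 < r"
  using assms
proof (induction es arbitrary: thesis)
  case Nil
  show ?case using Nil(1)[of 1] by simp
next
  case (Cons e es)
  obtain r where r: "prod_list es = complex_of_real r" "0 < r"
    using Cons.IH Cons.prems(2) by auto
  obtain q where q: "e = complex_of_real q" "0 < q"
    using Cons.prems(2) by auto
  show ?case
    using Cons.prems(1)[of "q * r"] q r by simp
qed

text \<open>At an eigenvector the form is e times the squared length, so every eigenvalue is real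
  and positive, and the determinant is their product.\<close>

lemma pos_def_fdet:
  assumes "pos_def n P"
  obtains r where "fdet n P = complex_of_real r" "0 < r"
proof -
  obtain es where es: "fdet n P = prod_list es"
      "\<And>e. e \<in> set es \<Longrightarrow> \<exists>x. (\<exists>i<n. x i \<noteq> 0) \<and> (\<forall>i<n. app n P x i = e * x i)"
    by (rule fdet_eigenvalues[of n P], rule that)
  have "\<exists>r>0. e = complex_of_real r" if "e \<in> set es" for e
  proof -
    obtain x where x: "\<exists>i<n. x i \<noteq> 0" "\<forall>i<n. app n P x i = e * x i"
      using es(2) \<open>e \<in> set es\<close> by blast
    define r where "r = (\<Sum>i<n. (cmod (x i))\<^sup>2)"
    have "0 < r"
      unfolding r_def using x(1) by (auto intro!: sum_pos2)
    have eq: "qform n P x = e * of_real r"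
      unfolding qform_def r_def using x(2)
      by (simp add: sum_distrib_left mult.assoc complex_norm_square del: of_real_power)
    have "Im (qform n P x) = 0" "0 < Re (qform n P x)"
      using assms x(1) unfolding pos_def_def by auto
    then have "Im e = 0" "0 < Re e"
      using \<open>0 < r\<close> by (auto simp: eq zero_less_mult_iff)
    then show ?thesis by (auto simp: complex_eq_iff intro!: exI[of _ "Re e"])
  qed
  then obtain r where "prod_list es = complex_of_real r" "0 < r"
    by (rule prod_list_real_pos)
  then show thesis using that[of r] es(1) by simp
qed

text \<open>P^-1 Q is in general not Hermitian, but each of its eigenvalues is the quotient of the
  two forms at an eigenvector, hence real and at least 1. Their product is det Q / det P.\<close>

lemma fdet_mono:
  assumes P: "pos_def n P"
    and Q: "\<And>x. Im (qform n Q x) = 0 \<and> Re (qform n P x) \<le> Re (qform n Q x)"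
  obtains r where "fdet n Q = complex_of_real r * fdet n P" "1 \<le> r"
proof -
  have "fdet n P \<noteq> 0" using pos_def_fdet[OF P] by force
  then obtain K where K: "\<forall>i<n. \<forall>j<n. Q i j = (\<Sum>k<n. P i k * K k j)"
    by (rule fdet_right_quotient)
  have app: "app n Q x i = app n P (app n K x) i" if "i < n" for x i
    unfolding app_mult[symmetric] using K that by (simp add: app_def)
  have det: "fdet n Q = fdet n P * fdet n K"
    unfolding fdet_mult[symmetric] using K by (intro fdet_cong) auto
  obtain es where es: "fdet n K = prod_list es"
      "\<And>e. e \<in> set es \<Longrightarrow> \<exists>x. (\<exists>i<n. x i \<noteq> 0) \<and> (\<forall>i<n. app n K x i = e * x i)"
    by (rule fdet_eigenvalues[of n K], rule that)
  have "\<exists>r\<ge>1. e = complex_of_real r" if "e \<in> set es" for e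
  proof -
    obtain x where x: "\<exists>i<n. x i \<noteq> 0" "\<forall>i<n. app n K x i = e * x i"
      using es(2) \<open>e \<in> set es\<close> by blast
    have "app n Q x i = e * app n P x i" if "i < n" for i
      unfolding app[OF that] using x(2)
      by (simp add: app_def sum_distrib_left algebra_simps)
    then have eq: "qform n Q x = e * qform n P x" by (rule qform_eigen)
    have p: "Im (qform n P x) = 0" "0 < Re (qform n P x)"
      using P x(1) unfolding pos_def_def by auto
    have "Im e = 0" using Q[of x] p by (simp add: eq)
    moreover have "1 * Re (qform n P x) \<le> Re e * Re (qform n P x)"
      using Q[of x] p by (simp add: eq)
    then have "1 \<le> Re e" using p(2) by (simp only: mult_le_cancel_right_pos)
    ultimately show ?thesis
      by (auto simp: complex_eq_iff intro!: exI[of _ "Re e"])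
  qed
  then obtain r where "prod_list es = complex_of_real r" "1 \<le> r"
    by (rule prod_list_real_ge_1)
  then show thesis using that[of r] det es(1) by (simp add: mult.commute)
qed

text \<open>Sylvester's identity det (1 + A B) = det (1 + B A) for a column A and a row B: the block
  matrix with rows (1, -A) and (B, 1) is factored in two ways into block triangular matrices, and B
  A is a single number.\<close>

lemma fdet_identity_plus_rank_one:
  "fdet n (\<lambda>i j. (if i = j then 1 else 0) + a i * b j) = 1 + (\<Sum>i<n. a i * b i)"
proof -
  define A where "A = mat n 1 (\<lambda>(i, _). a i)"
  define B where "B = mat 1 n (\<lambda>(_, j). b j)"
  have [simp]: "A \<in> carrier_mat n 1" "B \<in> carrier_mat 1 n" "B * A \<in> carrier_mat 1 1"
      "1\<^sub>m 1 + B * A \<in> carrier_mat 1 1" "1\<^sub>m n + A * B \<in> carrier_mat n n"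
    by (auto simp: A_def B_def)
  let ?L1 = "four_block_mat (1\<^sub>m n) (0\<^sub>m n 1) B (1\<^sub>m 1)"
  let ?L2 = "four_block_mat (1\<^sub>m n) (- A) (0\<^sub>m 1 n) (1\<^sub>m 1 + B * A)"
  let ?R1 = "four_block_mat (1\<^sub>m n) (- A) (0\<^sub>m 1 n) (1\<^sub>m 1)"
  let ?R2 = "four_block_mat (1\<^sub>m n + A * B) (0\<^sub>m n 1) B (1\<^sub>m 1)"
  have "?L1 * ?L2 = four_block_mat (1\<^sub>m n * 1\<^sub>m n + 0\<^sub>m n 1 * 0\<^sub>m 1 n)
      (1\<^sub>m n * - A + 0\<^sub>m n 1 * (1\<^sub>m 1 + B * A)) (B * 1\<^sub>m n + 1\<^sub>m 1 * 0\<^sub>m 1 n)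
      (B * - A + 1\<^sub>m 1 * (1\<^sub>m 1 + B * A))"
    by (rule mult_four_block_mat[of _ n n _ 1 _ 1 _ _ n _ 1]) (simp_all del: One_nat_def)
  moreover have "1\<^sub>m n * 1\<^sub>m n + 0\<^sub>m n 1 * 0\<^sub>m 1 n = (1\<^sub>m n :: complex mat)"
      "1\<^sub>m n * - A + 0\<^sub>m n 1 * (1\<^sub>m 1 + B * A) = - A"
      "B * 1\<^sub>m n + 1\<^sub>m 1 * 0\<^sub>m 1 n = B" "B * - A + 1\<^sub>m 1 * (1\<^sub>m 1 + B * A) = 1\<^sub>m 1"
    by (rule eq_matI; simp add: A_def B_def scalar_prod_def sum_negf del: One_nat_def)+
  ultimately have L: "?L1 * ?L2 = four_block_mat (1\<^sub>m n) (- A) B (1\<^sub>m 1)" by (simp only:)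
  have "?R1 * ?R2 = four_block_mat (1\<^sub>m n * (1\<^sub>m n + A * B) + - A * B)
      (1\<^sub>m n * 0\<^sub>m n 1 + - A * 1\<^sub>m 1) (0\<^sub>m 1 n * (1\<^sub>m n + A * B) + 1\<^sub>m 1 * B)
      (0\<^sub>m 1 n * 0\<^sub>m n 1 + 1\<^sub>m 1 * 1\<^sub>m 1)"
    by (rule mult_four_block_mat[of _ n n _ 1 _ 1 _ _ n _ 1]) (simp_all del: One_nat_def)
  moreover have "1\<^sub>m n * (1\<^sub>m n + A * B) + - A * B = 1\<^sub>m n"
      "1\<^sub>m n * 0\<^sub>m n 1 + - A * 1\<^sub>m 1 = - A"
      "0\<^sub>m 1 n * (1\<^sub>m n + A * B) + 1\<^sub>m 1 * B = B"
      "0\<^sub>m 1 n * 0\<^sub>m n 1 + 1\<^sub>m 1 * 1\<^sub>m 1 = (1\<^sub>m 1 :: complex mat)"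
    by (rule eq_matI; simp add: A_def B_def scalar_prod_def del: One_nat_def)+
  ultimately have R: "?R1 * ?R2 = four_block_mat (1\<^sub>m n) (- A) B (1\<^sub>m 1)" by (simp only:)
  have c: "?L1 \<in> carrier_mat (n + 1) (n + 1)" "?L2 \<in> carrier_mat (n + 1) (n + 1)"
      "?R1 \<in> carrier_mat (n + 1) (n + 1)" "?R2 \<in> carrier_mat (n + 1) (n + 1)"
    by (rule four_block_carrier_mat; simp del: One_nat_def)+
  have "Determinant.det ?L1 * Determinant.det ?L2 = Determinant.det ?R1 * Determinant.det ?R2"
    unfolding det_mult[OF c(1,2), symmetric] det_mult[OF c(3,4), symmetric] L R ..
  moreover have "Determinant.det ?L1 = Determinant.det (1\<^sub>m n :: complex mat) * Determinant.det (1\<^sub>m 1 :: complex mat)"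
    by (rule det_four_block_mat_upper_right_zero[of _ n _ 1]) (simp_all del: One_nat_def)
  moreover have "Determinant.det ?R1 = Determinant.det (1\<^sub>m n :: complex mat) * Determinant.det (1\<^sub>m 1 :: complex mat)"
    by (rule det_four_block_mat_lower_left_zero[of _ n _ 1]) (simp_all del: One_nat_def)
  moreover have "Determinant.det ?L2 = Determinant.det (1\<^sub>m n :: complex mat) * Determinant.det (1\<^sub>m 1 + B * A)"
    by (rule det_four_block_mat_lower_left_zero[of _ n _ 1]) (simp_all del: One_nat_def)
  moreover have "Determinant.det ?R2 = Determinant.det (1\<^sub>m n + A * B) * Determinant.det (1\<^sub>m 1 :: complex mat)"
    by (rule det_four_block_mat_upper_right_zero[of _ n _ 1]) (simp_all del: One_nat_def)
  ultimately have "Determinant.det (1\<^sub>m 1 + B * A) = Determinant.det (1\<^sub>m n + A * B)" by simp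
  moreover have "Determinant.det (1\<^sub>m 1 + B * A) = 1 + (\<Sum>i<n. a i * b i)"
    by (subst det_upper_triangular[of _ 1])
       (auto simp: upper_triangular_def diag_mat_def A_def B_def scalar_prod_def atLeast0LessThan mult.commute)
  moreover have "mat n n (\<lambda>(i, j). (if i = j then 1 else 0) + a i * b j) = 1\<^sub>m n + A * B"
    by (auto intro!: eq_matI simp: A_def B_def scalar_prod_def)
  ultimately show ?thesis by (simp add: fdet_def)
qed

text \<open>As \<open>y\<close> is a solution of P y = a, the matrix P + a b factors as P (1 + y
  b).\<close>

lemma fdet_plus_rank_one:
  assumes "\<And>i. i < n \<Longrightarrow> app n P y i = a i"
  shows "fdet n (\<lambda>i j. P i j + a i * b j) = fdet n P * (1 + (\<Sum>i<n. y i * b i))"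
proof -
  have "fdet n (\<lambda>i j. P i j + a i * b j)
      = fdet n (\<lambda>i j. \<Sum>k<n. P i k * ((if k = j then 1 else 0) + y k * b j))"
  proof (rule fdet_cong)
    fix i j assume "i < n" "j < n"
    then show "P i j + a i * b j = (\<Sum>k<n. P i k * ((if k = j then 1 else 0) + y k * b j))"
      unfolding assms[OF \<open>i < n\<close>, symmetric]
      by (simp add: app_def distrib_left sum.distrib sum_distrib_right if_distrib[of "\<lambda>x. _ * x"] mult.assoc cong: if_cong)
  qed
  then show ?thesis
    by (simp add: fdet_mult fdet_identity_plus_rank_one)
qed

text \<open>A right inverse of the transpose of \<open>P\<close>, transposed back, is a left inverse
  of \<open>P\<close>.\<close>

lemma fdet_inj:
  assumes "fdet n P \<noteq> 0" "\<And>i. i < n \<Longrightarrow> app n P x i = 0" "j < n"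
  shows "x j = 0"
proof -
  have "fdet n (\<lambda>i j. P j i) = fdet n P"
    using fdet_cnj_transpose[of n "\<lambda>i j. cnj (P i j)"] unfolding fdet_leibniz
    by (simp add: cnj_sum)
  then have "fdet n (\<lambda>i j. P j i) \<noteq> 0" using assms(1) by simp
  then obtain K where K: "\<forall>i<n. \<forall>j<n. (if i = j then 1 else 0) = (\<Sum>k<n. P k i * K k j)"
    by (rule fdet_right_quotient)
  have "x j = (\<Sum>i<n. (if i = j then 1 else 0) * x i)"
    using \<open>j < n\<close> by (simp add: if_distrib[of "\<lambda>c. c * _"] cong: if_cong)
  also have "\<dots> = (\<Sum>i<n. \<Sum>k<n. K k j * (P k i * x i))"
    by (intro sum.cong refl) (use \<open>j < n\<close> in \<open>simp add: K sum_distrib_left sum_distrib_right mult_ac\<close>)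
  also have "\<dots> = (\<Sum>k<n. K k j * app n P x k)"
    by (subst sum.swap) (simp add: app_def sum_distrib_left)
  also have "\<dots> = 0" using assms(2) by simp
  finally show ?thesis .
qed

text \<open>Since \<open>w = S\<^sup>-\<^sup>1 \<Gamma> x\<close>, the hypothesis says \<open>\<Gamma>\<^sup>* S\<^sup>-\<^sup>1 \<Gamma> \<le> \<Phi>\<close> as quadratic forms.\<close>

lemma cmod_fdet_sq_le:
  assumes S: "pos_def n S" and \<Phi>: "pos_def n \<Phi>" "\<And>x. Im (qform n \<Phi> x) = 0"
    and le: "\<And>x w. (\<And>i. i < n \<Longrightarrow> app n S w i = app n \<Gamma> x i) \<Longrightarrow>
      Im (qform n S w) = 0 \<and> Re (qform n S w) \<le> Re (qform n \<Phi> x)"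
  shows "(cmod (fdet n \<Gamma>))\<^sup>2 \<le> Re (fdet n S) * Re (fdet n \<Phi>)"
proof (cases "fdet n \<Gamma> = 0")
  case True
  obtain r q where "fdet n S = complex_of_real r" "0 < r" "fdet n \<Phi> = complex_of_real q" "0 < q"
    using pos_def_fdet[OF S] pos_def_fdet[OF \<Phi>(1)] by metis
  then show ?thesis using True by simp
next
  case False
  obtain s where s: "fdet n S = complex_of_real s" "0 < s" using pos_def_fdet[OF S] .
  then have "fdet n S \<noteq> 0" by auto
  then obtain K where K: "\<forall>i<n. \<forall>j<n. \<Gamma> i j = (\<Sum>k<n. S i k * K k j)"
    by (rule fdet_right_quotient)
  have det: "fdet n \<Gamma> = fdet n S * fdet n K"
    unfolding fdet_mult[symmetric] using K by (intro fdet_cong) auto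
  \<comment> \<open>This is \<Gamma>^* S^-1 \<Gamma>, so det P det S = |det \<Gamma>|^2 and it
    remains to compare det P with det \<Phi>. Positive definiteness of \<open>P\<close> uses that
    \<Gamma> is injective in this case.\<close>
  define P where "P i j = (\<Sum>k<n. cnj (\<Gamma> k i) * K k j)" for i j
  have "fdet n P = cnj (fdet n \<Gamma>) * fdet n K"
    unfolding P_def fdet_mult fdet_cnj_transpose ..
  then have detP: "fdet n P * fdet n S = complex_of_real ((cmod (fdet n \<Gamma>))\<^sup>2)"
    by (simp add: det complex_norm_square mult_ac del: of_real_power)
  have app: "app n S (app n K x) i = app n \<Gamma> x i" if "i < n" for x i
    unfolding app_mult[symmetric] using K that by (simp add: app_def)
  have form: "qform n P x = cnj (qform n S (app n K x))" for x
  proof -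
    have "qform n P x = (\<Sum>i<n. \<Sum>k<n. cnj (\<Gamma> k i) * app n K x k * cnj (x i))"
      unfolding qform_def P_def app_mult unfolding app_def[of n "\<lambda>i k. cnj (\<Gamma> k i)"]
      by (simp add: sum_distrib_right)
    also have "\<dots> = (\<Sum>k<n. app n K x k * cnj (app n \<Gamma> x k))"
      by (subst sum.swap) (simp add: app_def[of n \<Gamma>] cnj_sum sum_distrib_left mult_ac)
    also have "\<dots> = cnj (qform n S (app n K x))"
      unfolding qform_def cnj_sum using app by (intro sum.cong) (auto simp: mult.commute)
    finally show ?thesis .
  qed
  have "pos_def n P"
    unfolding pos_def_def
  proof (intro allI impI)
    fix x :: "nat \<Rightarrow> complex" assume x: "\<exists>i<n. x i \<noteq> 0"
    have "\<exists>i<n. app n K x i \<noteq> 0"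
    proof (rule ccontr)
      assume "\<not> ?thesis"
      then have "app n S (app n K x) i = 0" for i by (simp add: app_def[of n S])
      then have "app n \<Gamma> x i = 0" if "i < n" for i using app that by metis
      then show False using fdet_inj[OF False, of x] x by blast
    qed
    then show "Im (qform n P x) = 0 \<and> 0 < Re (qform n P x)"
      using S unfolding pos_def_def form by simp
  qed
  moreover have "Im (qform n \<Phi> x) = 0 \<and> Re (qform n P x) \<le> Re (qform n \<Phi> x)" for x
    using \<Phi>(2) le[of "app n K x" x] app by (simp add: form)
  ultimately obtain r where r: "fdet n \<Phi> = complex_of_real r * fdet n P" "1 \<le> r"
    by (rule fdet_mono)
  obtain q where q: "fdet n P = complex_of_real q" "0 < q"
    using pos_def_fdet[OF \<open>pos_def n P\<close>] .
  have "(cmod (fdet n \<Gamma>))\<^sup>2 = q * s"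
    using detP unfolding q(1) s(1) of_real_mult[symmetric] of_real_eq_iff by simp
  also have "\<dots> \<le> s * (r * q)" using r(2) q(2) s(2) by simp
  finally show ?thesis by (simp add: r(1) q(1) s(1))
qed

section \<open>Jensen's inequality on the unit circle\<close>

definition circ :: "real \<Rightarrow> complex" where
  "circ \<theta> = exp (2 * of_real pi * \<i> * of_real \<theta>)"

lemma circ_simps [simp]: "cmod (circ \<theta>) = 1" "circ \<theta> \<noteq> 0" "cnj (circ \<theta>) = inverse (circ \<theta>)"
proof -
  show *: "cmod (circ \<theta>) = 1" by (simp add: circ_def norm_exp_eq_Re)
  then show "circ \<theta> \<noteq> 0" by auto
  then show "cnj (circ \<theta>) = inverse (circ \<theta>)"
    using complex_norm_square[of "circ \<theta>"] * by (simp add: field_simps)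
qed

lemma continuous_on_circ [continuous_intros]:
  "continuous_on T f \<Longrightarrow> continuous_on T (\<lambda>x. circ (f x))"
  unfolding circ_def by (intro continuous_intros)

text \<open>Cauchy's integral formula at the centre. The circle is parametrised over the unit
  interval, so the integral is already a mean.\<close>

lemma circle_mean_value:
  assumes "f holomorphic_on ball 0 R" "1 < R"
  shows "((\<lambda>\<theta>. f (circ \<theta>)) has_integral f 0) {0..1}"
proof -
  have "((\<lambda>u. f u / (u - 0)) has_contour_integral (2 * of_real pi * \<i> * f 0)) (circlepath 0 1)"
  proof (rule Cauchy_integral_circlepath)
    have "cball 0 1 \<subseteq> ball (0::complex) R" using \<open>1 < R\<close> by auto
    then have "f holomorphic_on cball 0 1" using assms(1) by (rule holomorphic_on_subset[rotated])
    then show "continuous_on (cball 0 1) f" "f holomorphic_on ball 0 1"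
      by (auto intro: holomorphic_on_imp_continuous_on elim: holomorphic_on_subset)
  qed auto
  then have "((\<lambda>x. f (circlepath 0 1 x) / (circlepath 0 1 x - 0)
      * vector_derivative (circlepath 0 1) (at x within {0..1})) has_integral 2 * of_real pi * \<i> * f 0) {0..1}"
    by (simp add: has_contour_integral_def)
  also have "?this \<longleftrightarrow> ((\<lambda>x. 2 * of_real pi * \<i> * f (circ x)) has_integral 2 * of_real pi * \<i> * f 0) {0..1}"
  proof (rule has_integral_cong)
    fix x :: real assume "x \<in> {0..1}"
    moreover have "circlepath 0 1 x = circ x" by (simp add: circlepath circ_def)
    ultimately show "f (circlepath 0 1 x) / (circlepath 0 1 x - 0)
        * vector_derivative (circlepath 0 1) (at x within {0..1}) = 2 * of_real pi * \<i> * f (circ x)"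
      by (simp add: vector_derivative_circlepath01 circ_def[symmetric])
  qed
  finally have "((\<lambda>x. 2 * of_real pi * \<i> * f (circ x)) has_integral 2 * of_real pi * \<i> * f 0) {0..1}" .
  from has_integral_mult_right[OF this, of "1 / (2 * of_real pi * \<i>)"] show ?thesis
    by simp
qed

text \<open>The factor \<open>r\<close> keeps the zeros of the product off the closed disc: each
  factor stays in the right half-plane there, the sum of the principal logarithms is holomorphic,
  vanishes at 0, and has the logarithm of the modulus as its real part.\<close>

lemma ln_product_circle_mean:
  fixes w :: "nat \<Rightarrow> complex" and r :: real
  assumes "\<And>i. i < n \<Longrightarrow> cmod (w i) \<le> 1" "0 < r" "r < 1"
  shows "((\<lambda>\<theta>. ln (\<Prod>i<n. cmod (1 + r * w i * circ \<theta>))) has_integral 0) {0..1}"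
proof -
  define f where "f z = (\<Sum>i<n. Ln (1 + r * w i * z))" for z
  have small: "cmod (r * w i * z) < 1" if "i < n" "z \<in> ball 0 (1 / r)" for i z
  proof -
    have "cmod (r * w i * z) = r * cmod (w i) * cmod z"
      using \<open>0 < r\<close> by (simp add: norm_mult)
    also have "\<dots> \<le> r * 1 * cmod z"
      using assms that by (intro mult_left_mono mult_right_mono) auto
    also have "\<dots> < 1" using that(2) \<open>0 < r\<close> by (simp add: field_simps)
    finally show ?thesis .
  qed
  have pos: "0 < Re (1 + r * w i * z)" if "i < n" "z \<in> ball 0 (1 / r)" for i z
    using small[OF that] abs_Re_le_cmod[of "r * w i * z"] by simp
  have "f holomorphic_on ball 0 (1 / r)"
    unfolding f_def using pos
    by (intro holomorphic_on_sum holomorphic_intros) (fastforce simp: complex_nonpos_Reals_iff)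
  then have "((\<lambda>\<theta>. f (circ \<theta>)) has_integral f 0) {0..1}"
    by (rule circle_mean_value) (use assms in \<open>simp add: field_simps\<close>)
  then have "((\<lambda>\<theta>. Re (f (circ \<theta>))) has_integral Re (f 0)) {0..1}"
    by (rule has_integral_Re)
  moreover have "f 0 = 0" by (simp add: f_def)
  moreover have "Re (f (circ \<theta>)) = ln (\<Prod>i<n. cmod (1 + r * w i * circ \<theta>))" for \<theta>
  proof -
    have "1 + r * w i * circ \<theta> \<noteq> 0" if "i < n" for i
      using pos[OF that, of "circ \<theta>"] assms by (auto simp: field_simps complex_eq_iff)
    then show ?thesis
      unfolding f_def by (subst ln_prod) (auto simp: Re_Ln)
  qed
  ultimately show ?thesis by simp
qed

text \<open>Jensen's inequality for the polynomial with factors 1 + w_i z, whose value at 0 is 1.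
  Its zeros may lie on the circle, where the logarithm is singular; hence the integral is that of a
  continuous positive majorant \<open>u\<close>. Contracting the product to radius 1 - \<epsilon>
  removes the singularities at the price of an error C \<epsilon>.\<close>

lemma jensen_lower_bound:
  fixes w :: "nat \<Rightarrow> complex" and u :: "real \<Rightarrow> real"
  assumes u: "continuous_on {0..1} u" "\<And>\<theta>. \<theta> \<in> {0..1} \<Longrightarrow> 0 < u \<theta>"
    and "0 < K"
    and le: "\<And>\<theta>. \<theta> \<in> {0..1} \<Longrightarrow> K * (\<Prod>i<n. cmod (1 + w i * circ \<theta>))\<^sup>2 \<le> u \<theta>"
  shows "ln K \<le> integral {0..1} (\<lambda>\<theta>. ln (u \<theta>))"
proof -
  \<comment> \<open>Zeros inside the disc are reflected to the outside, which lowers the product on the circle.\<close>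
  define v where "v i = (if cmod (w i) \<le> 1 then w i else inverse (cnj (w i)))" for i
  have v1: "cmod (v i) \<le> 1" for i
    by (auto simp: v_def norm_inverse inverse_le_1_iff)
  have vw: "cmod (1 + v i * circ \<theta>) \<le> cmod (1 + w i * circ \<theta>)" for i \<theta>
  proof (cases "cmod (w i) \<le> 1")
    case False
    then have "w i \<noteq> 0" by auto
    have "cmod (1 + v i * circ \<theta>) = cmod (cnj (1 + v i * circ \<theta>))"
      by (simp only: complex_mod_cnj)
    also have "cnj (1 + v i * circ \<theta>) = (1 + w i * circ \<theta>) / (w i * circ \<theta>)"
      using \<open>w i \<noteq> 0\<close> False by (simp add: v_def field_simps)
    also have "cmod \<dots> = cmod (1 + w i * circ \<theta>) / cmod (w i)"
      by (simp add: norm_divide norm_mult)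
    also have "\<dots> \<le> cmod (1 + w i * circ \<theta>) / 1"
      using False by (intro divide_left_mono) auto
    finally show ?thesis by simp
  qed (simp add: v_def)
  obtain m where m: "m > 0" "\<And>\<theta>. \<theta> \<in> {0..1} \<Longrightarrow> m \<le> u \<theta>"
  proof -
    obtain \<theta>0 where "\<theta>0 \<in> {0..1}" "\<And>\<theta>. \<theta> \<in> {0..1} \<Longrightarrow> u \<theta>0 \<le> u \<theta>"
      using continuous_attains_inf[of "{0..1::real}" u] u(1) by auto
    then show thesis using that[of "u \<theta>0"] u(2) by auto
  qed
  have "u \<theta> \<noteq> 0" if "\<theta> \<in> {0..1}" for \<theta> using u(2)[OF that] by simp
  then have ln_u: "(\<lambda>\<theta>. ln (u \<theta>)) integrable_on {0..1}"
    using u(1) by (intro integrable_continuous_interval continuous_intros) auto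
  \<comment> \<open>The contraction may raise K times the squared product by K \<eta> (2 * 2^n + 2),
    which is C \<epsilon> m. The minimum \<open>m\<close> of \<open>u\<close> turns this additive
    error into a factor 1 + C \<epsilon>, that is, into an error C \<epsilon> of the
    logarithm.\<close>
  define C where "C = K * 2 ^ n * n * (2 ^ n + 1) / m"
  have C0: "0 \<le> C" using \<open>0 < K\<close> \<open>0 < m\<close> by (simp add: C_def)
  define I where "I = integral {0..1} (\<lambda>\<theta>. ln (u \<theta>))"
  have bound: "ln K \<le> I + C * \<epsilon>" if "0 < \<epsilon>" "\<epsilon> < 1" "2 ^ n * n * \<epsilon> \<le> 1" for \<epsilon> :: real
  proof -
    define r where "r = 1 - \<epsilon>"
    have r: "0 < r" "r < 1" using that by (auto simp: r_def)
    define b where "b \<theta> = (\<Prod>i<n. cmod (1 + r * v i * circ \<theta>))" for \<theta>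
    define a where "a \<theta> = (\<Prod>i<n. cmod (1 + v i * circ \<theta>))" for \<theta>
    define \<eta> where "\<eta> = 2 ^ n * n * \<epsilon> / 2"
    have \<eta>: "0 \<le> \<eta>" "\<eta> \<le> 1" using that by (auto simp: \<eta>_def)
    have nz: "1 + r * v i * circ \<theta> \<noteq> 0" for i \<theta>
    proof
      assume "1 + r * v i * circ \<theta> = 0"
      then have "cmod (r * v i * circ \<theta>) = 1"
        by (metis add_eq_0_iff norm_minus_cancel norm_one)
      then have "r * cmod (v i) = 1" using r by (simp add: norm_mult)
      moreover have "r * cmod (v i) \<le> r * 1" using r v1 by (intro mult_left_mono) auto
      ultimately show False using r by simp
    qed
    have b_pos: "0 < b \<theta>" for \<theta> unfolding b_def using nz by (intro prod_pos) auto
    \<comment> \<open>Halved factors have modulus at most 1, so the difference of two products is at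
      most the sum of the differences of the factors. The power of 2 in \<eta> undoes the
      halving.\<close>
    have le1: "cmod ((1 + q * v i * circ \<theta>) / 2) \<le> 1" if "0 \<le> q" "q \<le> 1" for q :: real and i \<theta>
    proof -
      have "cmod (1 + q * v i * circ \<theta>) \<le> cmod 1 + cmod (q * v i * circ \<theta>)" by (rule norm_triangle_ineq)
      also have "\<dots> = 1 + q * cmod (v i)" using that by (simp add: norm_mult)
      also have "\<dots> \<le> 1 + 1 * 1" using that v1 by (intro add_left_mono mult_mono) auto
      finally show ?thesis by (simp add: norm_divide)
    qed
    have ab: "b \<theta> \<le> a \<theta> + \<eta>" and a2: "a \<theta> \<le> 2 ^ n" for \<theta>
    proof -
      have "cmod ((\<Prod>i<n. (1 + r * v i * circ \<theta>) / 2) - (\<Prod>i<n. (1 + v i * circ \<theta>) / 2))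
          \<le> (\<Sum>i<n. cmod ((1 + r * v i * circ \<theta>) / 2 - (1 + v i * circ \<theta>) / 2))"
        using le1[of r] le1[of 1] r by (intro norm_prod_diff) auto
      also have "\<dots> \<le> (\<Sum>i<n. \<epsilon> / 2)"
      proof (rule sum_mono)
        fix i
        have "(1 + r * v i * circ \<theta>) / 2 - (1 + v i * circ \<theta>) / 2 = - (\<epsilon> / 2) * (v i * circ \<theta>)"
          by (simp add: r_def field_simps)
        then have "cmod ((1 + r * v i * circ \<theta>) / 2 - (1 + v i * circ \<theta>) / 2) = \<epsilon> / 2 * cmod (v i)"
          using \<open>0 < \<epsilon>\<close> by (simp add: norm_mult)
        also have "\<dots> \<le> \<epsilon> / 2 * 1" using v1 \<open>0 < \<epsilon>\<close> by (intro mult_left_mono) auto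
        finally show "cmod ((1 + r * v i * circ \<theta>) / 2 - (1 + v i * circ \<theta>) / 2) \<le> \<epsilon> / 2" by simp
      qed
      finally have "cmod ((\<Prod>i<n. (1 + r * v i * circ \<theta>) / 2) - (\<Prod>i<n. (1 + v i * circ \<theta>) / 2))
          \<le> n * \<epsilon> / 2" by simp
      moreover have "cmod (\<Prod>i<n. (1 + r * v i * circ \<theta>) / 2) = b \<theta> / 2 ^ n"
        "cmod (\<Prod>i<n. (1 + v i * circ \<theta>) / 2) = a \<theta> / 2 ^ n"
        unfolding a_def b_def by (simp_all add: prod_norm[symmetric] norm_divide prod_dividef norm_power)
      ultimately have "b \<theta> / 2 ^ n \<le> a \<theta> / 2 ^ n + n * \<epsilon> / 2"
        by (smt (verit) norm_triangle_ineq2)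
      then show "b \<theta> \<le> a \<theta> + \<eta>" by (simp add: \<eta>_def field_simps)
      have "a \<theta> \<le> (\<Prod>i<n. 2)"
        unfolding a_def using le1[of 1] by (intro prod_mono) (auto simp: norm_divide)
      then show "a \<theta> \<le> 2 ^ n" by simp
    qed
    have "ln K + 2 * ln (b \<theta>) \<le> ln (u \<theta>) + C * \<epsilon>" if "\<theta> \<in> {0..1}" for \<theta>
    proof -
      have u\<theta>: "0 < u \<theta>" using u(2) that by simp
      have a0: "0 \<le> a \<theta>" unfolding a_def by (intro prod_nonneg) auto
      have "(b \<theta>)\<^sup>2 \<le> (a \<theta> + \<eta>)\<^sup>2" using ab b_pos[of \<theta>] by (intro power_mono) auto
      also have "\<dots> = (a \<theta>)\<^sup>2 + \<eta> * (2 * a \<theta> + \<eta>)" by (simp add: power2_eq_square algebra_simps)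
      also have "\<dots> \<le> (a \<theta>)\<^sup>2 + \<eta> * (2 * 2 ^ n + 2)"
        using a2[of \<theta>] \<eta> by (intro add_left_mono mult_left_mono) auto
      finally have "K * (b \<theta>)\<^sup>2 \<le> K * ((a \<theta>)\<^sup>2 + \<eta> * (2 * 2 ^ n + 2))"
        using \<open>0 < K\<close> by simp
      moreover have "K * (a \<theta>)\<^sup>2 \<le> u \<theta>"
      proof -
        have "a \<theta> \<le> (\<Prod>i<n. cmod (1 + w i * circ \<theta>))"
          unfolding a_def using vw by (intro prod_mono) auto
        then have "(a \<theta>)\<^sup>2 \<le> (\<Prod>i<n. cmod (1 + w i * circ \<theta>))\<^sup>2" using a0 by (intro power_mono) auto
        then show ?thesis using le[OF that] \<open>0 < K\<close>
          by (meson dual_order.trans less_eq_real_def mult_left_mono)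
      qed
      moreover have "C * \<epsilon> * m = K * (\<eta> * (2 * 2 ^ n + 2))"
        using \<open>0 < m\<close> by (simp add: C_def \<eta>_def field_simps)
      ultimately have "K * (b \<theta>)\<^sup>2 \<le> u \<theta> + C * \<epsilon> * m"
        by (simp only: distrib_left[of K])
      also have "\<dots> \<le> u \<theta> + C * \<epsilon> * u \<theta>"
        using m(2)[OF that] C0 \<open>0 < \<epsilon>\<close> by (intro add_left_mono mult_left_mono) auto
      also have "\<dots> = u \<theta> * (1 + C * \<epsilon>)" by (simp add: algebra_simps)
      finally have "ln (K * (b \<theta>)\<^sup>2) \<le> ln (u \<theta> * (1 + C * \<epsilon>))"
        using \<open>0 < K\<close> b_pos[of \<theta>] by (intro ln_mono) auto
      moreover have "ln (K * (b \<theta>)\<^sup>2) = ln K + 2 * ln (b \<theta>)"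
        using \<open>0 < K\<close> b_pos[of \<theta>] by (subst ln_mult) (auto simp: ln_realpow)
      moreover have "0 < 1 + C * \<epsilon>" using C0 \<open>0 < \<epsilon>\<close> by (simp add: add_pos_nonneg)
      then have "ln (u \<theta> * (1 + C * \<epsilon>)) \<le> ln (u \<theta>) + C * \<epsilon>"
        using u\<theta> ln_add_one_self_le_self[of "C * \<epsilon>"] C0 \<open>0 < \<epsilon>\<close> by (subst ln_mult) auto
      ultimately show ?thesis by linarith
    qed
    moreover have "((\<lambda>\<theta>. ln K + 2 * ln (b \<theta>)) has_integral ln K * 1 + 2 * 0) {0..1}"
      unfolding b_def
      using has_integral_const_real[of "ln K" 0 1] ln_product_circle_mean[of n v r] v1 r
      by (intro has_integral_add has_integral_mult_right) auto
    moreover have "((\<lambda>\<theta>. ln (u \<theta>) + C * \<epsilon>) has_integral I + C * \<epsilon>) {0..1}"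
      using has_integral_const_real[of "C * \<epsilon>" 0 1] ln_u unfolding I_def
      by (intro has_integral_add integrable_integral) auto
    ultimately show ?thesis
      using has_integral_le[of "\<lambda>\<theta>. ln K + 2 * ln (b \<theta>)" _ "{0..1}" "\<lambda>\<theta>. ln (u \<theta>) + C * \<epsilon>"] by fastforce
  qed
  have "((\<lambda>\<epsilon>. I + C * \<epsilon>) \<longlongrightarrow> I + C * 0) (at_right 0)"
    by (intro tendsto_intros)
  moreover have "\<forall>\<^sub>F \<epsilon> in at_right 0. ln K \<le> I + C * \<epsilon>"
  proof -
    have pos: "0 < 1 + 2 ^ n * real n" by (intro add_pos_nonneg) auto
    then have "\<forall>\<^sub>F \<epsilon> in at_right 0. \<epsilon> \<in> {0 <..< 1 / (1 + 2 ^ n * real n)}"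
      by (intro eventually_at_right_real) simp
    then show ?thesis
    proof eventually_elim
      case (elim \<epsilon>)
      then have "2 ^ n * n * \<epsilon> + \<epsilon> < 1" using pos by (simp add: pos_less_divide_eq algebra_simps)
      moreover have "0 \<le> 2 ^ n * n * \<epsilon>" using elim by simp
      ultimately show ?case using bound[of \<epsilon>] elim by auto
    qed
  qed
  ultimately show ?thesis
    unfolding I_def[symmetric] by (intro tendsto_lowerbound[of _ "I" "at_right 0"]) auto
qed

subsection \<open>Circle means of log-determinants\<close>

text \<open>This is 1 + s X^* X, whose determinant is the product of 1 + s \<sigma>^2 over the
  singular values \<sigma> of X.\<close>

definition gram :: "nat \<Rightarrow> real \<Rightarrow> (nat \<Rightarrow> nat \<Rightarrow> complex) \<Rightarrow> nat \<Rightarrow> nat \<Rightarrow> complex" where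
  "gram n s X i j = (if i = j then 1 else 0) + s * (\<Sum>k<n. cnj (X k i) * X k j)"

lemma qform_diag_plus_rank_one:
  "qform n (\<lambda>i j. (if i = j then of_real (h i) else 0) + of_real \<rho> * b i * cnj (b j)) x
    = of_real ((\<Sum>i<n. h i * (cmod (x i))\<^sup>2) + \<rho> * (cmod (\<Sum>j<n. cnj (b j) * x j))\<^sup>2)"
proof -
  define \<beta> where "\<beta> = (\<Sum>j<n. cnj (b j) * x j)"
  have "app n (\<lambda>i j. (if i = j then of_real (h i) else 0) + of_real \<rho> * b i * cnj (b j)) x i
      = h i * x i + \<rho> * b i * \<beta>" if "i < n" for i
    using that
    by (simp add: app_def distrib_right sum.distrib \<beta>_def sum_distrib_left mult.assoc
        if_distrib[of "\<lambda>c. c * _"] cong: if_cong)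
  then have "qform n (\<lambda>i j. (if i = j then of_real (h i) else 0) + of_real \<rho> * b i * cnj (b j)) x
      = (\<Sum>i<n. h i * (x i * cnj (x i)) + \<rho> * \<beta> * (b i * cnj (x i)))"
    unfolding qform_def by (intro sum.cong) (auto simp: algebra_simps)
  also have "\<dots> = (\<Sum>i<n. h i * (x i * cnj (x i))) + \<rho> * \<beta> * cnj \<beta>"
    by (simp add: sum.distrib sum_distrib_left \<beta>_def cnj_sum)
  finally show ?thesis
    unfolding \<beta>_def[symmetric]
    by (simp add: complex_norm_square[symmetric] mult.assoc del: of_real_power)
qed

lemma qform_gram:
  "qform n (gram n s X) x
    = of_real ((\<Sum>i<n. (cmod (x i))\<^sup>2) + s * (\<Sum>k<n. (cmod (app n X x k))\<^sup>2))"
proof -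
  have "app n (gram n s X) x i = x i + s * (\<Sum>k<n. cnj (X k i) * app n X x k)" if "i < n" for i
  proof -
    have "app n (gram n s X) x i
        = x i + s * (\<Sum>j<n. (\<Sum>k<n. cnj (X k i) * X k j) * x j)"
      using that by (simp add: app_def gram_def distrib_right sum.distrib mult.assoc
          if_distrib[of "\<lambda>c. c * _"] flip: sum_distrib_left cong: if_cong)
    also have "(\<Sum>j<n. (\<Sum>k<n. cnj (X k i) * X k j) * x j) = (\<Sum>k<n. cnj (X k i) * app n X x k)"
      unfolding app_def sum_distrib_left sum_distrib_right
      by (subst sum.swap) (simp add: mult.assoc)
    finally show ?thesis .
  qed
  then have "qform n (gram n s X) x
      = (\<Sum>i<n. x i * cnj (x i)) + s * (\<Sum>i<n. \<Sum>k<n. cnj (X k i) * app n X x k * cnj (x i))"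
    unfolding qform_def by (simp add: distrib_right sum.distrib sum_distrib_left sum_distrib_right mult.assoc)
  also have "(\<Sum>i<n. \<Sum>k<n. cnj (X k i) * app n X x k * cnj (x i))
      = (\<Sum>k<n. app n X x k * cnj (app n X x k))"
    by (subst sum.swap) (simp add: app_def[of n X x] cnj_sum sum_distrib_left mult_ac)
  finally show ?thesis
    by (simp add: complex_norm_square[symmetric] del: of_real_power)
qed

lemma sum_norm_sq_pos:
  fixes x :: "nat \<Rightarrow> complex"
  shows "\<exists>i<n. x i \<noteq> 0 \<Longrightarrow> 0 < (\<Sum>i<n. (cmod (x i))\<^sup>2)"
  by (metis (no_types, lifting) finite_lessThan lessThan_iff sum_pos2 zero_le_power2 zero_less_norm_iff zero_less_power)

lemma pos_def_gram: "0 \<le> s \<Longrightarrow> pos_def n (gram n s X)"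
  unfolding pos_def_def qform_gram
  using sum_norm_sq_pos by (auto intro!: add_pos_nonneg mult_nonneg_nonneg sum_nonneg)

lemma fdet_diag_plus_rank_one:
  assumes "\<And>i. i < n \<Longrightarrow> 0 < h i"
  shows "fdet n (\<lambda>i j. (if i = j then of_real (h i) else 0) + of_real \<rho> * b i * cnj (b j))
    = of_real ((\<Prod>i<n. h i) * (1 + \<rho> * (\<Sum>i<n. (cmod (b i))\<^sup>2 / h i)))"
proof -
  have "fdet n (\<lambda>i j. (if i = j then of_real (h i) else 0) + (of_real \<rho> * b i) * cnj (b j))
      = fdet n (\<lambda>i j. if i = j then of_real (h i) else 0)
        * (1 + (\<Sum>i<n. \<rho> * b i / h i * cnj (b i)))"
  proof (rule fdet_plus_rank_one)
    fix i assume "i < n"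
    then have "app n (\<lambda>i j. if i = j then of_real (h i) else 0) (\<lambda>i. \<rho> * b i / h i) i
        = (\<Sum>j<n. if j = i then \<rho> * b j else 0)"
      unfolding app_def using assms[of i] by (intro sum.cong) auto
    also have "\<dots> = \<rho> * b i" using \<open>i < n\<close> by simp
    finally show "app n (\<lambda>i j. if i = j then of_real (h i) else 0) (\<lambda>i. \<rho> * b i / h i) i = \<rho> * b i" .
  qed
  also have "(\<Sum>i<n. \<rho> * b i / h i * cnj (b i)) = of_real (\<rho> * (\<Sum>i<n. (cmod (b i))\<^sup>2 / h i))"
    by (simp add: sum_distrib_left complex_norm_square mult_ac del: of_real_power)
  finally show ?thesis by (simp add: fdet_diagonal mult.assoc)
qed

text \<open>This is the Cauchy-Schwarz inequality in the direct sum of two copies of C^n, where the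
  columns F and R take their values.\<close>

lemma cauchy_schwarz_two_sums:
  fixes p q p' q' :: "nat \<Rightarrow> complex"
  shows "(cmod (\<Sum>i<n. p i * cnj (p' i) + q i * cnj (q' i)))\<^sup>2
    \<le> (\<Sum>i<n. (cmod (p i))\<^sup>2 + (cmod (q i))\<^sup>2) * (\<Sum>i<n. (cmod (p' i))\<^sup>2 + (cmod (q' i))\<^sup>2)"
proof -
  define f where "f = (\<lambda>(b, i). if b then cmod (p i) else cmod (q i))"
  define g where "g = (\<lambda>(b, i). if b then cmod (p' i) else cmod (q' i))"
  have *: "(\<Sum>j\<in>UNIV \<times> {..<n}. F j) = (\<Sum>i<n. F (True, i) + F (False, i))" for F :: "bool \<times> nat \<Rightarrow> real"
    using sum.cartesian_product[of "\<lambda>b i. F (b, i)" "{..<n}" "UNIV :: bool set"]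
    by (simp add: UNIV_bool sum.distrib)
  have "cmod (\<Sum>i<n. p i * cnj (p' i) + q i * cnj (q' i)) \<le> (\<Sum>j\<in>UNIV \<times> {..<n}. f j * g j)"
    unfolding * f_def g_def
    by (rule order_trans[OF norm_sum sum_mono])
       (auto intro: order_trans[OF norm_triangle_ineq] simp: norm_mult)
  then have "(cmod (\<Sum>i<n. p i * cnj (p' i) + q i * cnj (q' i)))\<^sup>2 \<le> (\<Sum>j\<in>UNIV \<times> {..<n}. f j * g j)\<^sup>2"
    by (intro power_mono) auto
  also have "\<dots> \<le> (\<Sum>j\<in>UNIV \<times> {..<n}. (f j)\<^sup>2) * (\<Sum>j\<in>UNIV \<times> {..<n}. (g j)\<^sup>2)"
    by (rule Cauchy_Schwarz_ineq_sum)
  finally show ?thesis unfolding * by (simp add: f_def g_def)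
qed

lemma ln_fdet_circle_mean:
  fixes d c :: "nat \<Rightarrow> complex" and B :: "nat \<Rightarrow> nat \<Rightarrow> complex" and s t :: real
  assumes "0 < s" "0 < t" and c: "\<exists>i<n. c i \<noteq> 0"
  defines "b \<equiv> \<lambda>j. \<Sum>i<n. cnj (B i j) * c i"
    and "h \<equiv> \<lambda>i. 1 + s * (cmod (d i))\<^sup>2"
    and "X \<equiv> \<lambda>z i j. (if i = j then d i else 0) + z * B i j"
  defines "hc \<equiv> \<Sum>i<n. (cmod (c i))\<^sup>2 * h i"
  shows "(\<Sum>i<n. ln (h i)) + ln (1 + t\<^sup>2 * s / hc * (\<Sum>i<n. (cmod (b i))\<^sup>2 / h i))
    \<le> integral {0..1} (\<lambda>\<theta>. ln (Re (fdet n (gram n s (X (t * circ \<theta>))))))"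
proof -
  have h: "1 \<le> h i" for i using \<open>0 < s\<close> by (simp add: h_def)
  have h0: "0 < h i" for i using h[of i] by simp
  have "(\<Sum>i<n. (cmod (c i))\<^sup>2) \<le> hc"
    unfolding hc_def using h by (intro sum_mono) (simp add: mult_le_cancel_left1)
  then have hc: "0 < hc" using sum_norm_sq_pos[OF c] by linarith
  define \<rho> where "\<rho> = t\<^sup>2 * s / hc"
  have "0 \<le> \<rho>" using \<open>0 < s\<close> hc by (simp add: \<rho>_def)
  define S where "S i j = (if i = j then of_real (h i) else 0) + of_real \<rho> * b i * cnj (b j)" for i j
  define W where "W = \<rho> * (\<Sum>i<n. (cmod (b i))\<^sup>2 / h i)"
  have "0 \<le> W"
    unfolding W_def using \<open>0 \<le> \<rho>\<close> h0 by (intro mult_nonneg_nonneg sum_nonneg) (auto simp: less_imp_le)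
  define K where "K = (\<Prod>i<n. h i) * (1 + W)"
  have K: "0 < K" unfolding K_def using h0 \<open>0 \<le> W\<close> by (intro mult_pos_pos prod_pos) auto
  have detS: "fdet n S = of_real K"
    unfolding S_def K_def W_def by (rule fdet_diag_plus_rank_one) (rule h0)
  have formS: "qform n S x = of_real ((\<Sum>i<n. h i * (cmod (x i))\<^sup>2)
      + \<rho> * (cmod (\<Sum>j<n. cnj (b j) * x j))\<^sup>2)" for x
    unfolding S_def by (rule qform_diag_plus_rank_one)
  have posS: "pos_def n S"
    unfolding pos_def_def
  proof (intro allI impI conjI)
    fix x :: "nat \<Rightarrow> complex" assume "\<exists>i<n. x i \<noteq> 0"
    then have "0 < (\<Sum>i<n. (cmod (x i))\<^sup>2)" by (rule sum_norm_sq_pos)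
    also have "\<dots> \<le> (\<Sum>i<n. h i * (cmod (x i))\<^sup>2)"
      using h by (intro sum_mono) (simp add: mult_le_cancel_right1)
    finally show "0 < Re (qform n S x)"
      unfolding formS Re_complex_of_real using \<open>0 \<le> \<rho>\<close> by (intro add_pos_nonneg) auto
  qed (simp add: formS)
  \<comment> \<open>With \<open>F x = (x, sqrt s X x)\<close> and \<open>R w = (w - z sqrt s \<lambda> \<beta> D\<^sup>* c, sqrt s D w + z \<lambda> \<beta> c)\<close>,
    where \<open>\<beta> = \<langle>w, b\<rangle>\<close>, the cross terms of \<open>R\<^sup>* R\<close> cancel and \<open>R\<^sup>* R = S\<close>,
    while \<open>R\<^sup>* F = S + s z D\<^sup>* B\<close> is holomorphic in \<open>z\<close> on the circle \<open>|z| = t\<close>.\<close>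
  have key: "(cmod (fdet n (\<lambda>i j. S i j + z * (s * cnj (d i) * B i j))))\<^sup>2
      \<le> K * Re (fdet n (gram n s (X z)))" if z: "cmod z = t" for z
  proof -
    define \<Gamma> where "\<Gamma> i j = S i j + z * (s * cnj (d i) * B i j)" for i j
    define rs where "rs = complex_of_real (sqrt s)"
    \<comment> \<open>The rank-one terms have the coefficients t^2 sqrt s \<lambda> in R^* F and t^2
      \<lambda>^2 hc in R^* R. They agree for \<lambda> = sqrt s / hc, and both are then equal to
      \<rho>.\<close>
    define L where "L = complex_of_real (sqrt s / hc)"
    have rs: "rs * rs = of_real s" "cnj rs = rs"
      using \<open>0 < s\<close> by (simp_all add: rs_def flip: of_real_mult)
    have "sqrt s * (sqrt s / hc) * hc = s" "sqrt s / hc * (sqrt s / hc) * hc * hc = s"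
      using \<open>0 < s\<close> hc by simp_all
    then have L: "cnj L = L" "rs * L * hc = s" "L * L * hc * hc = s"
      unfolding rs_def L_def of_real_mult[symmetric] by simp_all
    have zz: "z * cnj z = of_real (t\<^sup>2)" using complex_norm_square[of z] z by simp
    have le: "Im (qform n S w) = 0 \<and> Re (qform n S w) \<le> Re (qform n (gram n s (X z)) x)"
      if eq: "\<And>i. i < n \<Longrightarrow> app n S w i = app n \<Gamma> x i" for x w
    proof
      show "Im (qform n S w) = 0" by (simp add: formS)
      define \<beta> where "\<beta> = (\<Sum>j<n. cnj (b j) * w j)"
      define q where "q i = rs * app n (X z) x i" for i
      define p' where "p' i = w i - z * rs * L * \<beta> * cnj (d i) * c i" for i
      define q' where "q' i = rs * d i * w i + z * L * \<beta> * c i" for i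
      have appX: "app n (X z) x i = d i * x i + z * app n B x i" if "i < n" for i
        using that by (simp add: app_def X_def distrib_right sum.distrib sum_distrib_left mult.assoc
            if_distrib[of "\<lambda>c. c * _"] cong: if_cong)
      have app\<Gamma>: "app n \<Gamma> x i = h i * x i + \<rho> * b i * (\<Sum>j<n. cnj (b j) * x j)
          + z * s * cnj (d i) * app n B x i" if "i < n" for i
        using that by (simp add: app_def \<Gamma>_def S_def distrib_right sum.distrib sum_distrib_left mult.assoc
            if_distrib[of "\<lambda>c. c * _"] cong: if_cong)
      have bx: "(\<Sum>j<n. cnj (b j) * x j) = (\<Sum>i<n. cnj (c i) * app n B x i)"
        unfolding b_def app_def cnj_sum sum_distrib_left sum_distrib_right
        by (subst sum.swap) (simp add: mult_ac)
      have hz: "complex_of_real (h i) = 1 + s * (d i * cnj (d i))" for i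
        by (simp add: h_def complex_norm_square del: of_real_power)
      have "(\<Sum>i<n. x i * cnj (p' i) + q i * cnj (q' i))
          = (\<Sum>i<n. h i * x i * cnj (w i) + z * s * cnj (d i) * app n B x i * cnj (w i)
              + t\<^sup>2 * s / hc * cnj \<beta> * (cnj (c i) * app n B x i))"
      proof (rule sum.cong[OF refl])
        fix i assume "i \<in> {..<n}"
        then have "i < n" by simp
        have "x i * cnj (p' i) + q i * cnj (q' i)
            = (1 + (rs * rs) * (d i * cnj (d i))) * x i * cnj (w i)
              + z * (rs * rs) * cnj (d i) * app n B x i * cnj (w i)
              + (z * cnj z) * (rs * L) * cnj \<beta> * (cnj (c i) * app n B x i)"
          by (simp add: p'_def q'_def q_def appX[OF \<open>i < n\<close>] rs(2) L(1) algebra_simps)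
        moreover have "rs * L = s / hc" using L(2) hc by (simp add: field_simps)
        ultimately show "x i * cnj (p' i) + q i * cnj (q' i)
            = h i * x i * cnj (w i) + z * s * cnj (d i) * app n B x i * cnj (w i)
              + t\<^sup>2 * s / hc * cnj \<beta> * (cnj (c i) * app n B x i)"
          by (simp only: rs(1) zz hz) (simp add: mult.assoc)
      qed
      also have "\<dots> = (\<Sum>i<n. (h i * x i + z * s * cnj (d i) * app n B x i) * cnj (w i))
          + \<rho> * cnj \<beta> * (\<Sum>j<n. cnj (b j) * x j)"
        unfolding bx sum_distrib_left by (simp add: sum.distrib \<rho>_def algebra_simps)
      also have "\<dots> = (\<Sum>i<n. app n \<Gamma> x i * cnj (w i))"
        by (simp add: app\<Gamma> \<beta>_def cnj_sum sum_distrib_left sum_distrib_right sum.distrib algebra_simps)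
      also have "\<dots> = qform n S w" unfolding qform_def using eq by simp
      \<comment> \<open>As S w = \<Gamma> x and \<Gamma> = R^* F, the form of \<open>S\<close> at
        \<open>w\<close> is the inner product of F x with R w.\<close>
      finally have FR: "qform n S w = (\<Sum>i<n. x i * cnj (p' i) + q i * cnj (q' i))" by simp
      have RR: "(\<Sum>i<n. (cmod (p' i))\<^sup>2 + (cmod (q' i))\<^sup>2) = Re (qform n S w)"
      proof -
        have "complex_of_real (\<Sum>i<n. (cmod (p' i))\<^sup>2 + (cmod (q' i))\<^sup>2)
            = (\<Sum>i<n. p' i * cnj (p' i) + q' i * cnj (q' i))"
          by (simp add: complex_norm_square del: of_real_power)
        also have "\<dots> = (\<Sum>i<n. h i * (w i * cnj (w i)) + t\<^sup>2 * (L * L) * (\<beta> * cnj \<beta>) * (c i * cnj (c i) * h i))"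
        proof (rule sum.cong[OF refl])
          fix i
          have "p' i * cnj (p' i) + q' i * cnj (q' i)
              = (1 + (rs * rs) * (d i * cnj (d i))) * (w i * cnj (w i))
                + (z * cnj z) * (L * L) * (\<beta> * cnj \<beta>) * (c i * cnj (c i) * (1 + (rs * rs) * (d i * cnj (d i))))"
            by (simp add: p'_def q'_def rs(2) L(1) algebra_simps)
          then show "p' i * cnj (p' i) + q' i * cnj (q' i)
              = h i * (w i * cnj (w i)) + t\<^sup>2 * (L * L) * (\<beta> * cnj \<beta>) * (c i * cnj (c i) * h i)"
            by (simp only: rs(1) zz hz)
        qed
        also have "\<dots> = (\<Sum>i<n. h i * (w i * cnj (w i))) + t\<^sup>2 * (L * L) * (\<beta> * cnj \<beta>) * hc"
          by (simp add: sum.distrib sum_distrib_left hc_def complex_norm_square del: of_real_power)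
        also have "t\<^sup>2 * (L * L) * (\<beta> * cnj \<beta>) * hc = \<rho> * (\<beta> * cnj \<beta>)"
          using L(3) hc by (simp add: \<rho>_def field_simps)
        also have "(\<Sum>i<n. h i * (w i * cnj (w i))) + \<rho> * (\<beta> * cnj \<beta>) = qform n S w"
          unfolding formS \<beta>_def[symmetric] by (simp add: complex_norm_square del: of_real_power)
        finally show ?thesis by (metis Re_complex_of_real)
      qed
      have FF: "(\<Sum>i<n. (cmod (x i))\<^sup>2 + (cmod (q i))\<^sup>2) = Re (qform n (gram n s (X z)) x)"
        unfolding qform_gram using \<open>0 < s\<close>
        by (simp add: q_def rs_def norm_mult power_mult_distrib sum.distrib sum_distrib_left)
      \<comment> \<open>In the Cauchy-Schwarz inequality for F x and R w, the squared length of R w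
        is the form of \<open>S\<close> at \<open>w\<close> itself, so one factor cancels when it is
        positive.\<close>
      have "(Re (qform n S w))\<^sup>2 \<le> (cmod (qform n S w))\<^sup>2"
        using abs_Re_le_cmod[of "qform n S w"] by (subst abs_le_square_iff[symmetric]) simp
      also have "\<dots> \<le> Re (qform n (gram n s (X z)) x) * Re (qform n S w)"
        unfolding FF[symmetric] RR[symmetric] unfolding FR by (rule cauchy_schwarz_two_sums)
      finally have *: "Re (qform n S w) * Re (qform n S w)
          \<le> Re (qform n (gram n s (X z)) x) * Re (qform n S w)"
        by (simp add: power2_eq_square)
      show "Re (qform n S w) \<le> Re (qform n (gram n s (X z)) x)"
      proof (cases "Re (qform n S w) > 0")
        case True
        then show ?thesis using * by simp
      next
        case False
        have "0 \<le> Re (qform n (gram n s (X z)) x)"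
          unfolding FF[symmetric] by (intro sum_nonneg) auto
        then show ?thesis using False by linarith
      qed
    qed
    have "(cmod (fdet n \<Gamma>))\<^sup>2 \<le> Re (fdet n S) * Re (fdet n (gram n s (X z)))"
      by (rule cmod_fdet_sq_le[OF posS]) (use \<open>0 < s\<close> pos_def_gram le in \<open>auto simp: qform_gram\<close>)
    then show ?thesis unfolding \<Gamma>_def by (simp add: detS)
  qed
  have "fdet n S \<noteq> 0" using K by (simp add: detS)
  \<comment> \<open>Here M = S^-1 (s D^* B), so det (R^* F) = K det (1 + z M) is a polynomial in z
    with value K at 0, split into linear factors.\<close>
  then obtain M where M: "\<forall>i<n. \<forall>j<n. s * cnj (d i) * B i j = (\<Sum>k<n. S i k * M k j)"
    by (rule fdet_right_quotient)
  obtain es where es: "length es = n"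
      "\<And>z. fdet n (\<lambda>i j. (if i = j then 1 else 0) + z * M i j) = (\<Prod>e\<leftarrow>es. 1 + z * e)"
    by (rule fdet_eigenvalues[of n M], rule that)
  have factor: "fdet n (\<lambda>i j. S i j + z * (s * cnj (d i) * B i j)) = K * (\<Prod>i<n. 1 + z * es ! i)" for z
  proof -
    have "fdet n (\<lambda>i j. S i j + z * (s * cnj (d i) * B i j))
        = fdet n (\<lambda>i j. \<Sum>k<n. S i k * ((if k = j then 1 else 0) + z * M k j))"
      by (intro fdet_cong) (use M in \<open>simp add: distrib_left sum.distrib sum_distrib_left mult_ac
          if_distrib[of "\<lambda>c. _ * c"] cong: if_cong\<close>)
    also have "\<dots> = K * (\<Prod>e\<leftarrow>es. 1 + z * e)"
      unfolding fdet_mult es(2) detS ..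
    also have "(\<Prod>e\<leftarrow>es. 1 + z * e) = (\<Prod>i<n. 1 + z * es ! i)"
      by (simp add: prod.list_conv_set_nth es(1) atLeast0LessThan)
    finally show ?thesis .
  qed
  define u where "u \<theta> = Re (fdet n (gram n s (X (t * circ \<theta>))))" for \<theta>
  have "ln K \<le> integral {0..1} (\<lambda>\<theta>. ln (u \<theta>))"
  proof (rule jensen_lower_bound)
    show "continuous_on {0..1} u"
      unfolding u_def gram_def X_def by (intro continuous_intros)
    show "0 < u \<theta>" for \<theta>
    proof -
      obtain r where "fdet n (gram n s (X (t * circ \<theta>))) = of_real r" "0 < r"
        using pos_def_fdet[OF pos_def_gram] \<open>0 < s\<close> less_imp_le by metis
      then show ?thesis by (simp add: u_def)
    qed
    show "0 < K" by (fact K)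
    show "K * (\<Prod>i<n. cmod (1 + of_real t * es ! i * circ \<theta>))\<^sup>2 \<le> u \<theta>" for \<theta>
    proof -
      have "cmod (t * circ \<theta>) = t" using \<open>0 < t\<close> by (simp add: norm_mult)
      from key[OF this] have "(K * (\<Prod>i<n. cmod (1 + t * circ \<theta> * es ! i)))\<^sup>2 \<le> K * u \<theta>"
        unfolding factor u_def using K by (simp add: norm_mult prod_norm[symmetric])
      then have "K * (K * (\<Prod>i<n. cmod (1 + t * circ \<theta> * es ! i))\<^sup>2) \<le> K * u \<theta>"
        by (simp add: power_mult_distrib power2_eq_square mult_ac)
      then show ?thesis using K by (simp add: mult_ac)
    qed
  qed
  moreover have "ln K = (\<Sum>i<n. ln (h i)) + ln (1 + W)"
  proof -
    have "0 < (\<Prod>i<n. h i)" using h0 by (intro prod_pos) auto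
    moreover have "ln (\<Prod>i<n. h i) = (\<Sum>i<n. ln (h i))"
      using h0 by (intro ln_prod) (auto simp: less_imp_neq[symmetric])
    ultimately show ?thesis
      unfolding K_def using \<open>0 \<le> W\<close> by (simp only: ln_mult_pos)
  qed
  ultimately show ?thesis by (simp add: u_def W_def \<rho>_def)
qed

text \<open>The \<open>w k\<close> will be coordinates of singular vectors after compression: their
  length stays at most 1, but orthogonality is lost. The rank-one terms are therefore added one at a
  time, each multiplying the determinant by at most 1 + s \<sigma>^2, while \<tau> accounts for the
  remaining singular values.\<close>

lemma fdet_gram_le:
  fixes \<sigma> :: "nat \<Rightarrow> real" and w :: "nat \<Rightarrow> nat \<Rightarrow> complex"
  assumes "0 < s"
    and w: "\<And>k. k < m \<Longrightarrow> (\<Sum>i<n. (cmod (w k i))\<^sup>2) \<le> 1"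
    and le: "\<And>x. (\<Sum>k<n. (cmod (app n X x k))\<^sup>2)
      \<le> \<tau>\<^sup>2 * (\<Sum>i<n. (cmod (x i))\<^sup>2) + (\<Sum>k<m. (\<sigma> k)\<^sup>2 * (cmod (\<Sum>i<n. cnj (w k i) * x i))\<^sup>2)"
  shows "Re (fdet n (gram n s X)) \<le> (1 + s * \<tau>\<^sup>2) ^ n * (\<Prod>k<m. 1 + s * (\<sigma> k)\<^sup>2)"
proof -
  define c where "c = 1 + s * \<tau>\<^sup>2"
  have c: "1 \<le> c" using \<open>0 < s\<close> by (simp add: c_def)
  define P where "P m i j = (if i = j then of_real c else 0)
      + (\<Sum>k<m. of_real (s * (\<sigma> k)\<^sup>2) * w k i * cnj (w k j))" for m and i j :: nat
  have form: "qform n (P m) x = of_real (c * (\<Sum>i<n. (cmod (x i))\<^sup>2)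
      + (\<Sum>k<m. s * (\<sigma> k)\<^sup>2 * (cmod (\<Sum>i<n. cnj (w k i) * x i))\<^sup>2))" for m x
  proof (induction m)
    case 0
    have "qform n (P 0) x = qform n (\<lambda>i j. (if i = j then of_real c else 0) + of_real 0 * 0 * cnj 0) x"
      by (simp add: P_def[abs_def])
    then show ?case
      using qform_diag_plus_rank_one[of n "\<lambda>_. c" 0 "\<lambda>_. 0" x] by (simp add: sum_distrib_left)
  next
    case (Suc m)
    define g where "g = (\<Sum>i<n. cnj (w m i) * x i)"
    have "app n (P (Suc m)) x i = app n (P m) x i + s * (\<sigma> m)\<^sup>2 * w m i * g" for i
      by (simp add: app_def P_def g_def distrib_left distrib_right sum.distrib sum_distrib_left mult_ac)
    then have "qform n (P (Suc m)) x
        = qform n (P m) x + s * (\<sigma> m)\<^sup>2 * (g * (\<Sum>i<n. w m i * cnj (x i)))"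
      by (simp add: qform_def distrib_left distrib_right sum.distrib sum_distrib_left mult_ac)
    also have "(\<Sum>i<n. w m i * cnj (x i)) = cnj g" by (simp add: g_def cnj_sum)
    finally show ?case
      unfolding Suc by (simp add: g_def[symmetric] complex_norm_square del: of_real_power)
  qed
  have lower: "c * (\<Sum>i<n. (cmod (x i))\<^sup>2) \<le> Re (qform n (P m) x)" for m x
    unfolding form Re_complex_of_real using \<open>0 < s\<close> by (simp add: sum_nonneg)
  have pos: "pos_def n (P m)" for m
    unfolding pos_def_def
  proof (intro allI impI conjI)
    fix x :: "nat \<Rightarrow> complex" assume "\<exists>i<n. x i \<noteq> 0"
    then have "0 < c * (\<Sum>i<n. (cmod (x i))\<^sup>2)"
      using sum_norm_sq_pos[of n x] c by simp
    then show "0 < Re (qform n (P m) x)" using lower[of x m] by linarith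
  qed (simp add: form)
  have bound: "Re (fdet n (P m')) \<le> c ^ n * (\<Prod>k<m'. 1 + s * (\<sigma> k)\<^sup>2)" if "m' \<le> m" for m'
    using that
  proof (induction m')
    case 0
    have "fdet n (P 0) = of_real (c ^ n)"
      using fdet_diagonal[of n "\<lambda>_. of_real c"] by (simp add: P_def[abs_def])
    then show ?case by (simp del: of_real_power)
  next
    case (Suc k)
    define N where "N = (\<Sum>i<n. (cmod (w k i))\<^sup>2)"
    have N: "0 \<le> N" "N \<le> 1" using w[of k] Suc.prems by (auto simp: N_def sum_nonneg)
    obtain r where r: "fdet n (P k) = complex_of_real r" "0 < r" using pos_def_fdet[OF pos] .
    obtain r' where r': "fdet n (P (Suc k)) = complex_of_real r'" "0 < r'" using pos_def_fdet[OF pos] .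
    obtain y where y: "\<And>i. i < n \<Longrightarrow> app n (P k) y i = w k i"
      using fdet_solve[of n "P k" "w k"] r by auto
    \<comment> \<open>\<open>g\<close> is the value at \<open>w k\<close> of the form of the inverse
      of \<open>P k\<close>. Since \<open>P k\<close> is at least c \<ge> 1, g is at least |y|^2;
      Cauchy-Schwarz gives g^2 \<le> |y|^2 N \<le> g, and so g \<le> 1.\<close>
    define g where "g = (\<Sum>i<n. y i * cnj (w k i))"
    have gy: "qform n (P k) y = cnj g"
      unfolding qform_def g_def cnj_sum using y by (intro sum.cong) auto
    have g_real: "g = of_real (Re g)"
      using form[of k y] by (simp add: gy complex_eq_iff)
    define Y where "Y = (\<Sum>i<n. (cmod (y i))\<^sup>2)"
    have "c * Y \<le> Re g" using lower[of y k] by (simp add: gy Y_def)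
    moreover have "0 \<le> Y" by (simp add: Y_def sum_nonneg)
    ultimately have "Y \<le> Re g" using c by (meson dual_order.trans mult_le_cancel_right1 not_le)
    have "(Re g)\<^sup>2 \<le> (cmod g)\<^sup>2"
      using abs_Re_le_cmod[of g] by (subst abs_le_square_iff[symmetric]) simp
    also have "\<dots> \<le> Y * N"
      using cauchy_schwarz_two_sums[of y "w k" "\<lambda>_. 0" "\<lambda>_. 0" n] by (simp add: g_def Y_def N_def)
    also have "\<dots> \<le> Re g * 1" using \<open>Y \<le> Re g\<close> \<open>0 \<le> Y\<close> N by (intro mult_mono) auto
    finally have "Re g \<le> 1" by (cases "0 < Re g") (auto simp: power2_eq_square mult_le_cancel_left2)
    have "fdet n (P (Suc k)) = fdet n (\<lambda>i j. P k i j + w k i * (of_real (s * (\<sigma> k)\<^sup>2) * cnj (w k j)))"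
      by (intro fdet_cong) (simp add: P_def mult_ac)
    also have "\<dots> = fdet n (P k) * (1 + (\<Sum>i<n. y i * (of_real (s * (\<sigma> k)\<^sup>2) * cnj (w k i))))"
      using y by (intro fdet_plus_rank_one)
    also have "(\<Sum>i<n. y i * (of_real (s * (\<sigma> k)\<^sup>2) * cnj (w k i))) = of_real (s * (\<sigma> k)\<^sup>2 * Re g)"
    proof -
      have "(\<Sum>i<n. y i * (of_real (s * (\<sigma> k)\<^sup>2) * cnj (w k i))) = of_real (s * (\<sigma> k)\<^sup>2) * g"
        by (simp add: g_def sum_distrib_left mult_ac)
      also have "\<dots> = of_real (s * (\<sigma> k)\<^sup>2) * of_real (Re g)" using g_real by (rule arg_cong)
      finally show ?thesis by (simp only: of_real_mult)
    qed
    finally have "Re (fdet n (P (Suc k))) = Re (fdet n (P k)) * (1 + s * (\<sigma> k)\<^sup>2 * Re g)"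
      by (simp add: r(1) del: of_real_mult of_real_power)
    also have "\<dots> \<le> Re (fdet n (P k)) * (1 + s * (\<sigma> k)\<^sup>2)"
      using r \<open>0 < s\<close> mult_left_mono[OF \<open>Re g \<le> 1\<close>, of "s * (\<sigma> k)\<^sup>2"]
      by (intro mult_left_mono add_left_mono) auto
    also have "\<dots> \<le> c ^ n * (\<Prod>k<k. 1 + s * (\<sigma> k)\<^sup>2) * (1 + s * (\<sigma> k)\<^sup>2)"
      using Suc \<open>0 < s\<close> by (intro mult_right_mono) auto
    finally show ?case by (simp add: mult_ac)
  qed
  have "Im (qform n (P m) x) = 0 \<and> Re (qform n (gram n s X) x) \<le> Re (qform n (P m) x)" for x
  proof -
    have "s * (\<Sum>k<n. (cmod (app n X x k))\<^sup>2) \<le> s * (\<tau>\<^sup>2 * (\<Sum>i<n. (cmod (x i))\<^sup>2)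
        + (\<Sum>k<m. (\<sigma> k)\<^sup>2 * (cmod (\<Sum>i<n. cnj (w k i) * x i))\<^sup>2))"
      using le \<open>0 < s\<close> by (intro mult_left_mono) auto
    then show ?thesis
      unfolding form qform_gram by (simp add: c_def algebra_simps flip: sum_distrib_left)
  qed
  then obtain r where r: "fdet n (P m) = complex_of_real r * fdet n (gram n s X)" "1 \<le> r"
    using fdet_mono[OF pos_def_gram[of s n X], of "P m"] \<open>0 < s\<close> less_imp_le by blast
  obtain q where q: "fdet n (gram n s X) = complex_of_real q" "0 < q"
    using pos_def_fdet[OF pos_def_gram] \<open>0 < s\<close> less_imp_le by metis
  have "Re (fdet n (gram n s X)) \<le> Re (fdet n (P m))"
    using r q by (simp add: mult_le_cancel_right1)
  also have "\<dots> \<le> c ^ n * (\<Prod>k<m. 1 + s * (\<sigma> k)\<^sup>2)" by (rule bound) simp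
  finally show ?thesis by (simp add: c_def)
qed

subsection \<open>Complex inner product spaces\<close>

context
  fixes x y z :: "'a::complex_inner"
begin

lemma cinner_add_right: "cinner x (y + z) = cinner x y + cinner x z"
  by (metis cinner_commute cinner_add_left complex_cnj_add)

lemma cinner_scaleC_right: "cinner x (c *\<^sub>C y) = cnj c * cinner x y"
  by (metis cinner_commute cinner_scaleC_left complex_cnj_mult)

lemma cinner_zero_left [simp]: "cinner 0 x = 0"
  using cinner_add_left[of 0 0 x] by simp

lemma cinner_minus_left: "cinner (- x) y = - cinner x y"
  using cinner_add_left[of x "- x" y] cinner_add_left[of 0 0 y] by (simp add: add_eq_0_iff)

end

lemma cinner_zero_right [simp]: "cinner x (0 :: 'a::complex_inner) = 0"
  by (metis cinner_commute cinner_zero_left complex_cnj_zero)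

lemma cinner_diff_left: "cinner (x - y) z = cinner x z - cinner y (z :: 'a::complex_inner)"
  using cinner_add_left[of x "- y" z] by (simp add: cinner_minus_left)

lemma cinner_diff_right: "cinner z (x - y) = cinner z x - cinner z (y :: 'a::complex_inner)"
  by (metis cinner_commute cinner_diff_left complex_cnj_diff)

lemma cinner_sum_left: "cinner (\<Sum>i\<in>I. f i) (y :: 'a::complex_inner) = (\<Sum>i\<in>I. cinner (f i) y)"
  by (induction I rule: infinite_finite_induct) (simp_all add: cinner_add_left)

lemma cinner_sum_right: "cinner (y :: 'a::complex_inner) (\<Sum>i\<in>I. f i) = (\<Sum>i\<in>I. cinner y (f i))"
  by (induction I rule: infinite_finite_induct) (simp_all add: cinner_add_right)

lemma cinner_scaleR_left: "cinner (r *\<^sub>R x) (y :: 'a::complex_inner) = r * cinner x y"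
  by (simp add: scaleR_scaleC cinner_scaleC_left)

lemma cinner_scaleR_right: "cinner y (r *\<^sub>R x :: 'a::complex_inner) = r * cinner y x"
  by (simp add: scaleR_scaleC cinner_scaleC_right)

lemmas cinner_simps = cinner_add_left cinner_add_right cinner_diff_left cinner_diff_right
  cinner_scaleC_left cinner_scaleC_right cinner_scaleR_left cinner_scaleR_right

lemma cinner_eq_zero_swap: "cinner x y = 0 \<Longrightarrow> cinner y (x :: 'a::complex_inner) = 0"
  by (metis cinner_commute complex_cnj_zero)

lemma norm_sq_eq_Re_cinner: "(norm (x :: 'a::complex_inner))\<^sup>2 = Re (cinner x x)"
  by (simp add: cinner_self)

lemma norm_add_sq: "(norm (x + y :: 'a::complex_inner))\<^sup>2 = (norm x)\<^sup>2 + (norm y)\<^sup>2 + 2 * Re (cinner x y)"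
proof -
  have "Re (cinner y x) = Re (cinner x y)" by (subst cinner_commute) simp
  then show ?thesis by (simp add: norm_sq_eq_Re_cinner cinner_simps)
qed

lemma norm_diff_sq: "(norm (x - y :: 'a::complex_inner))\<^sup>2 = (norm x)\<^sup>2 + (norm y)\<^sup>2 - 2 * Re (cinner x y)"
  using norm_add_sq[of x "- y"] by (simp add: cinner_diff_right[of x 0 y, simplified])

lemma norm_scaleC: "norm (c *\<^sub>C x :: 'a::complex_inner) = cmod c * norm x"
proof -
  have "complex_of_real ((norm (c *\<^sub>C x))\<^sup>2) = c * cnj c * of_real ((norm x)\<^sup>2)"
    unfolding cinner_self[symmetric] cinner_scaleC_left cinner_scaleC_right by (simp only: mult_ac)
  also have "c * cnj c = of_real ((cmod c)\<^sup>2)"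
    using complex_norm_square[of c] by simp
  finally have "(norm (c *\<^sub>C x))\<^sup>2 = (cmod c * norm x)\<^sup>2"
    unfolding of_real_mult[symmetric] of_real_eq_iff power_mult_distrib .
  then show ?thesis by (simp add: power2_eq_iff_nonneg)
qed

lemma cmod_cinner_le: "cmod (cinner x (y :: 'a::complex_inner)) \<le> norm x * norm y"
proof (cases "y = 0")
  case False
  define c where "c = cinner x y / of_real ((norm y)\<^sup>2)"
  have "cinner (x - c *\<^sub>C y) y = 0"
    using False by (simp add: cinner_simps c_def cinner_self)
  then have "Re (cinner (x - c *\<^sub>C y) (c *\<^sub>C y)) = 0" by (simp only: cinner_scaleC_right) simp
  then have "(norm x)\<^sup>2 = (norm (x - c *\<^sub>C y))\<^sup>2 + (norm (c *\<^sub>C y))\<^sup>2"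
    using norm_add_sq[of "x - c *\<^sub>C y" "c *\<^sub>C y"] by simp
  then have "(norm (c *\<^sub>C y))\<^sup>2 \<le> (norm x)\<^sup>2" by simp
  then have "norm (c *\<^sub>C y) \<le> norm x" by (rule power2_le_imp_le) simp
  then show ?thesis
    using False by (simp add: norm_scaleC c_def norm_divide norm_mult power2_eq_square field_simps)
qed simp

lemma bounded_linear_cinner_left: "bounded_linear (\<lambda>x. cinner x (y :: 'a::complex_inner))"
proof (rule bounded_linear_intro)
  show "cmod (cinner x y) \<le> norm x * norm y" for x :: 'a by (rule cmod_cinner_le)
  show "cinner (x + z) y = cinner x y + cinner z y" for x z :: 'a by (rule cinner_add_left)
  show "cinner (r *\<^sub>R x) y = r *\<^sub>R cinner x y" for r and x :: 'a
    unfolding cinner_scaleR_left by (simp only: scaleR_conv_of_real)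
qed

lemmas tendsto_cinner_left = bounded_linear.tendsto[OF bounded_linear_cinner_left]

text \<open>The existence of adjoints rests on this. By the parallelogram identity minimising
  sequences of J are Cauchy, so the minimum is attained, and the vanishing of the first variation
  there is the representation.\<close>

lemma riesz_representation:
  fixes f :: "'a::chilbert_space \<Rightarrow> complex"
  assumes f: "bounded_linear f" "\<And>c x. f (c *\<^sub>C x) = c * f x"
  obtains y where "\<forall>x. f x = cinner x y"
proof -
  interpret f: bounded_linear f by fact
  obtain K where K: "\<And>x. cmod (f x) \<le> norm x * K" using f.bounded by blast
  \<comment> \<open>The representing vector minimises \<open>J\<close>.\<close>
  define J where "J x = (norm x)\<^sup>2 - 2 * Re (f x)" for x
  have J_lower: "- K\<^sup>2 \<le> J x" for x
  proof -
    have "0 \<le> (norm x - K)\<^sup>2" by simp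
    then have "2 * (norm x * K) \<le> (norm x)\<^sup>2 + K\<^sup>2" by (simp add: power2_diff)
    moreover have "Re (f x) \<le> norm x * K" using K[of x] complex_Re_le_cmod[of "f x"] by linarith
    ultimately show ?thesis by (simp add: J_def)
  qed
  then have bdd: "bdd_below (range J)" by (intro bdd_belowI2)
  define m where "m = (INF x. J x)"
  have m: "m \<le> J x" for x unfolding m_def by (intro cINF_lower bdd) simp
  have "\<exists>x. J x < m + 1 / (real n + 1)" for n
    using cINF_less_iff[OF _ bdd, of "m + 1 / (real n + 1)"] by (auto simp: m_def[symmetric] add_pos_nonneg)
  then obtain X where X: "\<And>n. J (X n) < m + 1 / (real n + 1)" by metis
  have mid: "(norm (x - y))\<^sup>2 \<le> 2 * J x + 2 * J y - 4 * m" for x y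
  proof -
    have "(norm (x + y))\<^sup>2 + (norm (x - y))\<^sup>2 = 2 * (norm x)\<^sup>2 + 2 * (norm y)\<^sup>2"
      by (simp add: norm_add_sq norm_diff_sq)
    moreover have "J ((1/2) *\<^sub>R (x + y)) = (norm (x + y))\<^sup>2 / 4 - Re (f x) - Re (f y)"
      unfolding J_def f.scaleR f.add norm_scaleR by (simp add: power_mult_distrib power_divide add_divide_distrib)
    moreover have "m \<le> J ((1/2) *\<^sub>R (x + y))" by (rule m)
    moreover have "J x = (norm x)\<^sup>2 - 2 * Re (f x)" "J y = (norm y)\<^sup>2 - 2 * Re (f y)"
      by (simp_all only: J_def)
    ultimately show ?thesis by linarith
  qed
  have "Cauchy X"
  proof (rule CauchyI)
    fix e :: real assume "0 < e"
    obtain N :: nat where N: "4 / e\<^sup>2 < real N" using reals_Archimedean2 by blast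
    show "\<exists>M. \<forall>i\<ge>M. \<forall>j\<ge>M. norm (X i - X j) < e"
    proof (intro exI allI impI)
      fix i j assume ij: "N \<le> i" "N \<le> j"
      have small: "J (X k) < m + 1 / (real N + 1)" if "N \<le> k" for k
        using X[of k] that by (smt (verit) frac_le of_nat_0_le_iff of_nat_mono)
      have "(norm (X i - X j))\<^sup>2 < 4 * (1 / (real N + 1))"
        using mid[of "X i" "X j"] small[OF ij(1)] small[OF ij(2)] by linarith
      also have "\<dots> < e\<^sup>2"
        using N \<open>0 < e\<close> by (simp add: field_simps) (smt (verit) zero_less_power)
      finally show "norm (X i - X j) < e" using \<open>0 < e\<close> by (simp add: power2_less_imp_less)
    qed
  qed
  then obtain y where y: "X \<longlonglongrightarrow> y" using convergentD Cauchy_convergent by blast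
  have "(\<lambda>n. J (X n)) \<longlonglongrightarrow> J y"
    unfolding J_def by (intro tendsto_intros y f.tendsto)
  moreover have "(\<lambda>n. m + 1 / (real n + 1)) \<longlonglongrightarrow> m + 0"
    by (intro tendsto_intros) real_asymp
  ultimately have "J y \<le> m + 0"
    using X by (intro LIMSEQ_le[of "\<lambda>n. J (X n)"]) (auto intro: less_imp_le)
  then have min: "J y \<le> J x" for x using m[of x] by simp
  have Re_eq: "Re (f x) = Re (cinner x y)" for x
  proof (rule ccontr)
    define a where "a = Re (cinner x y) - Re (f x)"
    assume "Re (f x) \<noteq> Re (cinner x y)"
    then have "a \<noteq> 0" by (simp add: a_def)
    have quad: "0 \<le> \<epsilon>\<^sup>2 * (norm x)\<^sup>2 + 2 * \<epsilon> * a" for \<epsilon> :: real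
    proof -
      have sym: "Re (cinner y x) = Re (cinner x y)" by (subst cinner_commute) simp
      have "J (y + \<epsilon> *\<^sub>R x) = J y + \<epsilon>\<^sup>2 * (norm x)\<^sup>2 + 2 * \<epsilon> * a"
        unfolding J_def norm_add_sq f.add f.scaleR
        by (simp add: a_def power_mult_distrib cinner_simps sym algebra_simps)
      then show ?thesis using min[of "y + \<epsilon> *\<^sub>R x"] by simp
    qed
    \<comment> \<open>The quadratic in \<epsilon> is negative at \<epsilon> = -a / q; adding 1 keeps
      the divisor positive even for x = 0.\<close>
    define q where "q = (norm x)\<^sup>2 + 1"
    have q: "0 < q" by (simp add: q_def add_nonneg_pos)
    have "(- a / q)\<^sup>2 * (norm x)\<^sup>2 + 2 * (- a / q) * a = a\<^sup>2 / q * ((norm x)\<^sup>2 / q - 2)"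
      using q by (simp add: power2_eq_square field_simps)
    moreover have "(norm x)\<^sup>2 / q < 2" using q by (simp add: q_def field_simps add_nonneg_pos)
    then have "a\<^sup>2 / q * ((norm x)\<^sup>2 / q - 2) < 0"
      using \<open>a \<noteq> 0\<close> q by (intro mult_pos_neg) auto
    ultimately show False using quad[of "- a / q"] by linarith
  qed
  \<comment> \<open>Real parts at i x are, up to sign, imaginary parts at x.\<close>
  have "f x = cinner x y" for x
    using Re_eq[of x] Re_eq[of "\<i> *\<^sub>C x"] by (simp add: f(2) cinner_simps complex_eq_iff)
  then show thesis by (intro that allI)
qed

lemma bounded_clinearD:
  assumes "bounded_clinear A"
  shows "bounded_linear A" "A (c *\<^sub>C x) = c *\<^sub>C A x" "A (x + y) = A x + A y" "A 0 = 0"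
    "A (x - y) = A x - A y" "norm (A x) \<le> onorm A * norm x" "A (\<Sum>i\<in>I. g i) = (\<Sum>i\<in>I. A (g i))"
  using assms unfolding bounded_clinear_def
  by (auto simp: linear_simps onorm linear_sum bounded_linear.linear)

text \<open>\<open>cadjoint\<close> is a definite description, so its defining property needs
  existence, pointwise from the representation of functionals, and uniqueness.\<close>

lemma cadjoint_cinner:
  assumes "bounded_clinear A"
  shows "cinner (A x) y = cinner x (cadjoint A y)"
proof -
  have "\<exists>z. \<forall>x. cinner (A x) y = cinner x z" for y
  proof -
    have "bounded_linear (\<lambda>x. cinner (A x) y)"
    proof (rule bounded_linear_intro)
      fix x
      have "cmod (cinner (A x) y) \<le> norm (A x) * norm y" by (rule cmod_cinner_le)
      also have "\<dots> \<le> onorm A * norm x * norm y"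
        using bounded_clinearD(6)[OF assms] by (intro mult_right_mono) auto
      finally show "cmod (cinner (A x) y) \<le> norm x * (onorm A * norm y)" by (simp add: mult_ac)
    qed (simp_all only: bounded_clinearD(2,3)[OF assms] cinner_add_left cinner_scaleC_left
        scaleR_scaleC scaleC_complex_def)
    moreover have "cinner (A (c *\<^sub>C x)) y = c * cinner (A x) y" for c x
      by (simp only: bounded_clinearD(2)[OF assms] cinner_scaleC_left)
    ultimately obtain z where "\<forall>x. cinner (A x) y = cinner x z"
      by (rule riesz_representation)
    then show ?thesis by blast
  qed
  then have "\<exists>B. \<forall>y x. cinner (A x) y = cinner x (B y)" by (intro choice allI)
  then obtain B where "\<forall>y x. cinner (A x) y = cinner x (B y)" by (rule exE)
  then have B: "cinner (A x) y = cinner x (B y)" for x y by simp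
  have C: "C = B" if "\<forall>x y. cinner (A x) y = cinner x (C y)" for C
  proof
    fix y
    have "cinner (C y - B y) (C y - B y) = 0"
      by (simp only: cinner_diff_right that[rule_format, symmetric] B[symmetric] diff_self)
    then show "C y = B y" by (simp add: cinner_self)
  qed
  have "\<forall>x y. cinner (A x) y = cinner x (cadjoint A y)"
    unfolding cadjoint_def
    by (rule theI[of "\<lambda>C. \<forall>x y. cinner (A x) y = cinner x (C y)", OF _ C]) (simp_all add: B)
  then show ?thesis by simp
qed

lemma cinner_ext: "(\<And>y. cinner y u = cinner y v) \<Longrightarrow> u = (v :: 'a::complex_inner)"
proof -
  assume "\<And>y. cinner y u = cinner y v"
  then have "cinner (u - v) (u - v) = 0" by (simp only: cinner_diff_right) simp
  then show ?thesis by (simp add: cinner_self)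
qed

lemma cadjoint_unique:
  assumes "bounded_clinear A" "\<And>y. cinner (A y) x = cinner y z"
  shows "cadjoint A x = z"
  by (rule cinner_ext) (simp only: cadjoint_cinner[OF assms(1), symmetric] assms(2))

lemma
  assumes "bounded_clinear A"
  shows cadjoint_add: "cadjoint A (x + y) = cadjoint A x + cadjoint A y"
    and cadjoint_scaleC: "cadjoint A (c *\<^sub>C x) = c *\<^sub>C cadjoint A x"
    and cadjoint_diff: "cadjoint A (x - y) = cadjoint A x - cadjoint A y"
    and cinner_cadjoint: "cinner (cadjoint A x) y = cinner x (A y)"
    and norm_cadjoint_le: "norm (cadjoint A x) \<le> onorm A * norm x"
proof -
  note * = cadjoint_cinner[OF assms]
  show "cadjoint A (x + y) = cadjoint A x + cadjoint A y"
    by (rule cadjoint_unique[OF assms]) (simp only: cinner_add_right *)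
  show "cadjoint A (c *\<^sub>C x) = c *\<^sub>C cadjoint A x"
    by (rule cadjoint_unique[OF assms]) (simp only: cinner_scaleC_right *)
  show "cadjoint A (x - y) = cadjoint A x - cadjoint A y"
    by (rule cadjoint_unique[OF assms]) (simp only: cinner_diff_right *)
  show "cinner (cadjoint A x) y = cinner x (A y)"
    using *[of y x] by (subst (1 2) cinner_commute) simp
  have "(norm (cadjoint A x))\<^sup>2 = Re (cinner (A (cadjoint A x)) x)"
    by (simp only: * norm_sq_eq_Re_cinner)
  also have "\<dots> \<le> norm (A (cadjoint A x)) * norm x"
    by (rule order_trans[OF complex_Re_le_cmod cmod_cinner_le])
  also have "\<dots> \<le> onorm A * norm (cadjoint A x) * norm x"
    using bounded_clinearD(6)[OF assms] by (intro mult_right_mono) auto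
  finally show "norm (cadjoint A x) \<le> onorm A * norm x"
    using onorm_pos_le[OF bounded_clinearD(1)[OF assms]]
    by (cases "norm (cadjoint A x) = 0") (auto simp: power2_eq_square mult_ac)
qed

lemma bounded_linear_cadjoint: "bounded_clinear A \<Longrightarrow> bounded_linear (cadjoint A)"
  by (rule bounded_linear_intro[of _ "onorm A"])
     (auto simp: cadjoint_add scaleR_scaleC cadjoint_scaleC mult.commute[of "norm _"] intro: norm_cadjoint_le)

lemma subspace_singular_space:
  assumes "bounded_clinear A"
  shows "complex_vector.subspace (singular_space A s)"
  using cadjoint_diff[OF assms, of 0 0]
  by (simp add: complex_vector.subspace_def singular_space_def bounded_clinearD(2-4)[OF assms]
      cadjoint_add[OF assms] cadjoint_scaleC[OF assms] scaleC_add_right scaleC_scaleC mult.commute)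


section \<open>Finite orthonormal sets and projections\<close>

definition orthonormal :: "'a::complex_inner set \<Rightarrow> bool" where
  "orthonormal E \<longleftrightarrow> (\<forall>e\<in>E. \<forall>f\<in>E. cinner e f = (if e = f then 1 else 0))"

text \<open>For a finite orthonormal \<open>E\<close> this is the orthogonal projection onto its
  span.\<close>

definition fproj :: "'a::complex_inner set \<Rightarrow> 'a \<Rightarrow> 'a" where
  "fproj E x = (\<Sum>e\<in>E. cinner x e *\<^sub>C e)"

lemma orthonormalD: "orthonormal E \<Longrightarrow> e \<in> E \<Longrightarrow> norm e = 1"
  unfolding orthonormal_def norm_eq_sqrt_cinner by simp

lemma cinner_fproj:
  assumes "orthonormal E" "finite E" "e \<in> E"
  shows "cinner (fproj E x) e = cinner x e"
proof -
  have "cinner (fproj E x) e = (\<Sum>f\<in>E. cinner x f * (if f = e then 1 else 0))"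
    unfolding fproj_def cinner_sum_left cinner_scaleC_left
    using assms(1,3) by (intro sum.cong) (auto simp: orthonormal_def)
  then show ?thesis using assms(2,3) by (simp add: if_distrib cong: if_cong)
qed

lemma cinner_diff_fproj:
  "orthonormal E \<Longrightarrow> finite E \<Longrightarrow> e \<in> E \<Longrightarrow> cinner (x - fproj E x) e = 0"
  by (simp add: cinner_diff_left cinner_fproj)

lemma norm_fproj_sq:
  assumes "orthonormal E" "finite E"
  shows "(norm (fproj E x))\<^sup>2 = (\<Sum>e\<in>E. (cmod (cinner x e))\<^sup>2)"
proof -
  have "cinner (fproj E x) (fproj E x) = (\<Sum>e\<in>E. cnj (cinner x e) * cinner x e)"
    by (subst (2) fproj_def) (simp add: cinner_sum_right cinner_scaleC_right cinner_fproj assms)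
  also have "\<dots> = of_real (\<Sum>e\<in>E. (cmod (cinner x e))\<^sup>2)"
    by (simp add: complex_norm_square mult.commute del: of_real_power)
  finally show ?thesis unfolding cinner_self of_real_eq_iff .
qed

lemma norm_decomp_fproj:
  assumes "orthonormal E" "finite E"
  shows "(norm x)\<^sup>2 = (\<Sum>e\<in>E. (cmod (cinner x e))\<^sup>2) + (norm (x - fproj E x))\<^sup>2"
proof -
  have "cinner (x - fproj E x) (fproj E x) = 0"
    by (subst (2) fproj_def) (simp add: cinner_sum_right cinner_scaleC_right cinner_diff_fproj assms)
  then show ?thesis
    using norm_add_sq[of "x - fproj E x" "fproj E x"] norm_fproj_sq[OF assms, of x] by simp
qed

lemma bessel:
  "orthonormal E \<Longrightarrow> finite E \<Longrightarrow> (\<Sum>e\<in>E. (cmod (cinner x e))\<^sup>2) \<le> (norm x)\<^sup>2"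
  using norm_decomp_fproj[of E x] by simp

lemma norm_diff_fproj_le:
  assumes "orthonormal E" "finite E"
  shows "norm (x - fproj E x) \<le> norm x"
proof (rule power2_le_imp_le)
  have "0 \<le> (\<Sum>e\<in>E. (cmod (cinner x e))\<^sup>2)" by (rule sum_nonneg) simp
  then show "(norm (x - fproj E x))\<^sup>2 \<le> (norm x)\<^sup>2"
    using norm_decomp_fproj[OF assms, of x] by linarith
qed simp

lemma orthonormal_independent:
  assumes "orthonormal E" "finite E"
  shows "complex_vector.independent E"
proof (rule complex_vector.independent_if_scalars_zero[OF \<open>finite E\<close>])
  fix f e assume 0: "(\<Sum>x\<in>E. f x *\<^sub>C x) = 0" and e: "e \<in> E"
  have "cinner (\<Sum>x\<in>E. f x *\<^sub>C x) e = (\<Sum>x\<in>E. f x * (if x = e then 1 else 0))"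
    unfolding cinner_sum_left cinner_scaleC_left
    using assms e by (intro sum.cong) (auto simp: orthonormal_def)
  also have "\<dots> = f e" using \<open>finite E\<close> e by (simp add: if_distrib cong: if_cong)
  finally show "f e = 0" by (simp add: 0)
qed

text \<open>\<open>E\<close> is an orthonormal subset of maximal size, sizes being bounded by the
  dimension: a nonzero vector of \<open>S\<close> orthogonal to \<open>E\<close> could be normalised
  and added. \<open>E\<close> spans \<open>S\<close>, because \<open>x - fproj E x\<close> lies in
  \<open>S\<close> and is orthogonal to \<open>E\<close>.\<close>

lemma cdim_orthonormal_basis:
  fixes S :: "'a::complex_inner set"
  assumes S: "complex_vector.subspace S" and dim: "cdim S = enat d"
  obtains E where "orthonormal E" "finite E" "E \<subseteq> S" "card E = d"
    "\<forall>x\<in>S. (\<forall>e\<in>E. cinner x e = 0) \<longrightarrow> x = 0"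
proof -
  have "\<exists>B. finite B \<and> S \<subseteq> complex_vector.span B" and d: "d = complex_vector.dim S"
    using dim unfolding cdim_def by (auto split: if_splits)
  then obtain B0 where B0: "finite B0" "S \<subseteq> complex_vector.span B0" by blast
  obtain B where B: "B \<subseteq> S" "complex_vector.independent B" "S \<subseteq> complex_vector.span B"
      "card B = complex_vector.dim S"
    by (rule complex_vector.basis_exists)
  have "finite B"
    using complex_vector.independent_span_bound[OF B0(1) B(2)] B(1) B0(2) by blast
  have le: "card E \<le> d" if "orthonormal E" "finite E" "E \<subseteq> S" for E
    using complex_vector.independent_span_bound[OF \<open>finite B\<close> orthonormal_independent[OF that(1,2)]]
      that(3) B(3,4) d by auto
  define Q where "Q k \<longleftrightarrow> (\<exists>E. orthonormal E \<and> finite E \<and> E \<subseteq> S \<and> card E = k)" for k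
  have Q0: "Q 0" unfolding Q_def by (intro exI[of _ "{}"]) (simp add: orthonormal_def)
  have Qd: "k \<le> d" if "Q k" for k using that le unfolding Q_def by blast
  have QG: "Q (Greatest Q)" by (rule GreatestI_nat[of Q 0 d, OF Q0 Qd])
  have greatest: "k \<le> Greatest Q" if "Q k" for k by (rule Greatest_le_nat[of Q k d, OF that Qd])
  from QG obtain E where E: "orthonormal E" "finite E" "E \<subseteq> S" "card E = Greatest Q"
    unfolding Q_def by blast
  have max: "x = 0" if x: "x \<in> S" "\<forall>e\<in>E. cinner x e = 0" for x
  proof (rule ccontr)
    assume "x \<noteq> 0"
    define u where "u = of_real (1 / norm x) *\<^sub>C x"
    have "norm u = 1" using \<open>x \<noteq> 0\<close> by (simp add: u_def norm_scaleC norm_divide)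
    then have uu: "cinner u u = 1" by (simp add: cinner_self)
    have ue: "cinner u e = 0" if "e \<in> E" for e using x(2) that by (simp add: u_def cinner_scaleC_left)
    have "u \<notin> E" using uu ue by force
    have "orthonormal (insert u E)"
      using E(1) uu ue cinner_eq_zero_swap[OF ue] \<open>u \<notin> E\<close> unfolding orthonormal_def by auto
    moreover have "u \<in> S" unfolding u_def using S x(1) by (rule complex_vector.subspace_scale)
    ultimately have "Q (Suc (card E))"
      unfolding Q_def using E \<open>u \<notin> E\<close> by (intro exI[of _ "insert u E"]) auto
    then show False using greatest[of "Suc (card E)"] E(4) by simp
  qed
  have "S \<subseteq> complex_vector.span E"
  proof
    fix x assume "x \<in> S"
    have F: "fproj E x \<in> complex_vector.span E"
      unfolding fproj_def by (intro complex_vector.span_sum complex_vector.span_scale complex_vector.span_base)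
    moreover have "complex_vector.span E \<subseteq> S" using E(3) S by (rule complex_vector.span_minimal)
    ultimately have "x - fproj E x \<in> S"
      using S \<open>x \<in> S\<close> by (intro complex_vector.subspace_diff) auto
    then have "x - fproj E x = 0" by (rule max) (simp add: cinner_diff_fproj E)
    then show "x \<in> complex_vector.span E" using F by simp
  qed
  then have "d \<le> card E" unfolding d using E(2) by (rule complex_vector.dim_le_card)
  then have "card E = d" using le[OF E(1-3)] by simp
  then show thesis using that[of E] E max by blast
qed

subsection \<open>Singular vectors of compact operators\<close>

lemma bounded_clinear_compact: "compact_operator X \<Longrightarrow> bounded_clinear X"
  by (simp add: compact_operator_def)

lemma norm_operator_sq: "bounded_clinear X \<Longrightarrow> (norm (X x))\<^sup>2 = Re (cinner (cadjoint X (X x)) x)"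
  by (simp only: cinner_cadjoint norm_sq_eq_Re_cinner)

text \<open>On the orthogonal complement of \<open>E\<close> the operator \<open>X\<^sup>* X\<close> would attain its norm
  at an eigenvector, so a norm exceeding \<open>\<tau>\<close> would give a singular value above \<open>\<tau>\<close>.\<close>

lemma norm_compact_le_orthogonal:
  fixes X :: "'a::chilbert_space \<Rightarrow> 'a"
  assumes X: "compact_operator X"
    and eig: "\<And>e. e \<in> E \<Longrightarrow> cadjoint X (X e) = of_real (r e) *\<^sub>C e"
    and "0 \<le> \<tau>"
    and small: "\<And>s x. \<tau> < s \<Longrightarrow> x \<in> singular_space X s \<Longrightarrow> \<forall>e\<in>E. cinner x e = 0 \<Longrightarrow> x = 0"
    and x: "\<forall>e\<in>E. cinner x e = 0"
  shows "norm (X x) \<le> \<tau> * norm x"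
proof -
  have b: "bounded_clinear X" using X by (rule bounded_clinear_compact)
  note lin = bounded_clinearD[OF b]
  define V where "V = {x. \<forall>e\<in>E. cinner x e = 0}"
  have V_scale: "c *\<^sub>C y \<in> V" if "y \<in> V" for c y using that by (simp add: V_def cinner_scaleC_left)
  have V_T: "cadjoint X (X y) \<in> V" if "y \<in> V" for y
    unfolding V_def
  proof (intro CollectI ballI)
    fix e assume e: "e \<in> E"
    have "cinner (cadjoint X (X y)) e = cinner y (cadjoint X (X e))"
      by (simp only: cinner_cadjoint[OF b] cadjoint_cinner[OF b])
    also have "\<dots> = 0" using that e by (simp add: eig cinner_scaleC_right V_def)
    finally show "cinner (cadjoint X (X y)) e = 0" .
  qed
  define R where "R = (\<lambda>y. norm (X y)) ` (V \<inter> cball 0 1)"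
  have bdd: "bdd_above R"
  proof (rule bdd_aboveI)
    fix q assume "q \<in> R"
    then obtain y where y: "norm y \<le> 1" "q = norm (X y)" by (auto simp: R_def)
    have "norm (X y) \<le> onorm X * norm y" by (rule lin(6))
    also have "\<dots> \<le> onorm X * 1" using onorm_pos_le[OF lin(1)] y by (intro mult_left_mono)
    finally show "q \<le> onorm X" using y by simp
  qed
  have "0 \<in> V" by (simp add: V_def)
  then have R0: "R \<noteq> {}" by (auto simp: R_def)
  define K where "K = Sup R"
  have K_unit: "norm (X y) \<le> K" if "y \<in> V" "norm y \<le> 1" for y
    unfolding K_def using that by (intro cSup_upper bdd) (auto simp: R_def)
  have K: "norm (X y) \<le> K * norm y" if "y \<in> V" for y
  proof (cases "y = 0")
    case False
    have "norm (X (of_real (1 / norm y) *\<^sub>C y)) \<le> K"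
      using that False by (intro K_unit V_scale) (simp_all add: norm_scaleC norm_divide)
    then show ?thesis using False by (simp add: lin(2) norm_scaleC norm_divide field_simps)
  qed (simp add: lin(4))
  show ?thesis
  proof (cases "K \<le> \<tau>")
    case True
    have "norm (X x) \<le> K * norm x" using x by (intro K) (simp add: V_def)
    also have "\<dots> \<le> \<tau> * norm x" using True by (intro mult_right_mono) auto
    finally show ?thesis .
  next
    case False
    then have "0 < K" using \<open>0 \<le> \<tau>\<close> by simp
    have "\<exists>y. y \<in> V \<and> norm y \<le> 1 \<and> K - 1 / (real n + 1) < norm (X y)" for n
    proof -
      have "\<exists>q\<in>R. K - 1 / (real n + 1) < q"
        using less_cSup_iff[OF R0 bdd, of "K - 1 / (real n + 1)"] unfolding K_def[symmetric]
        by (simp add: add_nonneg_pos)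
      then show ?thesis by (auto simp: R_def)
    qed
    then obtain y where y: "\<And>n. y n \<in> V" "\<And>n. norm (y n) \<le> 1"
        "\<And>n. K - 1 / (real n + 1) < norm (X (y n))"
      by metis
    have mem: "\<forall>n. X (y n) \<in> closure (X ` cball 0 1)"
    proof
      fix n show "X (y n) \<in> closure (X ` cball 0 1)"
      using y(2)[of n] closure_subset by (fastforce simp: dist_norm)
    qed
    have "compact (closure (X ` cball 0 1))" using X by (simp add: compact_operator_def)
    then have "seq_compact (closure (X ` cball 0 1))" by (rule compact_imp_seq_compact)
    from this mem obtain l \<phi> where "l \<in> closure (X ` cball 0 1)" "strict_mono (\<phi> :: nat \<Rightarrow> nat)"
        "((\<lambda>n. X (y n)) \<circ> \<phi>) \<longlonglongrightarrow> l"
      by (rule seq_compactE)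
    then have \<phi>: "strict_mono \<phi>" "(\<lambda>n. X (y (\<phi> n))) \<longlonglongrightarrow> l" by (simp_all add: o_def)
    have normX: "(\<lambda>n. norm (X (y (\<phi> n)))) \<longlonglongrightarrow> K"
    proof (rule tendsto_sandwich)
      show "\<forall>\<^sub>F n in sequentially. K - 1 / (real n + 1) \<le> norm (X (y (\<phi> n)))"
      proof (intro always_eventually allI)
        fix n
        have "1 / (real (\<phi> n) + 1) \<le> 1 / (real n + 1)"
          using seq_suble[OF \<phi>(1), of n] by (intro divide_left_mono) auto
        then show "K - 1 / (real n + 1) \<le> norm (X (y (\<phi> n)))" using y(3)[of "\<phi> n"] by linarith
      qed
      show "\<forall>\<^sub>F n in sequentially. norm (X (y (\<phi> n))) \<le> K"
        using K_unit y by (intro always_eventually allI) auto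
      show "(\<lambda>n. K - 1 / (real n + 1)) \<longlonglongrightarrow> K" by real_asymp
    qed simp
    define T where "T z = cadjoint X (X z)" for z
    have T_bound: "norm (T z) \<le> K * norm (X z)" if "z \<in> V" for z
    proof -
      have "(norm (T z))\<^sup>2 = Re (cinner (X z) (X (T z)))"
        unfolding norm_sq_eq_Re_cinner by (subst (1) T_def) (simp only: cinner_cadjoint[OF b])
      also have "\<dots> \<le> norm (X z) * norm (X (T z))"
        by (rule order_trans[OF complex_Re_le_cmod cmod_cinner_le])
      also have "\<dots> \<le> norm (X z) * (K * norm (T z))"
        using V_T[OF that] by (intro mult_left_mono K) (simp_all add: T_def)
      finally show ?thesis
        using \<open>0 < K\<close> by (cases "norm (T z) = 0") (auto simp: power2_eq_square mult_ac)
    qed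
    \<comment> \<open>The square is expanded using |T y| \<le> K |X y| and |y| \<le> 1. Thus vectors
      with |X y| close to K are approximate eigenvectors of T for K^2.\<close>
    have gap: "(norm (T (y n) - of_real (K\<^sup>2) *\<^sub>C y n))\<^sup>2 \<le> K\<^sup>2 * (K\<^sup>2 - (norm (X (y n)))\<^sup>2)" for n
    proof -
      have "(norm (T (y n)))\<^sup>2 \<le> (K * norm (X (y n)))\<^sup>2" using T_bound y(1) by (intro power_mono) auto
      moreover have "(norm (of_real (K\<^sup>2) *\<^sub>C y n))\<^sup>2 \<le> (K\<^sup>2)\<^sup>2"
        using y(2)[of n] by (intro power_mono) (auto simp: norm_scaleC norm_power mult_left_le)
      moreover have "Re (cinner (T (y n)) (of_real (K\<^sup>2) *\<^sub>C y n)) = K\<^sup>2 * (norm (X (y n)))\<^sup>2"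
        unfolding norm_operator_sq[OF b] T_def cinner_scaleC_right by (simp del: of_real_power)
      ultimately show ?thesis
        unfolding norm_diff_sq by (simp add: power2_eq_square algebra_simps)
    qed
    have "(\<lambda>n. (norm (T (y (\<phi> n)) - of_real (K\<^sup>2) *\<^sub>C y (\<phi> n)))\<^sup>2) \<longlonglongrightarrow> 0"
    proof (rule tendsto_sandwich)
      show "\<forall>\<^sub>F n in sequentially. 0 \<le> (norm (T (y (\<phi> n)) - of_real (K\<^sup>2) *\<^sub>C y (\<phi> n)))\<^sup>2"
        by (intro always_eventually allI zero_le_power2)
      show "\<forall>\<^sub>F n in sequentially. (norm (T (y (\<phi> n)) - of_real (K\<^sup>2) *\<^sub>C y (\<phi> n)))\<^sup>2
          \<le> K\<^sup>2 * (K\<^sup>2 - (norm (X (y (\<phi> n))))\<^sup>2)"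
        by (intro always_eventually allI gap)
      have "(\<lambda>n. K\<^sup>2 * (K\<^sup>2 - (norm (X (y (\<phi> n))))\<^sup>2)) \<longlonglongrightarrow> K\<^sup>2 * (K\<^sup>2 - K\<^sup>2)"
        by (intro tendsto_intros normX)
      then show "(\<lambda>n. K\<^sup>2 * (K\<^sup>2 - (norm (X (y (\<phi> n))))\<^sup>2)) \<longlonglongrightarrow> 0" by simp
    qed (rule tendsto_const)
    then have "(\<lambda>n. sqrt ((norm (T (y (\<phi> n)) - of_real (K\<^sup>2) *\<^sub>C y (\<phi> n)))\<^sup>2)) \<longlonglongrightarrow> sqrt 0"
      by (rule tendsto_real_sqrt)
    then have d0: "(\<lambda>n. T (y (\<phi> n)) - of_real (K\<^sup>2) *\<^sub>C y (\<phi> n)) \<longlonglongrightarrow> 0"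
      by (simp add: tendsto_norm_zero_iff)
    \<comment> \<open>Compactness yields convergence of X y only. The vectors y are recovered as
      K^-2 times T y - (T y - K^2 y), where both terms converge.\<close>
    have Tl: "(\<lambda>n. T (y (\<phi> n))) \<longlonglongrightarrow> cadjoint X l"
      unfolding T_def by (rule bounded_linear.tendsto[OF bounded_linear_cadjoint[OF b] \<phi>(2)])
    have "(\<lambda>n. (1 / K\<^sup>2) *\<^sub>R (T (y (\<phi> n)) - (T (y (\<phi> n)) - of_real (K\<^sup>2) *\<^sub>C y (\<phi> n))))
        \<longlonglongrightarrow> (1 / K\<^sup>2) *\<^sub>R (cadjoint X l - 0)"
      by (intro tendsto_intros Tl d0)
    moreover have "(1 / K\<^sup>2) *\<^sub>R (T (y n) - (T (y n) - of_real (K\<^sup>2) *\<^sub>C y n)) = y n" for n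
      using \<open>0 < K\<close> by (simp add: scaleR_scaleC[symmetric] del: of_real_power)
    ultimately have lim: "(\<lambda>n. y (\<phi> n)) \<longlonglongrightarrow> (1 / K\<^sup>2) *\<^sub>R cadjoint X l" by simp
    define z where "z = (1 / K\<^sup>2) *\<^sub>R cadjoint X l"
    note lim = lim[folded z_def]
    have "z \<in> V"
      unfolding V_def
    proof (intro CollectI ballI)
      fix e assume "e \<in> E"
      have "(\<lambda>n. cinner (y (\<phi> n)) e) \<longlonglongrightarrow> cinner z e" by (rule tendsto_cinner_left[OF lim])
      moreover have "cinner (y (\<phi> n)) e = 0" for n using y(1) \<open>e \<in> E\<close> by (simp add: V_def)
      ultimately show "cinner z e = 0" by (simp add: LIMSEQ_const_iff)
    qed
    have Xz: "(\<lambda>n. X (y (\<phi> n))) \<longlonglongrightarrow> X z" by (rule bounded_linear.tendsto[OF lin(1) lim])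
    then have "norm (X z) = K" using normX tendsto_norm LIMSEQ_unique by blast
    then have "z \<noteq> 0" using \<open>0 < K\<close> lin(4) by auto
    have "l = X z" using \<phi>(2) Xz LIMSEQ_unique by blast
    then have "cadjoint X (X z) = of_real (K\<^sup>2) *\<^sub>C z"
      using \<open>0 < K\<close> by (simp add: z_def scaleR_scaleC[symmetric] del: of_real_power)
    then have "z \<in> singular_space X K" by (simp add: singular_space_def)
    then have "z = 0" using False \<open>z \<in> V\<close> by (intro small[of K]) (auto simp: V_def)
    with \<open>z \<noteq> 0\<close> show ?thesis by contradiction
  qed
qed

text \<open>X^* X acts diagonally on the span of \<open>E\<close>, so X maps the projection onto
  that span and the remainder to orthogonal vectors, and the remainder is controlled by \<tau>. As
  forms, X^* X is at most \<tau>^2 plus the sum of the rank-one forms |X e|^2 e e^*.\<close>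

lemma norm_compact_sq_le:
  fixes X :: "'a::chilbert_space \<Rightarrow> 'a"
  assumes X: "compact_operator X" and E: "orthonormal E" "finite E"
    and eig: "\<And>e. e \<in> E \<Longrightarrow> cadjoint X (X e) = of_real ((norm (X e))\<^sup>2) *\<^sub>C e"
    and "0 \<le> \<tau>"
    and small: "\<And>s x. \<tau> < s \<Longrightarrow> x \<in> singular_space X s \<Longrightarrow> \<forall>e\<in>E. cinner x e = 0 \<Longrightarrow> x = 0"
  shows "(norm (X x))\<^sup>2 \<le> \<tau>\<^sup>2 * (norm x)\<^sup>2 + (\<Sum>e\<in>E. (norm (X e))\<^sup>2 * (cmod (cinner x e))\<^sup>2)"
proof -
  have b: "bounded_clinear X" using X by (rule bounded_clinear_compact)
  define r where "r = x - fproj E x"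
  have r0: "cinner r e = 0" if "e \<in> E" for e
    unfolding r_def using that E by (simp add: cinner_diff_fproj)
  have T: "cadjoint X (X (fproj E x)) = (\<Sum>e\<in>E. (cinner x e * of_real ((norm (X e))\<^sup>2)) *\<^sub>C e)"
  proof -
    interpret bounded_linear "cadjoint X" by (rule bounded_linear_cadjoint[OF b])
    show ?thesis
      unfolding fproj_def bounded_clinearD(7)[OF b] sum bounded_clinearD(2)[OF b] cadjoint_scaleC[OF b]
      by (intro sum.cong refl) (simp only: eig scaleC_scaleC)
  qed
  have "cinner (X (fproj E x)) (X r) = cinner (cadjoint X (X (fproj E x))) r"
    by (simp only: cinner_cadjoint[OF b])
  also have "\<dots> = (\<Sum>e\<in>E. (cinner x e * of_real ((norm (X e))\<^sup>2)) * cinner e r)"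
    unfolding T cinner_sum_left cinner_scaleC_left ..
  also have "\<dots> = 0" using r0 cinner_eq_zero_swap[of r] by (intro sum.neutral) auto
  finally have cross: "cinner (X (fproj E x)) (X r) = 0" .
  have "(norm (X (fproj E x)))\<^sup>2 = Re (cinner (cadjoint X (X (fproj E x))) (fproj E x))"
    by (rule norm_operator_sq[OF b])
  also have "cinner (cadjoint X (X (fproj E x))) (fproj E x)
      = (\<Sum>e\<in>E. (cinner x e * of_real ((norm (X e))\<^sup>2)) * cnj (cinner x e))"
    unfolding T cinner_sum_left cinner_scaleC_left
    by (intro sum.cong refl arg_cong2[of _ _ _ _ "(*)"])
       (metis cinner_commute cinner_fproj[OF E])
  also have "\<dots> = of_real (\<Sum>e\<in>E. (norm (X e))\<^sup>2 * (cmod (cinner x e))\<^sup>2)"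
    unfolding of_real_sum
    by (intro sum.cong refl) (simp add: complex_norm_square mult_ac del: of_real_power)
  finally have main: "(norm (X (fproj E x)))\<^sup>2 = (\<Sum>e\<in>E. (norm (X e))\<^sup>2 * (cmod (cinner x e))\<^sup>2)" by simp
  have "X x = X (fproj E x) + X r"
    unfolding bounded_clinearD(3)[OF b, symmetric] r_def by simp
  then have "(norm (X x))\<^sup>2 = (norm (X (fproj E x)))\<^sup>2 + (norm (X r))\<^sup>2"
    using norm_add_sq[of "X (fproj E x)" "X r"] cross by simp
  moreover have "norm (X r) \<le> \<tau> * norm r"
    using r0 by (intro norm_compact_le_orthogonal[OF X eig \<open>0 \<le> \<tau>\<close> small]) auto
  then have "(norm (X r))\<^sup>2 \<le> \<tau>\<^sup>2 * (norm x)\<^sup>2"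
  proof -
    assume "norm (X r) \<le> \<tau> * norm r"
    also have "\<dots> \<le> \<tau> * norm x"
      unfolding r_def using E \<open>0 \<le> \<tau>\<close> by (intro mult_left_mono norm_diff_fproj_le)
    finally have "(norm (X r))\<^sup>2 \<le> (\<tau> * norm x)\<^sup>2" by (intro power_mono) auto
    then show ?thesis by (simp add: power_mult_distrib)
  qed
  ultimately show ?thesis using main by linarith
qed

lemma norm_on_singular_space:
  assumes "bounded_clinear X" "e \<in> singular_space X s" "norm e = 1" "0 \<le> s"
  shows "norm (X e) = s"
proof -
  have "(norm (X e))\<^sup>2 = Re (cinner (of_real (s\<^sup>2) *\<^sub>C e) e)"
    using assms(2) by (simp only: norm_operator_sq[OF assms(1)] singular_space_def mem_Collect_eq)
  also have "\<dots> = s\<^sup>2" using assms(3) by (simp add: cinner_scaleC_left cinner_self del: of_real_power)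
  finally show ?thesis using assms(4) by (simp add: power2_eq_iff_nonneg)
qed

lemma singular_spaces_orthogonal:
  assumes X: "bounded_clinear X" and e: "e \<in> singular_space X s" and f: "f \<in> singular_space X r"
    and "0 < s" "0 < r" "s \<noteq> r"
  shows "cinner e f = 0"
proof -
  have "of_real (s\<^sup>2) * cinner e f = cinner (cadjoint X (X e)) f"
    using e by (simp only: singular_space_def mem_Collect_eq cinner_scaleC_left)
  also have "\<dots> = cinner e (cadjoint X (X f))"
    by (simp only: cinner_cadjoint[OF X] cadjoint_cinner[OF X])
  also have "\<dots> = of_real (r\<^sup>2) * cinner e f"
    using f by (simp add: singular_space_def cinner_scaleC_right)
  finally have "of_real (s\<^sup>2) * cinner e f = of_real (r\<^sup>2) * cinner e f" .
  moreover have "s\<^sup>2 \<noteq> r\<^sup>2" using assms(4-6) by (simp add: power2_eq_iff_nonneg)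
  ultimately show ?thesis unfolding mult_cancel_right of_real_eq_iff by simp
qed

lemma sum_le_schatten_sum:
  assumes "finite F" "F \<subseteq> singular_values X"
  shows "(\<Sum>s\<in>F. ennreal_of_enat (cdim (singular_space X s)) * ennreal (s powr p)) \<le> schatten_sum p X"
  unfolding schatten_sum_def
  by (subst nonneg_infsum_complete) (use assms in \<open>auto intro!: SUP_upper\<close>)

text \<open>With s > 0, infinite multiplicity would make a single summand infinite.\<close>

lemma cdim_singular_space_finite:
  assumes "schatten_sum p X < \<infinity>" "s \<in> singular_values X"
  obtains d where "cdim (singular_space X s) = enat d"
proof -
  have "ennreal_of_enat (cdim (singular_space X s)) * ennreal (s powr p) < \<infinity>"
    using sum_le_schatten_sum[of "{s}" X p] assms by (simp add: le_less_trans)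
  moreover have "0 < s" using assms(2) by (simp add: singular_values_def)
  ultimately have "cdim (singular_space X s) \<noteq> \<infinity>"
    by (cases "cdim (singular_space X s)") (auto simp: ennreal_mult_less_top)
  then show thesis using that by auto
qed

text \<open>\<open>E\<close> is the union of orthonormal bases of the singular spaces for s in
  \<open>F\<close>. On the basis for s one has |X e| = s, so the bases are disjoint, the sum with
  multiplicities becomes a sum over vectors, and the eigenvalue can be written as |X e|^2.\<close>

lemma singular_vectors_exist:
  fixes X :: "'a::chilbert_space \<Rightarrow> 'a"
  assumes X: "bounded_clinear X" and fin: "schatten_sum p X < \<infinity>"
    and F: "finite F" "F \<subseteq> singular_values X"
  obtains E where "orthonormal E" "finite E"
    "\<forall>e\<in>E. cadjoint X (X e) = of_real ((norm (X e))\<^sup>2) *\<^sub>C e \<and> X e \<noteq> 0"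
    "ennreal (\<Sum>e\<in>E. norm (X e) powr p)
      = (\<Sum>s\<in>F. ennreal_of_enat (cdim (singular_space X s)) * ennreal (s powr p))"
    "\<forall>s\<in>F. \<forall>x\<in>singular_space X s. (\<forall>e\<in>E. cinner x e = 0) \<longrightarrow> x = 0"
proof -
  have "\<exists>B. orthonormal B \<and> finite B \<and> B \<subseteq> singular_space X s
      \<and> cdim (singular_space X s) = enat (card B)
      \<and> (\<forall>x\<in>singular_space X s. (\<forall>e\<in>B. cinner x e = 0) \<longrightarrow> x = 0)" if "s \<in> F" for s
  proof -
    have "s \<in> singular_values X" using F that by blast
    with fin obtain d where d: "cdim (singular_space X s) = enat d" by (rule cdim_singular_space_finite)
    obtain B where "orthonormal B" "finite B" "B \<subseteq> singular_space X s" "card B = d"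
        "\<forall>x\<in>singular_space X s. (\<forall>e\<in>B. cinner x e = 0) \<longrightarrow> x = 0"
      by (rule cdim_orthonormal_basis[OF subspace_singular_space[OF X] d])
    then show ?thesis using d by (intro exI[of _ B]) simp
  qed
  then have "\<forall>s\<in>F. \<exists>B. orthonormal B \<and> finite B \<and> B \<subseteq> singular_space X s
      \<and> cdim (singular_space X s) = enat (card B)
      \<and> (\<forall>x\<in>singular_space X s. (\<forall>e\<in>B. cinner x e = 0) \<longrightarrow> x = 0)" by blast
  from bchoice[OF this] obtain B where B: "\<forall>s\<in>F. orthonormal (B s) \<and> finite (B s) \<and> B s \<subseteq> singular_space X s
      \<and> cdim (singular_space X s) = enat (card (B s))
      \<and> (\<forall>x\<in>singular_space X s. (\<forall>e\<in>B s. cinner x e = 0) \<longrightarrow> x = 0)" by (rule exE)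
  have pos: "0 < s" if "s \<in> F" for s using that F by (auto simp: singular_values_def)
  have sing: "e \<in> singular_space X s" and unit: "norm e = 1" if "s \<in> F" "e \<in> B s" for s e
    using that B orthonormalD[of "B s" e] by auto
  have norm_eq: "norm (X e) = s" if "s \<in> F" "e \<in> B s" for s e
    using norm_on_singular_space[OF X sing unit] that pos[of s] by simp
  have disj: "B s \<inter> B r = {}" if "s \<in> F" "r \<in> F" "s \<noteq> r" for s r
    using norm_eq that by blast
  define E where "E = (\<Union>s\<in>F. B s)"
  show thesis
  proof (rule that)
    show "orthonormal E"
      unfolding orthonormal_def
    proof (intro ballI)
      fix e f assume "e \<in> E" "f \<in> E"
      then obtain s r where s: "s \<in> F" "e \<in> B s" and r: "r \<in> F" "f \<in> B r" by (auto simp: E_def)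
      show "cinner e f = (if e = f then 1 else 0)"
      proof (cases "s = r")
        case True
        then show ?thesis using B s r unfolding orthonormal_def by blast
      next
        case False
        then have "e \<noteq> f" using disj s r by blast
        then show ?thesis
          using singular_spaces_orthogonal[OF X sing[OF s] sing[OF r] pos[OF s(1)] pos[OF r(1)] False] by simp
      qed
    qed
    show "finite E" unfolding E_def using F B by blast
    show "\<forall>e\<in>E. cadjoint X (X e) = of_real ((norm (X e))\<^sup>2) *\<^sub>C e \<and> X e \<noteq> 0"
    proof
      fix e assume "e \<in> E"
      then obtain s where s: "s \<in> F" "e \<in> B s" by (auto simp: E_def)
      then have "norm (X e) = s" by (rule norm_eq)
      moreover have "cadjoint X (X e) = of_real (s\<^sup>2) *\<^sub>C e"
        using sing[OF s] by (simp only: singular_space_def mem_Collect_eq)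
      ultimately show "cadjoint X (X e) = of_real ((norm (X e))\<^sup>2) *\<^sub>C e \<and> X e \<noteq> 0"
        using pos[OF s(1)] by auto
    qed
    have "(\<Sum>e\<in>E. norm (X e) powr p) = (\<Sum>s\<in>F. \<Sum>e\<in>B s. norm (X e) powr p)"
      unfolding E_def using F B disj by (intro sum.UNION_disjoint) auto
    also have "\<dots> = (\<Sum>s\<in>F. card (B s) * s powr p)"
      using norm_eq by (intro sum.cong refl) simp
    also have "ennreal \<dots> = (\<Sum>s\<in>F. ennreal (card (B s) * s powr p))"
      by (intro sum_ennreal[symmetric]) auto
    also have "\<dots> = (\<Sum>s\<in>F. ennreal_of_enat (cdim (singular_space X s)) * ennreal (s powr p))"
      using B by (intro sum.cong refl) (simp add: ennreal_mult ennreal_of_nat_eq_real_of_nat)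
    finally show "ennreal (\<Sum>e\<in>E. norm (X e) powr p)
      = (\<Sum>s\<in>F. ennreal_of_enat (cdim (singular_space X s)) * ennreal (s powr p))" .
    show "\<forall>s\<in>F. \<forall>x\<in>singular_space X s. (\<forall>e\<in>E. cinner x e = 0) \<longrightarrow> x = 0"
      using B unfolding E_def by blast
  qed
qed

text \<open>Each singular value above \<tau> has a nonzero singular space and so contributes at
  least \<tau>^p to the sum.\<close>

lemma finite_large_singular_values:
  fixes X :: "'a::chilbert_space \<Rightarrow> 'a"
  assumes X: "bounded_clinear X" and fin: "schatten_sum p X < \<infinity>" and "0 < \<tau>" "0 < p"
  shows "finite {s \<in> singular_values X. \<tau> < s}"
proof (rule ccontr)
  assume "infinite {s \<in> singular_values X. \<tau> < s}"
  obtain S where S: "schatten_sum p X = ennreal S" "0 \<le> S"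
    using fin by (cases "schatten_sum p X") auto
  obtain N :: nat where N: "S / \<tau> powr p < N" using reals_Archimedean2 by blast
  obtain F where F: "F \<subseteq> {s \<in> singular_values X. \<tau> < s}" "finite F" "card F = N"
    using infinite_arbitrarily_large[OF \<open>infinite _\<close>] by metis
  have "of_nat N * ennreal (\<tau> powr p) = (\<Sum>s\<in>F. 1 * ennreal (\<tau> powr p))" by (simp add: F)
  also have "\<dots> \<le> (\<Sum>s\<in>F. ennreal_of_enat (cdim (singular_space X s)) * ennreal (s powr p))"
  proof (intro sum_mono mult_mono ennreal_leI powr_mono2)
    fix s assume "s \<in> F"
    then have s: "s \<in> singular_values X" "\<tau> < s" using F by auto
    then show "\<tau> \<le> s" by simp
    obtain x where x: "x \<in> singular_space X s" "x \<noteq> 0" using s by (auto simp: singular_values_def)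
    obtain d where d: "cdim (singular_space X s) = enat d"
      using cdim_singular_space_finite[OF fin s(1)] .
    obtain B where B: "finite B" "card B = d" "\<forall>x\<in>singular_space X s. (\<forall>e\<in>B. cinner x e = 0) \<longrightarrow> x = 0"
      by (rule cdim_orthonormal_basis[OF subspace_singular_space[OF X] d])
    then have "B \<noteq> {}" using x by auto
    then have "1 \<le> d" using B(1) unfolding B(2)[symmetric] by (simp add: Suc_le_eq card_gt_0_iff)
    then show "1 \<le> ennreal_of_enat (cdim (singular_space X s))" by (simp add: d)
  qed (use \<open>0 < \<tau>\<close> \<open>0 < p\<close> in auto)
  also have "\<dots> \<le> ennreal S" unfolding S(1)[symmetric] using F by (intro sum_le_schatten_sum) auto
  finally have "ennreal (N * \<tau> powr p) \<le> ennreal S"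
    by (simp add: ennreal_mult ennreal_of_nat_eq_real_of_nat)
  then have "N * \<tau> powr p \<le> S" using S(2) by (simp add: ennreal_le_iff)
  then show False using N \<open>0 < \<tau>\<close> by (simp add: pos_divide_less_eq)
qed

definition suborthonormal :: "nat \<Rightarrow> (nat \<Rightarrow> 'a::complex_inner) \<Rightarrow> bool" where
  "suborthonormal n v \<longleftrightarrow> (\<forall>i<n. \<forall>j<n. i \<noteq> j \<longrightarrow> cinner (v i) (v j) = 0) \<and> (\<forall>i<n. norm (v i) \<le> 1)"

lemma norm_suborthonormal_sum:
  assumes "suborthonormal n v"
  shows "(norm (\<Sum>j<n. x j *\<^sub>C v j))\<^sup>2 \<le> (\<Sum>j<n. (cmod (x j))\<^sup>2)"
proof -
  define y where "y = (\<Sum>j<n. x j *\<^sub>C v j)"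
  have vy: "cinner (v i) y = cnj (x i) * of_real ((norm (v i))\<^sup>2)" if "i < n" for i
  proof -
    have "cinner (v i) y = (\<Sum>j<n. if j = i then cnj (x j) * cinner (v i) (v j) else 0)"
      unfolding y_def cinner_sum_right cinner_scaleC_right
      by (intro sum.cong refl) (use assms that in \<open>auto simp: suborthonormal_def\<close>)
    then show ?thesis using that by (simp add: cinner_self)
  qed
  have "cinner y y = (\<Sum>i<n. x i * cinner (v i) y)"
    by (subst (1) y_def) (simp only: cinner_sum_left cinner_scaleC_left)
  also have "\<dots> = of_real (\<Sum>i<n. (cmod (x i))\<^sup>2 * (norm (v i))\<^sup>2)"
    unfolding of_real_sum
    by (intro sum.cong refl) (simp add: vy complex_norm_square mult_ac del: of_real_power)
  finally have "(norm y)\<^sup>2 = (\<Sum>i<n. (cmod (x i))\<^sup>2 * (norm (v i))\<^sup>2)"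
    unfolding cinner_self of_real_eq_iff .
  also have "\<dots> \<le> (\<Sum>i<n. (cmod (x i))\<^sup>2 * 1)"
    using assms by (intro sum_mono mult_left_mono) (auto simp: suborthonormal_def power_le_one)
  finally show ?thesis by (simp add: y_def)
qed

text \<open>By duality: with z the combination of the v_j with coefficients <y, v_j>, one has Q =
  <y, z> and |z|^2 \<le> Q, hence Q^2 \<le> |y|^2 Q.\<close>

lemma suborthonormal_bessel:
  assumes "suborthonormal n v"
  shows "(\<Sum>j<n. (cmod (cinner y (v j)))\<^sup>2) \<le> (norm y)\<^sup>2"
proof -
  define Q where "Q = (\<Sum>j<n. (cmod (cinner y (v j)))\<^sup>2)"
  have Q0: "0 \<le> Q" by (simp add: Q_def sum_nonneg)
  define z where "z = (\<Sum>j<n. cinner y (v j) *\<^sub>C v j)"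
  have "cinner y z = of_real Q"
    unfolding z_def cinner_sum_right cinner_scaleC_right Q_def of_real_sum
    by (intro sum.cong refl) (simp add: complex_norm_square mult.commute del: of_real_power)
  then have "Q = cmod (cinner y z)" using Q0 by simp
  also have "\<dots> \<le> norm y * norm z" by (rule cmod_cinner_le)
  finally have "Q\<^sup>2 \<le> (norm y * norm z)\<^sup>2" using Q0 by (intro power_mono)
  also have "\<dots> \<le> (norm y)\<^sup>2 * Q"
    using norm_suborthonormal_sum[OF assms, of "\<lambda>j. cinner y (v j)"]
    unfolding power_mult_distrib z_def Q_def by (intro mult_left_mono) auto
  finally show ?thesis
    unfolding Q_def[symmetric] using Q0 by (cases "Q = 0") (auto simp: power2_eq_square)
qed

text \<open>Finitely many singular values exceed \<tau>; repeated by multiplicity, they are the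
  \<open>\<sigma> k\<close>, and the others enter through the n-th power of 1 + s \<tau>^2. As
  \<open>n\<close> is fixed before \<tau>, this power tends to 1 with \<tau> tending to 0. Neither
  \<open>m\<close> nor \<sigma> depends on \<open>s\<close>, so the bound can be integrated over
  \<open>s\<close>.\<close>

lemma fdet_gram_compression_le:
  fixes X :: "'a::chilbert_space \<Rightarrow> 'a"
  assumes X: "compact_operator X" and fin: "schatten_sum p X < \<infinity>" and "0 < p" "0 < \<tau>"
    and v: "suborthonormal n v" and u: "suborthonormal n u"
  obtains m :: nat and \<sigma> :: "nat \<Rightarrow> real" where "\<forall>k<m. 0 < \<sigma> k"
    "ennreal (\<Sum>k<m. \<sigma> k powr p) \<le> schatten_sum p X"
    "\<forall>s>0. Re (fdet n (gram n s (\<lambda>i j. cinner (X (v j)) (u i))))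
      \<le> (1 + s * \<tau>\<^sup>2) ^ n * (\<Prod>k<m. 1 + s * (\<sigma> k)\<^sup>2)"
proof -
  have b: "bounded_clinear X" using X by (rule bounded_clinear_compact)
  define F where "F = {s \<in> singular_values X. \<tau> < s}"
  have F: "finite F" "F \<subseteq> singular_values X"
    unfolding F_def using finite_large_singular_values[OF b fin \<open>0 < \<tau>\<close> \<open>0 < p\<close>] by auto
  obtain E where E: "orthonormal E" "finite E"
    "\<forall>e\<in>E. cadjoint X (X e) = of_real ((norm (X e))\<^sup>2) *\<^sub>C e \<and> X e \<noteq> 0"
    "ennreal (\<Sum>e\<in>E. norm (X e) powr p)
      = (\<Sum>s\<in>F. ennreal_of_enat (cdim (singular_space X s)) * ennreal (s powr p))"
    "\<forall>s\<in>F. \<forall>x\<in>singular_space X s. (\<forall>e\<in>E. cinner x e = 0) \<longrightarrow> x = 0"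
    using singular_vectors_exist[OF b fin F] .
  have small: "x = 0" if "\<tau> < s" "x \<in> singular_space X s" "\<forall>e\<in>E. cinner x e = 0" for s x
  proof (rule ccontr)
    assume "x \<noteq> 0"
    then have "s \<in> F" using that \<open>0 < \<tau>\<close> by (auto simp: F_def singular_values_def)
    then show False using E(5) that \<open>x \<noteq> 0\<close> by blast
  qed
  have bound: "(norm (X x))\<^sup>2 \<le> \<tau>\<^sup>2 * (norm x)\<^sup>2 + (\<Sum>e\<in>E. (norm (X e))\<^sup>2 * (cmod (cinner x e))\<^sup>2)" for x
    by (rule norm_compact_sq_le[OF X E(1,2)]) (use E(3) small \<open>0 < \<tau>\<close> in auto)
  obtain g where g: "bij_betw g {..<card E} E"
    using ex_bij_betw_nat_finite[OF E(2)] by (auto simp: atLeast0LessThan)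
  have gE: "g k \<in> E" if "k < card E" for k using g that by (auto dest: bij_betwE)
  show thesis
  proof (rule that)
    show "\<forall>k<card E. 0 < norm (X (g k))" using gE E(3) by auto
    have "(\<Sum>k<card E. norm (X (g k)) powr p) = (\<Sum>e\<in>E. norm (X e) powr p)"
      by (rule sum.reindex_bij_betw[OF g])
    then show "ennreal (\<Sum>k<card E. norm (X (g k)) powr p) \<le> schatten_sum p X"
      using sum_le_schatten_sum[OF F, of p] E(4) by simp
    show "\<forall>s>0. Re (fdet n (gram n s (\<lambda>i j. cinner (X (v j)) (u i))))
      \<le> (1 + s * \<tau>\<^sup>2) ^ n * (\<Prod>k<card E. 1 + s * (norm (X (g k)))\<^sup>2)"
    proof (intro allI impI fdet_gram_le[where w = "\<lambda>k i. cinner (g k) (v i)"])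
      fix k assume "k < card E"
      then have "norm (g k) = 1" using gE E(1) orthonormalD by blast
      then show "(\<Sum>i<n. (cmod (cinner (g k) (v i)))\<^sup>2) \<le> 1"
        using suborthonormal_bessel[OF v, of "g k"] by simp
    next
      fix x :: "nat \<Rightarrow> complex"
      define z where "z = (\<Sum>j<n. x j *\<^sub>C v j)"
      have "app n (\<lambda>i j. cinner (X (v j)) (u i)) x k = cinner (X z) (u k)" for k
        unfolding app_def z_def bounded_clinearD(7)[OF b] bounded_clinearD(2)[OF b] cinner_sum_left cinner_scaleC_left
        by (simp only: mult.commute)
      then have "(\<Sum>k<n. (cmod (app n (\<lambda>i j. cinner (X (v j)) (u i)) x k))\<^sup>2) \<le> (norm (X z))\<^sup>2"
        using suborthonormal_bessel[OF u, of "X z"] by simp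
      also have "\<dots> \<le> \<tau>\<^sup>2 * (norm z)\<^sup>2 + (\<Sum>e\<in>E. (norm (X e))\<^sup>2 * (cmod (cinner z e))\<^sup>2)" by (rule bound)
      also have "\<dots> \<le> \<tau>\<^sup>2 * (\<Sum>i<n. (cmod (x i))\<^sup>2) + (\<Sum>e\<in>E. (norm (X e))\<^sup>2 * (cmod (cinner z e))\<^sup>2)"
        using norm_suborthonormal_sum[OF v, of x] unfolding z_def
        by (intro add_right_mono mult_left_mono) auto
      also have "(\<Sum>e\<in>E. (norm (X e))\<^sup>2 * (cmod (cinner z e))\<^sup>2)
          = (\<Sum>k<card E. (norm (X (g k)))\<^sup>2 * (cmod (cinner z (g k)))\<^sup>2)"
        by (rule sum.reindex_bij_betw[OF g, symmetric])
      also have "\<dots> = (\<Sum>k<card E. (norm (X (g k)))\<^sup>2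
          * (cmod (\<Sum>i<n. cnj (cinner (g k) (v i)) * x i))\<^sup>2)"
        unfolding z_def cinner_sum_left cinner_scaleC_left cinner_commute[symmetric]
        by (simp only: mult.commute)
      finally show "(\<Sum>k<n. (cmod (app n (\<lambda>i j. cinner (X (v j)) (u i)) x k))\<^sup>2)
        \<le> \<tau>\<^sup>2 * (\<Sum>i<n. (cmod (x i))\<^sup>2) + (\<Sum>k<card E. (norm (X (g k)))\<^sup>2
          * (cmod (\<Sum>i<n. cnj (cinner (g k) (v i)) * x i))\<^sup>2)" .
    qed simp
  qed
qed

subsection \<open>Compression to finitely many coordinates\<close>

text \<open>The last coordinate is the normalised rest of \<open>x\<close>; it is \<open>0\<close> when nothing is missing
  (since \<open>1 / 0 = 0\<close>).\<close>

lemma suborthonormal_complete: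
  fixes g :: "nat \<Rightarrow> 'a::complex_inner"
  assumes gg: "\<And>i j. i < N \<Longrightarrow> j < N \<Longrightarrow> cinner (g i) (g j) = (if i = j then 1 else 0)"
  obtains v where "suborthonormal (Suc N) v" "\<forall>k<N. v k = g k"
    "x = (\<Sum>k<Suc N. cinner x (v k) *\<^sub>C v k)"
proof -
  define x' where "x' = x - (\<Sum>k<N. cinner x (g k) *\<^sub>C g k)"
  have x'g: "cinner x' (g j) = 0" if "j < N" for j
  proof -
    have "(\<Sum>k<N. cinner x (g k) * cinner (g k) (g j)) = (\<Sum>k<N. if k = j then cinner x (g k) else 0)"
      using that by (intro sum.cong refl) (simp add: gg)
    then show ?thesis using that by (simp add: x'_def cinner_diff_left cinner_sum_left cinner_scaleC_left)
  qed
  have g1: "norm (g k) = 1" if "k < N" for k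
    using gg[OF that that] unfolding norm_eq_sqrt_cinner by simp
  define v where "v k = (if k < N then g k else (1 / norm x') *\<^sub>R x')" for k
  show thesis
  proof (rule that)
    show "suborthonormal (Suc N) v"
      unfolding suborthonormal_def
    proof (intro conjI allI impI)
      show "cinner (v i) (v j) = 0" if "i < Suc N" "j < Suc N" "i \<noteq> j" for i j
        using that gg x'g cinner_eq_zero_swap[OF x'g] unfolding v_def
        by (auto simp: cinner_scaleR_left cinner_scaleR_right less_Suc_eq)
      show "norm (v i) \<le> 1" if "i < Suc N" for i
        using g1 unfolding v_def by simp
    qed
    show "\<forall>k<N. v k = g k" by (simp add: v_def)
    have "cinner (\<Sum>k<N. cinner x (g k) *\<^sub>C g k) x' = 0"
      unfolding cinner_sum_left cinner_scaleC_left
      using cinner_eq_zero_swap[OF x'g] by (intro sum.neutral) auto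
    moreover have "x = x' + (\<Sum>k<N. cinner x (g k) *\<^sub>C g k)" by (simp add: x'_def)
    ultimately have "cinner x x' = cinner x' x'" by (metis add.right_neutral cinner_add_left)
    then have "cinner x x' = of_real ((norm x')\<^sup>2)" by (simp only: cinner_self)
    then have "cinner x (v N) *\<^sub>C v N = x'"
      by (cases "x' = 0") (simp_all add: v_def cinner_scaleC_right scaleR_scaleC scaleC_scaleC power2_eq_square scaleC_one)
    then have "(\<Sum>k<Suc N. cinner x (v k) *\<^sub>C v k) = (\<Sum>k<N. cinner x (g k) *\<^sub>C g k) + x'"
      by (simp add: v_def)
    then show "x = (\<Sum>k<Suc N. cinner x (v k) *\<^sub>C v k)" by (simp add: x'_def)
  qed
qed

text \<open>One vector is added to \<open>E\<close> so that \<open>x\<close> lies in the span of the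
  family \<open>v\<close>, and one to the normalised images A e so that B x lies in the span of the
  family \<open>u\<close>. In these coordinates A is diagonal, while the compression of B still sees
  B x. Both families are chosen before \<open>s\<close> and \<open>t\<close>.\<close>

lemma compression_circle_mean:
  fixes A B :: "'a::chilbert_space \<Rightarrow> 'a"
  assumes A: "bounded_clinear A" and B: "bounded_clinear B" and Bx: "B x \<noteq> 0"
    and E: "orthonormal E" "finite E" "\<forall>e\<in>E. cadjoint A (A e) = of_real ((norm (A e))\<^sup>2) *\<^sub>C e \<and> A e \<noteq> 0"
  obtains n :: nat and v u :: "nat \<Rightarrow> 'a" where "suborthonormal n v" "suborthonormal n u"
    "\<forall>s>0. \<forall>t>0. (\<Sum>e\<in>E. ln (1 + s * (norm (A e))\<^sup>2))
        + ln (1 + t\<^sup>2 * s * (norm (B x) / norm x)\<^sup>2 / (1 + s * (onorm A)\<^sup>2)\<^sup>2)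
      \<le> integral {0..1} (\<lambda>\<theta>. ln (Re (fdet n (gram n s
          (\<lambda>i j. cinner (A (v j) + (of_real t * circ \<theta>) *\<^sub>C B (v j)) (u i))))))"
proof -
  define N where "N = card E"
  obtain g where g: "bij_betw g {..<N} E"
    using ex_bij_betw_nat_finite[OF E(2)] by (auto simp: N_def atLeast0LessThan)
  have gE: "g k \<in> E" if "k < N" for k using g that by (auto dest: bij_betwE)
  have g_inj: "g i = g j \<longleftrightarrow> i = j" if "i < N" "j < N" for i j
    using g that by (auto simp: bij_betw_def inj_on_eq_iff)
  have gg: "cinner (g i) (g j) = (if i = j then 1 else 0)" if "i < N" "j < N" for i j
    using E(1) gE g_inj that unfolding orthonormal_def by simp
  have Ag0: "A (g k) \<noteq> 0" if "k < N" for k using E(3) gE that by blast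
  have TA: "cadjoint A (A (g k)) = of_real ((norm (A (g k)))\<^sup>2) *\<^sub>C g k" if "k < N" for k
    using E(3) gE that by blast
  have AA: "cinner (A y) (A (g j)) = of_real ((norm (A (g j)))\<^sup>2) * cinner y (g j)" if "j < N" for y j
    unfolding cadjoint_cinner[OF A] TA[OF that] cinner_scaleC_right by (simp del: of_real_power)
  define h where "h k = (1 / norm (A (g k))) *\<^sub>R A (g k)" for k
  have Ah: "cinner (A y) (h j) = of_real (norm (A (g j))) * cinner y (g j)" if "j < N" for y j
    using Ag0[OF that] by (simp add: h_def cinner_scaleR_right AA[OF that] power2_eq_square)
  have hh: "cinner (h i) (h j) = (if i = j then 1 else 0)" if "i < N" "j < N" for i j
    using that Ag0 by (subst h_def) (simp add: cinner_scaleR_left Ah gg)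
  define y where "y = B x"
  define n where "n = Suc N"
  obtain v where v: "suborthonormal n v" and vg: "\<forall>k<N. v k = g k"
    and x_exp: "x = (\<Sum>k<n. cinner x (v k) *\<^sub>C v k)"
    unfolding n_def by (rule suborthonormal_complete[OF gg])
  obtain u where u: "suborthonormal n u" and uh: "\<forall>k<N. u k = h k"
    and y_exp: "y = (\<Sum>k<n. cinner y (u k) *\<^sub>C u k)"
    unfolding n_def by (rule suborthonormal_complete[OF hh])
  define d where "d i = cinner (A (v i)) (u i)" for i
  \<comment> \<open>For i < N the reason is that A^* u_i is a multiple of v_i, for i = N that A v_j
    is a multiple of u_j. Of the last diagonal entry only a bound will be used.\<close>
  have diag: "cinner (A (v j)) (u i) = (if i = j then d i else 0)" if "i < n" "j < n" for i j
  proof (cases "i = j")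
    case False
    show ?thesis
    proof (cases "i < N")
      case True
      then have "cinner (A (v j)) (u i) = of_real (norm (A (g i))) * cinner (v j) (g i)"
        by (simp add: uh Ah)
      also have "cinner (v j) (g i) = cinner (v j) (v i)" using True by (simp add: vg)
      also have "\<dots> = 0" using v that False by (simp add: suborthonormal_def)
      finally show ?thesis using False by simp
    next
      case i: False
      then have "j < N" using that False by (simp add: n_def)
      then have "A (v j) = of_real (norm (A (g j))) *\<^sub>C u j"
        using Ag0 by (simp add: vg uh h_def scaleR_scaleC[symmetric])
      moreover have "cinner (u j) (u i) = 0" using u that False by (simp add: suborthonormal_def)
      ultimately show ?thesis using False by (simp add: cinner_scaleC_left)
    qed
  qed (simp add: d_def)
  have d_norm: "d i = of_real (norm (A (g i)))" if "i < N" for i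
    using that by (simp add: d_def uh vg Ah gg)
  define M where "M = onorm A"
  have M0: "0 \<le> M" unfolding M_def by (rule onorm_pos_le[OF bounded_clinearD(1)[OF A]])
  have d_le: "cmod (d i) \<le> M" if "i < n" for i
  proof -
    have "cmod (d i) \<le> norm (A (v i)) * norm (u i)" unfolding d_def by (rule cmod_cinner_le)
    also have "\<dots> \<le> norm (A (v i)) * 1"
      using u that by (intro mult_left_mono) (auto simp: suborthonormal_def)
    also have "\<dots> \<le> M * norm (v i)" unfolding M_def using bounded_clinearD(6)[OF A] by simp
    also have "\<dots> \<le> M * 1" using v that M0 by (intro mult_left_mono) (auto simp: suborthonormal_def)
    finally show ?thesis by simp
  qed
  \<comment> \<open>With \<open>c\<close> the coordinates of y = B x, the \<open>b j\<close> are the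
    coordinates of B^* y. Pairing them with the coordinates of \<open>x\<close> gives |y|^2, which
    bounds \<open>b\<close> from below.\<close>
  define c where "c i = cinner y (u i)" for i
  define Bm where "Bm i j = cinner (B (v j)) (u i)" for i j
  define b where "b j = (\<Sum>i<n. cnj (Bm i j) * c i)" for j
  have b: "b j = cinner y (B (v j))" for j
  proof -
    have "cinner y (B (v j)) = (\<Sum>k<n. cinner y (u k) * cinner (u k) (B (v j)))"
      by (subst y_exp) (simp only: cinner_sum_left cinner_scaleC_left)
    then show ?thesis
      unfolding b_def Bm_def c_def cinner_commute[symmetric] by (simp only: mult.commute)
  qed
  have y0: "y \<noteq> 0" using Bx by (simp add: y_def)
  have x0: "x \<noteq> 0" using Bx bounded_clinearD(4)[OF B] by auto
  define \<beta> where "\<beta> = (norm y / norm x)\<^sup>2"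
  have b_lower: "(norm y)\<^sup>2 * \<beta> \<le> (\<Sum>j<n. (cmod (b j))\<^sup>2)"
  proof -
    have "cinner y y = (\<Sum>k<n. cnj (cinner x (v k)) * b k)"
      unfolding b by (subst (2) y_def, subst x_exp)
        (simp only: bounded_clinearD(7)[OF B] bounded_clinearD(2)[OF B] cinner_sum_right cinner_scaleC_right)
    then have "(norm y)\<^sup>2 = cmod (\<Sum>k<n. b k * cnj (cinner x (v k)))"
      using norm_of_real[of "(norm y)\<^sup>2", where 'a = complex]
      by (simp add: cinner_self mult.commute del: of_real_power norm_of_real)
    then have "((norm y)\<^sup>2)\<^sup>2 \<le> (\<Sum>j<n. (cmod (b j))\<^sup>2) * (\<Sum>k<n. (cmod (cinner x (v k)))\<^sup>2)"
      using cauchy_schwarz_two_sums[of b "\<lambda>k. cinner x (v k)" "\<lambda>_. 0" "\<lambda>_. 0" n] by simp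
    also have "\<dots> \<le> (\<Sum>j<n. (cmod (b j))\<^sup>2) * (norm x)\<^sup>2"
      using suborthonormal_bessel[OF v, of x] by (intro mult_left_mono sum_nonneg) auto
    finally show ?thesis using x0 by (simp add: \<beta>_def power_divide field_simps power2_eq_square)
  qed
  have c_ex: "\<exists>i<n. c i \<noteq> 0"
  proof (rule ccontr)
    assume "\<not> ?thesis"
    then have "y = 0" by (subst y_exp) (auto simp: c_def intro!: sum.neutral)
    with y0 show False by contradiction
  qed
  show thesis
  proof (rule that[OF v u], intro allI impI)
    fix s t :: real assume s: "0 < s" and t: "0 < t"
    define H where "H i = 1 + s * (cmod (d i))\<^sup>2" for i
    define hc where "hc = (\<Sum>i<n. (cmod (c i))\<^sup>2 * H i)"
    define m where "m = 1 + s * M\<^sup>2"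
    have m: "0 < m" using s by (simp add: m_def add_pos_nonneg)
    have H1: "1 \<le> H i" for i using s by (simp add: H_def)
    have H0: "0 < H i" for i using H1[of i] by linarith
    have Hm: "H i \<le> m" if "i < n" for i
      using d_le[OF that] s unfolding H_def m_def by (intro add_left_mono mult_left_mono power_mono) auto
    have "hc \<le> (\<Sum>i<n. (cmod (c i))\<^sup>2 * m)"
      unfolding hc_def using Hm by (intro sum_mono mult_left_mono) auto
    also have "\<dots> \<le> (norm y)\<^sup>2 * m"
      using suborthonormal_bessel[OF u, of y] m unfolding c_def sum_distrib_right[symmetric]
      by (intro mult_right_mono) auto
    finally have hc_le: "hc \<le> (norm y)\<^sup>2 * m" .
    have "0 < (\<Sum>i<n. (cmod (c i))\<^sup>2)" by (rule sum_norm_sq_pos[OF c_ex])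
    also have "\<dots> \<le> hc" unfolding hc_def using H1 by (intro sum_mono) (simp add: mult_le_cancel_left1)
    finally have hc0: "0 < hc" .
    \<comment> \<open>The bound \<open>m\<close> for the \<open>H i\<close> enters twice, through hc
      \<le> |y|^2 m and through the denominators \<open>H j\<close>; this is why it is squared in
      the gain.\<close>
    have "\<beta> / m\<^sup>2 = ((norm y)\<^sup>2 * \<beta> / m) / ((norm y)\<^sup>2 * m)"
      using y0 m by (simp add: power2_eq_square)
    also have "\<dots> \<le> ((norm y)\<^sup>2 * \<beta> / m) / hc"
      using hc_le hc0 m by (intro divide_left_mono mult_pos_pos) (auto simp: \<beta>_def y0)
    also have "\<dots> \<le> ((\<Sum>j<n. (cmod (b j))\<^sup>2) / m) / hc"
      using b_lower m hc0 by (intro divide_right_mono) auto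
    also have "\<dots> \<le> (\<Sum>j<n. (cmod (b j))\<^sup>2 / H j) / hc"
      unfolding sum_divide_distrib using Hm H0 hc0 m
      by (intro divide_right_mono sum_mono divide_left_mono mult_pos_pos) auto
    finally have "\<beta> / m\<^sup>2 \<le> (\<Sum>j<n. (cmod (b j))\<^sup>2 / H j) / hc" .
    then have "t\<^sup>2 * s * (\<beta> / m\<^sup>2) \<le> t\<^sup>2 * s * ((\<Sum>j<n. (cmod (b j))\<^sup>2 / H j) / hc)"
      using s by (intro mult_left_mono) auto
    moreover have "0 \<le> t\<^sup>2 * s * (\<beta> / m\<^sup>2)" using s by (simp add: \<beta>_def)
    ultimately have W: "ln (1 + t\<^sup>2 * s * \<beta> / m\<^sup>2) \<le> ln (1 + t\<^sup>2 * s / hc * (\<Sum>j<n. (cmod (b j))\<^sup>2 / H j))"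
      by (intro ln_mono) (auto simp: mult_ac)
    have "(\<Sum>e\<in>E. ln (1 + s * (norm (A e))\<^sup>2)) = (\<Sum>k<N. ln (1 + s * (norm (A (g k)))\<^sup>2))"
      by (rule sum.reindex_bij_betw[OF g, symmetric])
    also have "\<dots> = (\<Sum>k<N. ln (H k))" by (intro sum.cong refl) (simp add: H_def d_norm)
    also have "\<dots> \<le> (\<Sum>k<n. ln (H k))" using H1 by (simp add: n_def)
    finally have "(\<Sum>e\<in>E. ln (1 + s * (norm (A e))\<^sup>2)) + ln (1 + t\<^sup>2 * s * \<beta> / m\<^sup>2)
        \<le> (\<Sum>k<n. ln (H k)) + ln (1 + t\<^sup>2 * s / hc * (\<Sum>j<n. (cmod (b j))\<^sup>2 / H j))"
      using W by linarith
    also have "\<dots> \<le> integral {0..1} (\<lambda>\<theta>. ln (Re (fdet n (gram n s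
        (\<lambda>i j. (if i = j then d i else 0) + of_real t * circ \<theta> * Bm i j)))))"
      unfolding H_def b_def hc_def by (rule ln_fdet_circle_mean[OF s t c_ex])
    also have "\<dots> = integral {0..1} (\<lambda>\<theta>. ln (Re (fdet n (gram n s
        (\<lambda>i j. cinner (A (v j) + (of_real t * circ \<theta>) *\<^sub>C B (v j)) (u i))))))"
    proof (intro integral_cong arg_cong[where f = "\<lambda>z. ln (Re z)"] fdet_cong)
      fix \<theta> i j assume "i < n" "j < n"
      then show "gram n s (\<lambda>i j. (if i = j then d i else 0) + of_real t * circ \<theta> * Bm i j) i j
          = gram n s (\<lambda>i j. cinner (A (v j) + (of_real t * circ \<theta>) *\<^sub>C B (v j)) (u i)) i j"
        by (simp add: gram_def cinner_add_left cinner_scaleC_left diag Bm_def)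
    qed
    finally show "(\<Sum>e\<in>E. ln (1 + s * (norm (A e))\<^sup>2))
        + ln (1 + t\<^sup>2 * s * (norm (B x) / norm x)\<^sup>2 / (1 + s * (onorm A)\<^sup>2)\<^sup>2)
      \<le> integral {0..1} (\<lambda>\<theta>. ln (Re (fdet n (gram n s
          (\<lambda>i j. cinner (A (v j) + (of_real t * circ \<theta>) *\<^sub>C B (v j)) (u i))))))"
      by (simp only: \<beta>_def m_def M_def y_def)
  qed
qed

subsection \<open>Integrating over the scale\<close>

text \<open>Against the weight \<open>s\<^bsup>-a-1\<^esup>\<close> on the positive half-line, \<open>ln (1 + s x)\<close> integrates to
  a constant multiple of \<open>x\<^sup>a\<close>, which turns \<open>ln det (1 + s X\<^sup>* X)\<close> into \<open>Tr |X|\<^bsup>2a\<^esup>\<close>.\<close>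

definition wt :: "real \<Rightarrow> real \<Rightarrow> real" where
  "wt a s = (if 0 < s then s powr (- a - 1) else 0)"

lemma wt_nonneg [simp]: "0 \<le> wt a s"
  by (simp add: wt_def)

lemma measurable_wt [measurable]: "wt a \<in> borel_measurable borel"
  unfolding wt_def by measurable

definition wt_ln :: "real \<Rightarrow> ennreal" where
  "wt_ln a = (\<integral>\<^sup>+s. ennreal (wt a s * ln (1 + s)) \<partial>lborel)"

text \<open>Up to 1 the integrand is at most s^(-a) by ln (1 + s) \<le> s, integrable as a < 1.
  Beyond 1 it is at most K s^(-a/2-1), integrable as a > 0.\<close>

lemma wt_ln_finite:
  assumes "0 < a" "a < 1"
  shows "wt_ln a < \<infinity>"
proof -
  \<comment> \<open>This comes from ln y \<le> y - 1 at y = (1 + s)^(a/2), together with 1 + s \<le>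
    2 s for s \<ge> 1.\<close>
  define K where "K = 2 / a * 2 powr (a / 2)"
  have "((\<lambda>s. s powr (- a)) has_integral (1 powr (- a + 1) / (- a + 1))) {0..1}"
    using assms by (intro has_integral_powr_from_0) auto
  from nn_integral_has_integral_lebesgue'[OF _ this]
  have I1: "(\<integral>\<^sup>+s. ennreal (s powr (- a)) * indicator {0..1} s \<partial>lborel) < \<infinity>" by simp
  have "((\<lambda>s. s powr (- a / 2 - 1)) has_integral - (1 powr (- a / 2 - 1 + 1)) / (- a / 2 - 1 + 1)) {1..}"
    using assms by (intro has_integral_powr_to_inf) auto
  then have "((\<lambda>s. K * s powr (- a / 2 - 1)) has_integral K * (- (1 powr (- a / 2 - 1 + 1)) / (- a / 2 - 1 + 1))) {1..}"
    by (rule has_integral_mult_right)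
  from nn_integral_has_integral_lebesgue'[OF _ this]
  have I2: "(\<integral>\<^sup>+s. ennreal (K * s powr (- a / 2 - 1)) * indicator {1..} s \<partial>lborel) < \<infinity>"
    using assms by (simp add: K_def)
  have "wt_ln a \<le> (\<integral>\<^sup>+s. ennreal (s powr (- a)) * indicator {0..1} s
      + ennreal (K * s powr (- a / 2 - 1)) * indicator {1..} s \<partial>lborel)"
    unfolding wt_ln_def
  proof (intro nn_integral_mono)
    fix s :: real
    consider "s \<le> 0" | "0 < s" "s \<le> 1" | "1 < s" by linarith
    then show "ennreal (wt a s * ln (1 + s)) \<le> ennreal (s powr (- a)) * indicator {0..1} s
      + ennreal (K * s powr (- a / 2 - 1)) * indicator {1..} s"
    proof cases
      case 2
      have "wt a s * ln (1 + s) \<le> s powr (- a - 1) * s"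
        using 2 ln_add_one_self_le_self[of s] by (simp add: wt_def mult_left_mono)
      also have "\<dots> = s powr (- a)" using 2 by (simp add: powr_diff)
      finally show ?thesis using 2 by (intro add_increasing2) (auto intro: ennreal_leI)
    next
      case 3
      have "ln (1 + s) = 2 / a * ln ((1 + s) powr (a / 2))"
        using 3 assms by (simp add: ln_powr)
      also have "\<dots> \<le> 2 / a * (1 + s) powr (a / 2)"
        using 3 assms by (intro mult_left_mono order_trans[OF ln_le_minus_one]) auto
      also have "\<dots> \<le> 2 / a * (2 * s) powr (a / 2)"
        using 3 assms by (intro mult_left_mono powr_mono2) auto
      also have "\<dots> = K * s powr (a / 2)" using 3 by (simp add: K_def powr_mult)
      finally have "wt a s * ln (1 + s) \<le> s powr (- a - 1) * (K * s powr (a / 2))"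
        using 3 by (simp add: wt_def mult_left_mono)
      also have "\<dots> = K * (s powr (- a - 1) * s powr (a / 2))" by (simp only: mult_ac)
      also have "s powr (- a - 1) * s powr (a / 2) = s powr (- a / 2 - 1)"
        by (simp add: powr_add[symmetric])
      finally show ?thesis using 3 by (intro add_increasing) (auto intro: ennreal_leI)
    qed (simp add: wt_def)
  qed
  also have "\<dots> = (\<integral>\<^sup>+s. ennreal (s powr (- a)) * indicator {0..1} s \<partial>lborel)
      + (\<integral>\<^sup>+s. ennreal (K * s powr (- a / 2 - 1)) * indicator {1..} s \<partial>lborel)"
    by (intro nn_integral_add) measurable
  also have "\<dots> < \<infinity>" using I1 I2 by simp
  finally show ?thesis .
qed

text \<open>The window from 1/2 to 1 is an arbitrary one, bounded away from 0, on which the lower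
  bounds are uniform. Its length is the factor 1/2.\<close>

lemma nn_integral_ge_on_interval:
  fixes f :: "real \<Rightarrow> real"
  assumes "\<And>s. 1 / 2 \<le> s \<Longrightarrow> s \<le> 1 \<Longrightarrow> r \<le> f s"
  shows "ennreal (r / 2) \<le> (\<integral>\<^sup>+s. ennreal (f s) \<partial>lborel)"
proof -
  have "ennreal (r / 2) = ennreal r * ennreal (1 / 2)" 
    using ennreal_mult''[of "1 / 2" r] by (simp only: times_divide_eq_right mult_1_right)
  also have "\<dots> = (\<integral>\<^sup>+s. ennreal r * indicator {1/2..1::real} s \<partial>lborel)"
    by (simp add: nn_integral_cmult)
  also have "\<dots> \<le> (\<integral>\<^sup>+s. ennreal (f s) \<partial>lborel)"
    using assms by (intro nn_integral_mono) (auto simp: indicator_def intro: ennreal_leI)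
  finally show ?thesis .
qed

lemma wt_ge_1: "1 / 2 \<le> s \<Longrightarrow> s \<le> 1 \<Longrightarrow> 0 < a \<Longrightarrow> 1 \<le> wt a s"
  using powr_mono2'[of "- a - 1" s 1] by (simp add: wt_def)

lemma wt_ln_pos: "0 < a \<Longrightarrow> 0 < wt_ln a"
proof -
  assume "0 < a"
  have "ln (3 / 2) \<le> wt a s * ln (1 + s)" if "1 / 2 \<le> s" "s \<le> 1" for s
  proof -
    have "1 * ln (3 / 2) \<le> wt a s * ln (1 + s)"
      using that wt_ge_1[OF that \<open>0 < a\<close>] by (intro mult_mono) auto
    then show ?thesis by simp
  qed
  then have "ennreal (ln (3 / 2) / 2) \<le> wt_ln a"
    unfolding wt_ln_def by (rule nn_integral_ge_on_interval)
  moreover have "0 < ln (3 / 2 :: real)" by simp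
  ultimately show ?thesis by (metis ennreal_less_zero_iff half_gt_zero less_le_trans)
qed

lemma wt_ln_scale:
  assumes "0 \<le> x" "0 < a"
  shows "(\<integral>\<^sup>+s. ennreal (wt a s * ln (1 + s * x)) \<partial>lborel) = wt_ln a * ennreal (x powr a)"
proof (cases "x = 0")
  case False
  then have "0 < x" using assms by simp
  have "wt_ln a = ennreal x * (\<integral>\<^sup>+s. ennreal (wt a (0 + x * s) * ln (1 + (0 + x * s))) \<partial>lborel)"
    unfolding wt_ln_def using \<open>0 < x\<close> by (subst nn_integral_real_affine[of _ x 0]) auto
  also have "(\<integral>\<^sup>+s. ennreal (wt a (0 + x * s) * ln (1 + (0 + x * s))) \<partial>lborel)
      = (\<integral>\<^sup>+s. ennreal (x powr (- a - 1)) * ennreal (wt a s * ln (1 + s * x)) \<partial>lborel)"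
  proof (intro nn_integral_cong)
    fix s :: real
    show "ennreal (wt a (0 + x * s) * ln (1 + (0 + x * s)))
        = ennreal (x powr (- a - 1)) * ennreal (wt a s * ln (1 + s * x))"
      using \<open>0 < x\<close> by (auto simp: wt_def powr_mult ennreal_mult'[symmetric] zero_less_mult_iff mult_ac)
  qed
  also have "\<dots> = ennreal (x powr (- a - 1)) * (\<integral>\<^sup>+s. ennreal (wt a s * ln (1 + s * x)) \<partial>lborel)"
    by (intro nn_integral_cmult) measurable
  finally have "wt_ln a * ennreal (x powr a) = ennreal (x * x powr (- a - 1) * x powr a)
      * (\<integral>\<^sup>+s. ennreal (wt a s * ln (1 + s * x)) \<partial>lborel)"
    using \<open>0 < x\<close> by (simp add: ennreal_mult mult_ac)
  also have "x * x powr (- a - 1) * x powr a = 1"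
    using \<open>0 < x\<close> by (simp add: powr_diff powr_minus field_simps)
  finally show ?thesis by simp
qed simp

text \<open>Tonelli's theorem exchanges the integrals over \<open>s\<close> and \<theta>, so a bound
  of the weighted integral that is uniform in \<theta> passes to the circle mean. Values in
  \<open>ennreal\<close> keep questions of integrability over \<open>s\<close> out of the
  argument.\<close>

lemma nn_integral_wt_circle_mean_le:
  fixes L :: "real \<Rightarrow> real \<Rightarrow> real"
  assumes meas: "(\<lambda>(s, \<theta>). L s \<theta>) \<in> borel_measurable (borel \<Otimes>\<^sub>M borel)"
    and cont: "\<And>s. 0 < s \<Longrightarrow> continuous_on {0..1} (L s)"
    and nonneg: "\<And>s \<theta>. 0 < s \<Longrightarrow> 0 \<le> L s \<theta>"
    and G: "\<And>s. 0 < s \<Longrightarrow> G s \<le> integral {0..1} (L s)"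
    and K: "\<And>\<theta>. (\<integral>\<^sup>+s. ennreal (wt a s * L s \<theta>) \<partial>lborel) \<le> K"
  shows "(\<integral>\<^sup>+s. ennreal (wt a s * G s) \<partial>lborel) \<le> K"
proof -
  have [measurable]: "(\<lambda>(s, \<theta>). L s \<theta>) \<in> borel_measurable (lborel \<Otimes>\<^sub>M lborel)"
    using meas by (simp cong: measurable_cong_sets sets_pair_measure_cong)
  have "(\<integral>\<^sup>+s. ennreal (wt a s * G s) \<partial>lborel)
      \<le> (\<integral>\<^sup>+s. (\<integral>\<^sup>+\<theta>. ennreal (wt a s * L s \<theta>) * indicator {0..1} \<theta> \<partial>lborel) \<partial>lborel)"
  proof (intro nn_integral_mono)
    fix s :: real
    show "ennreal (wt a s * G s) \<le> (\<integral>\<^sup>+\<theta>. ennreal (wt a s * L s \<theta>) * indicator {0..1} \<theta> \<partial>lborel)"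
    proof (cases "0 < s")
      case True
      have "((\<lambda>\<theta>. wt a s * L s \<theta>) has_integral wt a s * integral {0..1} (L s)) {0..1}"
        by (intro has_integral_mult_right integrable_integral integrable_continuous_interval cont True)
      from nn_integral_has_integral_lebesgue'[OF _ this] nonneg[OF True]
      have "(\<integral>\<^sup>+\<theta>. ennreal (wt a s * L s \<theta>) * indicator {0..1} \<theta> \<partial>lborel)
          = ennreal (wt a s * integral {0..1} (L s))" by simp
      then show ?thesis using G[OF True] by (simp add: ennreal_leI mult_left_mono)
    qed (simp add: wt_def)
  qed
  also have "\<dots> = (\<integral>\<^sup>+\<theta>. (\<integral>\<^sup>+s. ennreal (wt a s * L s \<theta>) * indicator {0..1} \<theta> \<partial>lborel) \<partial>lborel)"
    by (rule lborel_pair.Fubini'[symmetric]) measurable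
  also have "\<dots> = (\<integral>\<^sup>+\<theta>. (\<integral>\<^sup>+s. ennreal (wt a s * L s \<theta>) \<partial>lborel) * indicator {0..1} \<theta> \<partial>lborel)"
    by (intro nn_integral_cong nn_integral_multc) measurable
  also have "\<dots> \<le> (\<integral>\<^sup>+\<theta>. K * indicator {0..1::real} \<theta> \<partial>lborel)"
    by (intro nn_integral_mono mult_right_mono K) simp
  also have "\<dots> = K" by (simp add: nn_integral_cmult)
  finally show ?thesis .
qed

text \<open>The comparison is with s = 0, where the determinant is 1. The logarithm is thus
  nonnegative, as Tonelli's theorem requires.\<close>

lemma fdet_gram_ge_1:
  assumes "0 < s"
  shows "1 \<le> Re (fdet n (gram n s X))"
proof -
  have id: "fdet n (gram n 0 X) = 1"
    using fdet_diagonal[of n "\<lambda>_. 1"] by (simp add: gram_def[abs_def])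
  have "Im (qform n (gram n s X) x) = 0 \<and> Re (qform n (gram n 0 X) x) \<le> Re (qform n (gram n s X) x)" for x
    unfolding qform_gram using assms by (simp add: sum_nonneg)
  then obtain r where "fdet n (gram n s X) = complex_of_real r * fdet n (gram n 0 X)" "1 \<le> r"
    using fdet_mono[OF pos_def_gram[of 0 n X], of "gram n s X"] by blast
  then show ?thesis by (simp add: id)
qed

lemma ln_ge_fraction: "0 \<le> (y::real) \<Longrightarrow> y / (1 + y) \<le> ln (1 + y)"
  using ln_le_minus_one[of "1 / (1 + y)"] by (simp add: ln_div field_simps)

lemma tendsto_ln_fraction_at_right:
  "0 < r \<Longrightarrow> 0 < m \<Longrightarrow> ((\<lambda>s::real. ln (1 + r * s / (1 + s * m)\<^sup>2) / s) \<longlongrightarrow> r) (at_right 0)"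
  by real_asymp

section \<open>Growth of Schatten sums on circles\<close>

locale circle_pencil =
  fixes A B :: "'a::chilbert_space \<Rightarrow> 'a" and p :: real and x :: 'a
  assumes A: "bounded_clinear A" and B: "bounded_clinear B" and Bx: "B x \<noteq> 0"
    and compact: "\<And>z. compact_operator (\<lambda>y. A y + z *\<^sub>C B y)"
    and p: "0 < p"
begin

definition \<beta> :: real where "\<beta> = (norm (B x) / norm x)\<^sup>2"

lemma beta_pos: "0 < \<beta>"
  using Bx bounded_clinearD(4)[OF B] by (auto simp: \<beta>_def)

text \<open>The logarithm contributed by the rank-one term, with the diagonal entries of A replaced
  by their bound \<open>onorm A\<close>.\<close>

definition gain :: "real \<Rightarrow> real \<Rightarrow> real" where
  "gain t s = ln (1 + t\<^sup>2 * s * \<beta> / (1 + s * (onorm A)\<^sup>2)\<^sup>2)"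

definition eigensystem :: "'a set \<Rightarrow> bool" where
  "eigensystem E \<longleftrightarrow> orthonormal E \<and> finite E
    \<and> (\<forall>e\<in>E. cadjoint A (A e) = of_real ((norm (A e))\<^sup>2) *\<^sub>C e \<and> A e \<noteq> 0)"

definition below :: "real \<Rightarrow> real \<Rightarrow> bool" where
  "below t U \<longleftrightarrow> (\<forall>z. cmod z = t \<longrightarrow> schatten_sum p (\<lambda>y. A y + z *\<^sub>C B y) \<le> ennreal U)"

text \<open>L s \<theta> is the log-determinant of the compressed operator at the point t
  \<open>circ \<theta>\<close>. In the last conclusion \<open>m\<close> and \<sigma> may depend on
  \<theta> and \<tau> but not on \<open>s\<close>, and \<open>n\<close> depends on none of
  these.\<close>

lemma circle_mean_bounds:
  assumes E: "eigensystem E" and t: "0 < t" and U: "0 \<le> U" "below t U"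
  obtains n :: nat and L :: "real \<Rightarrow> real \<Rightarrow> real" where
    "(\<lambda>(s, \<theta>). L s \<theta>) \<in> borel_measurable (borel \<Otimes>\<^sub>M borel)"
    "\<forall>s>0. continuous_on {0..1} (L s)"
    "\<forall>s>0. \<forall>\<theta>. 0 \<le> L s \<theta>"
    "\<forall>s>0. (\<Sum>e\<in>E. ln (1 + s * (norm (A e))\<^sup>2)) + gain t s \<le> integral {0..1} (L s)"
    "\<forall>\<theta>. \<forall>\<tau>>0. \<exists>(m::nat) \<sigma>. (\<forall>k<m. 0 < \<sigma> k) \<and> (\<Sum>k<m. \<sigma> k powr p) \<le> U
      \<and> (\<forall>s>0. L s \<theta> \<le> n * ln (1 + s * \<tau>\<^sup>2) + (\<Sum>k<m. ln (1 + s * (\<sigma> k)\<^sup>2)))"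
proof -
  obtain n v u where v: "suborthonormal n v" and u: "suborthonormal n u"
    and mean: "\<forall>s>0. \<forall>t>0. (\<Sum>e\<in>E. ln (1 + s * (norm (A e))\<^sup>2))
        + ln (1 + t\<^sup>2 * s * (norm (B x) / norm x)\<^sup>2 / (1 + s * (onorm A)\<^sup>2)\<^sup>2)
      \<le> integral {0..1} (\<lambda>\<theta>. ln (Re (fdet n (gram n s
          (\<lambda>i j. cinner (A (v j) + (of_real t * circ \<theta>) *\<^sub>C B (v j)) (u i))))))"
    using E[unfolded eigensystem_def] by (elim conjE) (rule compression_circle_mean[OF A B Bx])
  define M where "M \<theta> i j = cinner (A (v j) + (of_real t * circ \<theta>) *\<^sub>C B (v j)) (u i)" for \<theta> i j
  define D where "D s \<theta> = Re (fdet n (gram n s (M \<theta>)))" for s \<theta>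
  define L where "L s \<theta> = ln (D s \<theta>)" for s \<theta>
  have D1: "1 \<le> D s \<theta>" if "0 < s" for s \<theta> unfolding D_def by (rule fdet_gram_ge_1[OF that])
  \<comment> \<open>Continuity in both variables together gives measurability on the plane, and with
    \<open>s\<close> fixed it gives the circle integral.\<close>
  have contD: "continuous_on T (\<lambda>q. D (f q) (g q))"
    if "continuous_on T f" "continuous_on T g" for T :: "'b::topological_space set" and f g
    unfolding D_def gram_def M_def cinner_add_left cinner_scaleC_left
    by (intro continuous_intros that)
  show thesis
  proof (rule that)
    have "(\<lambda>q. D (fst q) (snd q)) \<in> borel_measurable borel"
      by (intro borel_measurable_continuous_onI contD continuous_intros)
    then have "(\<lambda>q. L (fst q) (snd q)) \<in> borel_measurable borel" unfolding L_def by measurable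
    then show "(\<lambda>(s, \<theta>). L s \<theta>) \<in> borel_measurable (borel \<Otimes>\<^sub>M borel)"
      unfolding borel_prod by (simp add: case_prod_beta')
    show "\<forall>s>0. continuous_on {0..1} (L s)"
    proof (intro allI impI)
      fix s :: real assume "0 < s"
      then have "D s \<theta> \<noteq> 0" for \<theta> using D1[of s \<theta>] by linarith
      then show "continuous_on {0..1} (L s)"
        unfolding L_def by (intro continuous_on_ln contD continuous_intros) auto
    qed
    show "\<forall>s>0. \<forall>\<theta>. 0 \<le> L s \<theta>" unfolding L_def using D1 by simp
    show "\<forall>s>0. (\<Sum>e\<in>E. ln (1 + s * (norm (A e))\<^sup>2)) + gain t s \<le> integral {0..1} (L s)"
      using mean t unfolding L_def D_def M_def gain_def \<beta>_def by blast
    show "\<forall>\<theta>. \<forall>\<tau>>0. \<exists>(m::nat) \<sigma>. (\<forall>k<m. 0 < \<sigma> k) \<and> (\<Sum>k<m. \<sigma> k powr p) \<le> U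
      \<and> (\<forall>s>0. L s \<theta> \<le> n * ln (1 + s * \<tau>\<^sup>2) + (\<Sum>k<m. ln (1 + s * (\<sigma> k)\<^sup>2)))"
    proof (intro allI impI)
      fix \<theta> \<tau> :: real assume "0 < \<tau>"
      define X where "X y = A y + (of_real t * circ \<theta>) *\<^sub>C B y" for y
      have X: "compact_operator X" unfolding X_def by (rule compact)
      have le: "schatten_sum p X \<le> ennreal U"
        using U(2) t unfolding below_def X_def by (simp add: norm_mult)
      then have fin: "schatten_sum p X < \<infinity>" by (simp add: le_less_trans)
      obtain m :: nat and \<sigma> where \<sigma>: "\<forall>k<m. 0 < \<sigma> k" "ennreal (\<Sum>k<m. \<sigma> k powr p) \<le> schatten_sum p X"
        "\<forall>s>0. Re (fdet n (gram n s (\<lambda>i j. cinner (X (v j)) (u i))))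
          \<le> (1 + s * \<tau>\<^sup>2) ^ n * (\<Prod>k<m. 1 + s * (\<sigma> k)\<^sup>2)"
        by (rule fdet_gram_compression_le[OF X fin p \<open>0 < \<tau>\<close> v u])
      have "ennreal (\<Sum>k<m. \<sigma> k powr p) \<le> ennreal U" using \<sigma>(2) le by (rule order_trans)
      then have "(\<Sum>k<m. \<sigma> k powr p) \<le> U" using U(1) by (simp add: ennreal_le_iff)
      moreover have "L s \<theta> \<le> n * ln (1 + s * \<tau>\<^sup>2) + (\<Sum>k<m. ln (1 + s * (\<sigma> k)\<^sup>2))" if s: "0 < s" for s
      proof -
        have D: "D s \<theta> \<le> (1 + s * \<tau>\<^sup>2) ^ n * (\<Prod>k<m. 1 + s * (\<sigma> k)\<^sup>2)"
          using \<sigma>(3) s unfolding D_def M_def X_def by blast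
        have pos1: "0 < 1 + s * r\<^sup>2" for r using s by (simp add: add_pos_nonneg)
        have "L s \<theta> \<le> ln ((1 + s * \<tau>\<^sup>2) ^ n * (\<Prod>k<m. 1 + s * (\<sigma> k)\<^sup>2))"
          unfolding L_def using D D1[OF s, of \<theta>] by (intro ln_mono) auto
        also have "\<dots> = ln ((1 + s * \<tau>\<^sup>2) ^ n) + ln (\<Prod>k<m. 1 + s * (\<sigma> k)\<^sup>2)"
          by (intro ln_mult_pos prod_pos zero_less_power pos1)
        also have "ln ((1 + s * \<tau>\<^sup>2) ^ n) = n * ln (1 + s * \<tau>\<^sup>2)"
          by (rule ln_realpow)
        also have "ln (\<Prod>k<m. 1 + s * (\<sigma> k)\<^sup>2) = (\<Sum>k<m. ln (1 + s * (\<sigma> k)\<^sup>2))"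
          by (intro ln_prod) (simp_all add: less_imp_neq[OF pos1, symmetric])
        finally show ?thesis .
      qed
      ultimately show "\<exists>(m::nat) \<sigma>. (\<forall>k<m. 0 < \<sigma> k) \<and> (\<Sum>k<m. \<sigma> k powr p) \<le> U
          \<and> (\<forall>s>0. L s \<theta> \<le> n * ln (1 + s * \<tau>\<^sup>2) + (\<Sum>k<m. ln (1 + s * (\<sigma> k)\<^sup>2)))"
        using \<sigma>(1) by blast
    qed
  qed
qed

text \<open>With y the fraction inside the logarithm, ln (1 + y) is at least y / (1 + y). The
  constant arises from y \<le> \<beta> in the denominator and from s \<ge> 1/2 and s \<le> 1 in the
  lower bound of y.\<close>

lemma gain_lower:
  assumes "0 < t" "t \<le> 1" "1 / 2 \<le> s" "s \<le> 1"
  shows "t\<^sup>2 * (\<beta> / (2 * (1 + (onorm A)\<^sup>2)\<^sup>2 * (1 + \<beta>))) \<le> gain t s"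
proof -
  define m where "m = (onorm A)\<^sup>2"
  have m: "0 \<le> m" by (simp add: m_def)
  define y where "y = t\<^sup>2 * s * \<beta> / (1 + s * m)\<^sup>2"
  have y0: "0 \<le> y" using assms beta_pos by (simp add: y_def)
  have "1 \<le> (1 + s * m)\<^sup>2" using m assms by simp
  then have "y \<le> t\<^sup>2 * s * \<beta> / 1"
    unfolding y_def using assms beta_pos by (intro divide_left_mono) auto
  also have "\<dots> \<le> 1 * 1 * \<beta>"
    using assms beta_pos by (simp add: mult_le_one power_le_one)
  finally have y\<beta>: "y \<le> \<beta>" by simp
  have "s * m \<le> 1 * m" using m assms by (intro mult_right_mono) auto
  then have m1: "(1 + s * m)\<^sup>2 \<le> (1 + m)\<^sup>2" using m assms by (intro power_mono) auto
  have sm: "0 < 1 + s * m" using m assms by (intro add_pos_nonneg) auto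
  have "t\<^sup>2 * (1 / 2) * \<beta> / (1 + m)\<^sup>2 \<le> y"
    unfolding y_def using assms beta_pos m1 zero_less_power[OF sm, of 2]
    by (intro frac_le mult_right_mono mult_left_mono) auto
  then have "t\<^sup>2 * (1 / 2) * \<beta> / (1 + m)\<^sup>2 / (1 + \<beta>) \<le> y / (1 + y)"
    using y0 y\<beta> beta_pos by (intro frac_le) auto
  also have "\<dots> \<le> ln (1 + y)" using y0 by (rule ln_ge_fraction)
  finally show ?thesis unfolding gain_def y_def m_def by (simp add: mult_ac)
qed

text \<open>The inequality for the circle means is integrated against the weight. Sums of logarithms
  become C times sums of p-th powers, and the integral of the gain is at least a multiple of
  t^2.\<close>

lemma growth_aux_less_2:
  assumes "p < 2"
  obtains C c where "0 < C" "0 < c"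
    "\<forall>E t U. eigensystem E \<longrightarrow> 0 < t \<longrightarrow> t \<le> 1 \<longrightarrow> 0 \<le> U \<longrightarrow> below t U \<longrightarrow>
      C * (\<Sum>e\<in>E. norm (A e) powr p) + c * t\<^sup>2 \<le> C * U"
proof -
  \<comment> \<open>The determinants contain squares of singular values, so p-th powers arise for a
    = p/2, and p < 2 is the condition a < 1.\<close>
  define a where "a = p / 2"
  have a: "0 < a" "a < 1" using p assms by (auto simp: a_def)
  obtain C where C: "wt_ln a = ennreal C" "0 < C"
    using wt_ln_finite[OF a] wt_ln_pos[OF a(1)] by (cases "wt_ln a") (auto simp: ennreal_less_zero_iff)
  have scale: "(\<integral>\<^sup>+s. ennreal (wt a s * ln (1 + s * r\<^sup>2)) \<partial>lborel) = ennreal (C * r powr p)"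
    if "0 \<le> r" for r
  proof -
    have "(r\<^sup>2) powr a = r powr p"
    proof (cases "r = 0")
      case False
      then have "r\<^sup>2 = r powr 2" using that by simp
      then show ?thesis by (simp only: powr_powr) (simp add: a_def)
    qed simp
    then show ?thesis using wt_ln_scale[of "r\<^sup>2" a] a C by (simp add: ennreal_mult)
  qed
  define \<gamma> where "\<gamma> = \<beta> / (2 * (1 + (onorm A)\<^sup>2)\<^sup>2 * (1 + \<beta>))"
  have \<gamma>: "0 < \<gamma>" unfolding \<gamma>_def using beta_pos by (intro divide_pos_pos mult_pos_pos zero_less_power) (auto simp: add_pos_nonneg)
  \<comment> \<open>The half in \<gamma> / 2 is the length of the window on which the gain is
    bounded below.\<close>
  have main: "C * (\<Sum>e\<in>E. norm (A e) powr p) + \<gamma> / 2 * t\<^sup>2 \<le> C * U"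
    if E: "eigensystem E" and t: "0 < t" "t \<le> 1" and U: "0 \<le> U" "below t U" for E t U
  proof -
    obtain n :: nat and L :: "real \<Rightarrow> real \<Rightarrow> real" where L: "(\<lambda>(s, \<theta>). L s \<theta>) \<in> borel_measurable (borel \<Otimes>\<^sub>M borel)"
      "\<forall>s>0. continuous_on {0..1} (L s)" "\<forall>s>0. \<forall>\<theta>. 0 \<le> L s \<theta>"
      "\<forall>s>0. (\<Sum>e\<in>E. ln (1 + s * (norm (A e))\<^sup>2)) + gain t s \<le> integral {0..1} (L s)"
      "\<forall>\<theta>. \<forall>\<tau>>0. \<exists>(m::nat) \<sigma>. (\<forall>k<m. 0 < \<sigma> k) \<and> (\<Sum>k<m. \<sigma> k powr p) \<le> U
        \<and> (\<forall>s>0. L s \<theta> \<le> n * ln (1 + s * \<tau>\<^sup>2) + (\<Sum>k<m. ln (1 + s * (\<sigma> k)\<^sup>2)))"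
      by (rule circle_mean_bounds[OF E t(1) U])
    have upper: "(\<integral>\<^sup>+s. ennreal (wt a s * L s \<theta>) \<partial>lborel) \<le> ennreal (C * U)" for \<theta>
    proof -
      define I where "I = (\<integral>\<^sup>+s. ennreal (wt a s * L s \<theta>) \<partial>lborel)"
      have "I \<le> ennreal (C * (n * \<tau> powr p + U))" if \<tau>: "0 < \<tau>" for \<tau>
      proof -
        obtain m :: nat and \<sigma> where \<sigma>: "\<forall>k<m. 0 < \<sigma> k" "(\<Sum>k<m. \<sigma> k powr p) \<le> U"
          "\<forall>s>0. L s \<theta> \<le> n * ln (1 + s * \<tau>\<^sup>2) + (\<Sum>k<m. ln (1 + s * (\<sigma> k)\<^sup>2))"
          using L(5)[rule_format, OF \<tau>, of \<theta>] by (elim exE conjE) (rule that)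
        have "I \<le> (\<integral>\<^sup>+s. of_nat n * ennreal (wt a s * ln (1 + s * \<tau>\<^sup>2))
            + (\<Sum>k<m. ennreal (wt a s * ln (1 + s * (\<sigma> k)\<^sup>2))) \<partial>lborel)"
          unfolding I_def
        proof (intro nn_integral_mono)
          fix s :: real
          show "ennreal (wt a s * L s \<theta>) \<le> of_nat n * ennreal (wt a s * ln (1 + s * \<tau>\<^sup>2))
            + (\<Sum>k<m. ennreal (wt a s * ln (1 + s * (\<sigma> k)\<^sup>2)))"
          proof (cases "0 < s")
            case True
            then have "wt a s * L s \<theta> \<le> wt a s * (n * ln (1 + s * \<tau>\<^sup>2) + (\<Sum>k<m. ln (1 + s * (\<sigma> k)\<^sup>2)))"
              using \<sigma>(3) by (intro mult_left_mono) auto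
            also have "\<dots> = n * (wt a s * ln (1 + s * \<tau>\<^sup>2)) + (\<Sum>k<m. wt a s * ln (1 + s * (\<sigma> k)\<^sup>2))"
              by (simp add: distrib_left sum_distrib_left)
            finally have "ennreal (wt a s * L s \<theta>) \<le> ennreal \<dots>" by (rule ennreal_leI)
            also have "\<dots> = of_nat n * ennreal (wt a s * ln (1 + s * \<tau>\<^sup>2))
                + (\<Sum>k<m. ennreal (wt a s * ln (1 + s * (\<sigma> k)\<^sup>2)))"
            proof -
              have nn: "0 \<le> wt a s * ln (1 + s * r\<^sup>2)" for r using True by simp
              have "ennreal (n * (wt a s * ln (1 + s * \<tau>\<^sup>2)) + (\<Sum>k<m. wt a s * ln (1 + s * (\<sigma> k)\<^sup>2)))
                  = ennreal (n * (wt a s * ln (1 + s * \<tau>\<^sup>2))) + ennreal (\<Sum>k<m. wt a s * ln (1 + s * (\<sigma> k)\<^sup>2))"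
                by (intro ennreal_plus mult_nonneg_nonneg[OF of_nat_0_le_iff nn] sum_nonneg nn)
              also have "ennreal (n * (wt a s * ln (1 + s * \<tau>\<^sup>2))) = of_nat n * ennreal (wt a s * ln (1 + s * \<tau>\<^sup>2))"
                unfolding ennreal_mult[OF of_nat_0_le_iff nn] ennreal_of_nat_eq_real_of_nat ..
              also have "ennreal (\<Sum>k<m. wt a s * ln (1 + s * (\<sigma> k)\<^sup>2)) = (\<Sum>k<m. ennreal (wt a s * ln (1 + s * (\<sigma> k)\<^sup>2)))"
                by (rule sum_ennreal[symmetric]) (rule nn)
              finally show ?thesis .
            qed
            finally show ?thesis .
          qed (simp add: wt_def)
        qed
        also have "\<dots> = of_nat n * ennreal (C * \<tau> powr p) + (\<Sum>k<m. ennreal (C * \<sigma> k powr p))"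
        proof -
          have [measurable]: "(\<lambda>s. ennreal (wt a s * ln (1 + s * r\<^sup>2))) \<in> borel_measurable lborel" for r
            by measurable
          have "(\<integral>\<^sup>+s. of_nat n * ennreal (wt a s * ln (1 + s * \<tau>\<^sup>2))
              + (\<Sum>k<m. ennreal (wt a s * ln (1 + s * (\<sigma> k)\<^sup>2))) \<partial>lborel)
            = (\<integral>\<^sup>+s. of_nat n * ennreal (wt a s * ln (1 + s * \<tau>\<^sup>2)) \<partial>lborel)
              + (\<integral>\<^sup>+s. (\<Sum>k<m. ennreal (wt a s * ln (1 + s * (\<sigma> k)\<^sup>2))) \<partial>lborel)"
            by (rule nn_integral_add) measurable
          also have "(\<integral>\<^sup>+s. of_nat n * ennreal (wt a s * ln (1 + s * \<tau>\<^sup>2)) \<partial>lborel)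
              = of_nat n * (\<integral>\<^sup>+s. ennreal (wt a s * ln (1 + s * \<tau>\<^sup>2)) \<partial>lborel)"
            by (rule nn_integral_cmult) measurable
          also have "(\<integral>\<^sup>+s. ennreal (wt a s * ln (1 + s * \<tau>\<^sup>2)) \<partial>lborel) = ennreal (C * \<tau> powr p)"
            using \<tau> by (intro scale less_imp_le)
          also have "(\<integral>\<^sup>+s. (\<Sum>k<m. ennreal (wt a s * ln (1 + s * (\<sigma> k)\<^sup>2))) \<partial>lborel)
              = (\<Sum>k<m. \<integral>\<^sup>+s. ennreal (wt a s * ln (1 + s * (\<sigma> k)\<^sup>2)) \<partial>lborel)"
            by (rule nn_integral_sum) measurable
          also have "\<dots> = (\<Sum>k<m. ennreal (C * \<sigma> k powr p))"
            using \<sigma>(1) by (intro sum.cong refl scale less_imp_le) simp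
          finally show ?thesis .
        qed
        also have "\<dots> = ennreal (C * (n * \<tau> powr p + (\<Sum>k<m. \<sigma> k powr p)))"
        proof -
          have nn: "0 \<le> C * r powr p" for r using C(2) by simp
          have "of_nat n * ennreal (C * \<tau> powr p) + (\<Sum>k<m. ennreal (C * \<sigma> k powr p))
              = ennreal (n * (C * \<tau> powr p)) + ennreal (\<Sum>k<m. C * \<sigma> k powr p)"
            unfolding ennreal_mult[OF of_nat_0_le_iff nn] ennreal_of_nat_eq_real_of_nat
            by (simp only: sum_ennreal nn)
          also have "\<dots> = ennreal (n * (C * \<tau> powr p) + (\<Sum>k<m. C * \<sigma> k powr p))"
            by (intro ennreal_plus[symmetric] mult_nonneg_nonneg[OF of_nat_0_le_iff nn] sum_nonneg nn)
          also have "n * (C * \<tau> powr p) + (\<Sum>k<m. C * \<sigma> k powr p) = C * (n * \<tau> powr p + (\<Sum>k<m. \<sigma> k powr p))"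
            unfolding distrib_left sum_distrib_left by (simp only: mult.left_commute)
          finally show ?thesis .
        qed
        also have "\<dots> \<le> ennreal (C * (n * \<tau> powr p + U))"
          using C(2) \<sigma>(2) by (intro ennreal_leI mult_left_mono) auto
        finally show ?thesis .
      qed
      \<comment> \<open>Letting \<tau> tend to 0 removes n \<tau>^p, because \<open>n\<close> does
        not depend on \<tau>.\<close>
      then have "\<forall>\<^sub>F \<tau> in at_right 0. I \<le> ennreal (C * (n * \<tau> powr p + U))"
        by (intro eventually_at_rightI[of 0 1]) auto
      moreover have lim: "((\<lambda>\<tau>::real. \<tau> powr p) \<longlongrightarrow> 0) (at_right 0)"
        using p by real_asymp
      have "((\<lambda>\<tau>. ennreal (C * (n * \<tau> powr p + U))) \<longlongrightarrow> ennreal (C * (real n * 0 + U))) (at_right 0)"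
        by (rule tendsto_ennrealI[OF tendsto_mult[OF tendsto_const
              tendsto_add[OF tendsto_mult[OF tendsto_const lim] tendsto_const]]])
      ultimately have "I \<le> ennreal (C * (real n * 0 + U))"
        by (intro tendsto_lowerbound[where F = "at_right (0::real)"]) auto
      then show ?thesis by (simp add: I_def)
    qed
    have le: "(\<integral>\<^sup>+s. ennreal (wt a s * ((\<Sum>e\<in>E. ln (1 + s * (norm (A e))\<^sup>2)) + gain t s)) \<partial>lborel) \<le> ennreal (C * U)"
      by (rule nn_integral_wt_circle_mean_le[OF L(1) L(2)[rule_format] L(3)[rule_format] L(4)[rule_format] upper])
    have gain0: "0 \<le> gain t s" if "0 < s" for s using beta_pos that by (simp add: gain_def)
    have eq1: "(\<integral>\<^sup>+s. ennreal (wt a s * ((\<Sum>e\<in>E. ln (1 + s * (norm (A e))\<^sup>2)) + gain t s)) \<partial>lborel)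
        = (\<integral>\<^sup>+s. (\<Sum>e\<in>E. ennreal (wt a s * ln (1 + s * (norm (A e))\<^sup>2))) + ennreal (wt a s * gain t s) \<partial>lborel)"
    proof (intro nn_integral_cong)
      fix s :: real
      show "ennreal (wt a s * ((\<Sum>e\<in>E. ln (1 + s * (norm (A e))\<^sup>2)) + gain t s))
        = (\<Sum>e\<in>E. ennreal (wt a s * ln (1 + s * (norm (A e))\<^sup>2))) + ennreal (wt a s * gain t s)"
      proof (cases "0 < s")
        case True
        have nn: "0 \<le> wt a s * ln (1 + s * r\<^sup>2)" for r using True by simp
        have "ennreal ((\<Sum>e\<in>E. wt a s * ln (1 + s * (norm (A e))\<^sup>2)) + wt a s * gain t s)
          = ennreal (\<Sum>e\<in>E. wt a s * ln (1 + s * (norm (A e))\<^sup>2)) + ennreal (wt a s * gain t s)"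
          using gain0[OF True] by (intro ennreal_plus sum_nonneg nn mult_nonneg_nonneg wt_nonneg)
        then show ?thesis
          unfolding distrib_left sum_distrib_left by (simp only: sum_ennreal nn)
      qed (simp add: wt_def)
    qed
    have [measurable]: "(\<lambda>s. ennreal (wt a s * gain t s)) \<in> borel_measurable lborel"
      unfolding gain_def by measurable
    have "(\<integral>\<^sup>+s. (\<Sum>e\<in>E. ennreal (wt a s * ln (1 + s * (norm (A e))\<^sup>2))) + ennreal (wt a s * gain t s) \<partial>lborel)
        = (\<integral>\<^sup>+s. (\<Sum>e\<in>E. ennreal (wt a s * ln (1 + s * (norm (A e))\<^sup>2))) \<partial>lborel)
          + (\<integral>\<^sup>+s. ennreal (wt a s * gain t s) \<partial>lborel)"
      by (rule nn_integral_add) measurable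
    also have "(\<integral>\<^sup>+s. (\<Sum>e\<in>E. ennreal (wt a s * ln (1 + s * (norm (A e))\<^sup>2))) \<partial>lborel)
        = (\<Sum>e\<in>E. \<integral>\<^sup>+s. ennreal (wt a s * ln (1 + s * (norm (A e))\<^sup>2)) \<partial>lborel)"
      by (rule nn_integral_sum) measurable
    also have "\<dots> = (\<Sum>e\<in>E. ennreal (C * norm (A e) powr p))"
      by (intro sum.cong refl scale norm_ge_zero)
    also have "\<dots> = ennreal (C * (\<Sum>e\<in>E. norm (A e) powr p))"
      unfolding sum_distrib_left using C(2) by (intro sum_ennreal) simp
    finally have "ennreal (C * (\<Sum>e\<in>E. norm (A e) powr p)) + (\<integral>\<^sup>+s. ennreal (wt a s * gain t s) \<partial>lborel)
        \<le> ennreal (C * U)"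
      using le unfolding eq1 by simp
    moreover have "ennreal (\<gamma> * t\<^sup>2 / 2) \<le> (\<integral>\<^sup>+s. ennreal (wt a s * gain t s) \<partial>lborel)"
    proof (rule nn_integral_ge_on_interval)
      fix s :: real assume s: "1 / 2 \<le> s" "s \<le> 1"
      have "\<gamma> * t\<^sup>2 \<le> gain t s" using gain_lower[OF t s] by (simp only: \<gamma>_def mult.commute)
      then have "1 * (\<gamma> * t\<^sup>2) \<le> wt a s * gain t s"
        using wt_ge_1[OF s a(1)] \<gamma> by (intro mult_mono) auto
      then show "\<gamma> * t\<^sup>2 \<le> wt a s * gain t s" by simp
    qed
    ultimately have "ennreal (C * (\<Sum>e\<in>E. norm (A e) powr p)) + ennreal (\<gamma> * t\<^sup>2 / 2) \<le> ennreal (C * U)"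
      by (rule order_trans[OF add_left_mono, rotated])
    moreover have "ennreal (C * (\<Sum>e\<in>E. norm (A e) powr p)) + ennreal (\<gamma> * t\<^sup>2 / 2)
        = ennreal (C * (\<Sum>e\<in>E. norm (A e) powr p) + \<gamma> * t\<^sup>2 / 2)"
      using C(2) \<gamma> by (intro ennreal_plus[symmetric]) (auto intro!: mult_nonneg_nonneg sum_nonneg)
    ultimately have "ennreal (C * (\<Sum>e\<in>E. norm (A e) powr p) + \<gamma> * t\<^sup>2 / 2) \<le> ennreal (C * U)"
      by simp
    then show ?thesis using C(2) U(1) by (simp add: ennreal_le_iff)
  qed
  show thesis by (rule that[OF C(2), of "\<gamma> / 2"]) (use \<gamma> main in auto)
qed

text \<open>For p = 2 the weight would be s^(-2), against which ln (1 + s) is not integrable at 0.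
  Dividing by s and passing to the limit instead turns each ln (1 + s r) / s into r and the gain
  into \<beta> t^2.\<close>

lemma growth_aux_2:
  assumes "p = 2"
  shows "\<forall>E t U. eigensystem E \<longrightarrow> 0 < t \<longrightarrow> t \<le> 1 \<longrightarrow> 0 \<le> U \<longrightarrow> below t U \<longrightarrow>
      (\<Sum>e\<in>E. norm (A e) powr p) + \<beta> * t\<^sup>2 \<le> U"
proof (intro allI impI)
  fix E t U assume E: "eigensystem E" and t: "0 < t" "t \<le> 1" and U: "0 \<le> U" "below t U"
  obtain n :: nat and L :: "real \<Rightarrow> real \<Rightarrow> real" where L: "(\<lambda>(s, \<theta>). L s \<theta>) \<in> borel_measurable (borel \<Otimes>\<^sub>M borel)"
    "\<forall>s>0. continuous_on {0..1} (L s)" "\<forall>s>0. \<forall>\<theta>. 0 \<le> L s \<theta>"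
    "\<forall>s>0. (\<Sum>e\<in>E. ln (1 + s * (norm (A e))\<^sup>2)) + gain t s \<le> integral {0..1} (L s)"
    "\<forall>\<theta>. \<forall>\<tau>>0. \<exists>(m::nat) \<sigma>. (\<forall>k<m. 0 < \<sigma> k) \<and> (\<Sum>k<m. \<sigma> k powr p) \<le> U
      \<and> (\<forall>s>0. L s \<theta> \<le> n * ln (1 + s * \<tau>\<^sup>2) + (\<Sum>k<m. ln (1 + s * (\<sigma> k)\<^sup>2)))"
    by (rule circle_mean_bounds[OF E t(1) U])
  have upper: "L s \<theta> \<le> s * U" if s: "0 < s" for s \<theta>
  proof -
    have "L s \<theta> \<le> n * (s * \<tau>\<^sup>2) + s * U" if \<tau>: "0 < \<tau>" for \<tau>
    proof -
      obtain m :: nat and \<sigma> where \<sigma>: "\<forall>k<m. 0 < \<sigma> k" "(\<Sum>k<m. \<sigma> k powr p) \<le> U"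
        "\<forall>s>0. L s \<theta> \<le> n * ln (1 + s * \<tau>\<^sup>2) + (\<Sum>k<m. ln (1 + s * (\<sigma> k)\<^sup>2))"
        using L(5)[rule_format, OF \<tau>, of \<theta>] by (elim exE conjE) (rule that)
      have "L s \<theta> \<le> n * ln (1 + s * \<tau>\<^sup>2) + (\<Sum>k<m. ln (1 + s * (\<sigma> k)\<^sup>2))" using \<sigma>(3) s by blast
      also have "\<dots> \<le> n * (s * \<tau>\<^sup>2) + (\<Sum>k<m. s * (\<sigma> k)\<^sup>2)"
        using s by (intro add_mono mult_left_mono sum_mono ln_add_one_self_le_self) auto
      also have "(\<Sum>k<m. s * (\<sigma> k)\<^sup>2) = s * (\<Sum>k<m. \<sigma> k powr p)"
        unfolding sum_distrib_left
      proof (intro sum.cong refl)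
        fix k assume "k \<in> {..<m}"
        then have "0 < \<sigma> k" using \<sigma>(1) by simp
        then show "s * (\<sigma> k)\<^sup>2 = s * \<sigma> k powr p" by (simp add: assms)
      qed
      also have "\<dots> \<le> s * U" using \<sigma>(2) s by (intro mult_left_mono) auto
      finally show ?thesis by simp
    qed
    then have "\<forall>\<^sub>F \<tau> in at_right 0. L s \<theta> \<le> n * (s * \<tau>\<^sup>2) + s * U"
      by (intro eventually_at_rightI[of 0 1]) auto
    moreover have "((\<lambda>\<tau>::real. n * (s * \<tau>\<^sup>2) + s * U) \<longlongrightarrow> n * (s * 0\<^sup>2) + s * U) (at_right 0)"
      by (intro tendsto_intros)
    ultimately have "L s \<theta> \<le> n * (s * 0\<^sup>2) + s * U"
      by (intro tendsto_lowerbound[where F = "at_right (0::real)"]) auto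
    then show ?thesis by simp
  qed
  have le: "(\<Sum>e\<in>E. ln (1 + s * (norm (A e))\<^sup>2) / s) + gain t s / s \<le> U" if s: "0 < s" for s
  proof -
    have "(\<Sum>e\<in>E. ln (1 + s * (norm (A e))\<^sup>2)) + gain t s \<le> integral {0..1} (L s)" using L(4) s by blast
    also have "\<dots> \<le> integral {0..1::real} (\<lambda>_. s * U)"
      using L(2) s upper by (intro integral_le integrable_continuous_interval) auto
    finally have "(\<Sum>e\<in>E. ln (1 + s * (norm (A e))\<^sup>2)) + gain t s \<le> s * U" by simp
    then show ?thesis using s by (simp add: sum_divide_distrib[symmetric] add_divide_distrib[symmetric] pos_divide_le_eq mult.commute)
  qed
  have lim: "((\<lambda>s. ln (1 + s * r) / s) \<longlongrightarrow> r) (at_right 0)" for r :: real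
    by real_asymp
  have limg: "((\<lambda>s. gain t s / s) \<longlongrightarrow> \<beta> * t\<^sup>2) (at_right 0)"
  proof -
    have "0 < t\<^sup>2 * \<beta>" using t beta_pos by simp
    have eq: "gain t s = ln (1 + t\<^sup>2 * \<beta> * s / (1 + s * (onorm A)\<^sup>2)\<^sup>2)" for s
      by (simp add: gain_def mult_ac)
    have "((\<lambda>s. gain t s / s) \<longlongrightarrow> t\<^sup>2 * \<beta>) (at_right 0)"
    \<comment> \<open>The limit formula is for a positive bound; when it is 0, the fraction in the
      gain is simply t^2 \<beta> s.\<close>
    proof (cases "onorm A = 0")
      case True
      then show ?thesis using lim[of "t\<^sup>2 * \<beta>"] by (simp add: eq mult.commute)
    next
      case False
      then have "0 < (onorm A)\<^sup>2" by simp
      with \<open>0 < t\<^sup>2 * \<beta>\<close> show ?thesis unfolding eq by (rule tendsto_ln_fraction_at_right)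
    qed
    then show ?thesis by (simp only: mult.commute)
  qed
  have "((\<lambda>s. (\<Sum>e\<in>E. ln (1 + s * (norm (A e))\<^sup>2) / s) + gain t s / s)
      \<longlongrightarrow> (\<Sum>e\<in>E. (norm (A e))\<^sup>2) + \<beta> * t\<^sup>2) (at_right 0)"
    by (intro tendsto_add tendsto_sum lim limg)
  moreover have "\<forall>\<^sub>F s in at_right 0. (\<Sum>e\<in>E. ln (1 + s * (norm (A e))\<^sup>2) / s) + gain t s / s \<le> U"
    using le by (intro eventually_at_rightI[of 0 1]) auto
  ultimately have "(\<Sum>e\<in>E. (norm (A e))\<^sup>2) + \<beta> * t\<^sup>2 \<le> U"
    by (intro tendsto_upperbound) auto
  moreover have "(\<Sum>e\<in>E. norm (A e) powr p) = (\<Sum>e\<in>E. (norm (A e))\<^sup>2)"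
    using E unfolding eigensystem_def by (intro sum.cong refl) (auto simp: assms)
  ultimately show "(\<Sum>e\<in>E. norm (A e) powr p) + \<beta> * t\<^sup>2 \<le> U" by simp
qed

text \<open>The Schatten sum of A is a supremum over finite sets of singular values, each realised
  by an eigensystem, and the constants C and c are common to all eigensystems.\<close>

theorem schatten_circle_growth:
  assumes "p \<le> 2" and fin: "schatten_sum p A < \<infinity>"
  obtains c where "0 < c" "\<forall>t U. 0 < t \<longrightarrow> t \<le> 1 \<longrightarrow> 0 \<le> U \<longrightarrow>
    (\<forall>z. cmod z = t \<longrightarrow> schatten_sum p (\<lambda>y. A y + z *\<^sub>C B y) \<le> ennreal U) \<longrightarrow>
    schatten_sum p A + ennreal (c * t\<^sup>2) \<le> ennreal U"
proof -
  obtain C c where C: "0 < C" "0 < c"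
    "\<forall>E t U. eigensystem E \<longrightarrow> 0 < t \<longrightarrow> t \<le> 1 \<longrightarrow> 0 \<le> U \<longrightarrow> below t U \<longrightarrow>
      C * (\<Sum>e\<in>E. norm (A e) powr p) + c * t\<^sup>2 \<le> C * U"
  proof (cases "p = 2")
    case True
    show thesis by (rule that[of 1 \<beta>]) (use growth_aux_2[OF True] beta_pos in auto)
  next
    case False
    then have "p < 2" using \<open>p \<le> 2\<close> by simp
    then show thesis by (rule growth_aux_less_2) (rule that)
  qed
  have "schatten_sum p A + ennreal (c / C * t\<^sup>2) \<le> ennreal U"
    if t: "0 < t" "t \<le> 1" and U: "0 \<le> U" and b: "below t U" for t U
  proof -
    have bound: "C * (\<Sum>e\<in>E. norm (A e) powr p) + c * t\<^sup>2 \<le> C * U" if "eigensystem E" for E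
      using C(3) that t U b by blast
    \<comment> \<open>The empty eigensystem shows that the difference is nonnegative, so that adding
      c / C t^2 back in \<open>ennreal\<close> returns U.\<close>
    have "0 \<le> U - c / C * t\<^sup>2"
      using bound[of "{}"] C(1) by (simp add: eigensystem_def orthonormal_def field_simps)
    have "schatten_sum p A \<le> ennreal (U - c / C * t\<^sup>2)"
      unfolding schatten_sum_def
    proof (subst nonneg_infsum_complete; (intro SUP_least)?)
      fix F assume "F \<in> {F. finite F \<and> F \<subseteq> singular_values A}"
      then have F: "finite F" "F \<subseteq> singular_values A" by auto
      obtain E where E: "orthonormal E" "finite E"
        "\<forall>e\<in>E. cadjoint A (A e) = of_real ((norm (A e))\<^sup>2) *\<^sub>C e \<and> A e \<noteq> 0"
        "ennreal (\<Sum>e\<in>E. norm (A e) powr p)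
          = (\<Sum>s\<in>F. ennreal_of_enat (cdim (singular_space A s)) * ennreal (s powr p))"
        by (rule singular_vectors_exist[OF A fin F])
      then have "C * (\<Sum>e\<in>E. norm (A e) powr p) + c * t\<^sup>2 \<le> C * U"
        by (intro bound) (simp add: eigensystem_def)
      then have "(\<Sum>e\<in>E. norm (A e) powr p) \<le> U - c / C * t\<^sup>2" using C(1) by (simp add: field_simps)
      then show "(\<Sum>s\<in>F. ennreal_of_enat (cdim (singular_space A s)) * ennreal (s powr p))
          \<le> ennreal (U - c / C * t\<^sup>2)"
        unfolding E(4)[symmetric] by (rule ennreal_leI)
    qed simp
    then have "schatten_sum p A + ennreal (c / C * t\<^sup>2)
        \<le> ennreal (U - c / C * t\<^sup>2) + ennreal (c / C * t\<^sup>2)"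
      by (rule add_right_mono)
    also have "\<dots> = ennreal U"
      using \<open>0 \<le> U - c / C * t\<^sup>2\<close> C by (subst ennreal_plus[symmetric]) auto
    finally show ?thesis .
  qed
  then show thesis
    using C by (intro that[of "c / C"]) (auto simp: below_def)
qed

end

subsection \<open>Diagonal operators of rank two\<close>

locale orthonormal_pair =
  fixes e1 e2 :: "'h::chilbert_space"
  assumes orth: "orthonormal {e1, e2}" and neq: "e1 \<noteq> e2"
begin

lemma cinner_pair [simp]: "cinner e1 e1 = 1" "cinner e2 e2 = 1" "cinner e1 e2 = 0" "cinner e2 e1 = 0"
  using orth neq unfolding orthonormal_def by auto

lemma norm_pair [simp]: "norm e1 = 1" "norm e2 = 1"
  using orthonormalD[OF orth] by auto

definition diag_op :: "complex \<times> complex \<Rightarrow> 'h \<Rightarrow> 'h" where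
  "diag_op v x = (fst v * cinner x e1) *\<^sub>C e1 + (snd v * cinner x e2) *\<^sub>C e2"

lemma diag_op_add: "diag_op (v + w) = diag_op v + diag_op w"
  by (rule ext) (simp add: diag_op_def distrib_right scaleC_add_left)

lemma diag_op_scaleC: "diag_op (c *\<^sub>C v) = c *\<^sub>C diag_op v"
  by (rule ext) (simp add: diag_op_def scaleC_prod_def scaleC_fun_def scaleC_complex_def
      scaleC_add_right scaleC_scaleC mult.assoc)

lemma diag_op_e: "diag_op v e1 = fst v *\<^sub>C e1" "diag_op v e2 = snd v *\<^sub>C e2"
  using complex_vector.scale_zero_left by (auto simp: diag_op_def)

lemma norm_diag_op_sq:
  "(norm (diag_op v x))\<^sup>2 = (cmod (fst v))\<^sup>2 * (cmod (cinner x e1))\<^sup>2 + (cmod (snd v))\<^sup>2 * (cmod (cinner x e2))\<^sup>2"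
  unfolding diag_op_def norm_add_sq
  by (simp add: cinner_scaleC_left cinner_scaleC_right norm_scaleC norm_mult power_mult_distrib)

lemma norm_diag_op_le: "norm (diag_op v x) \<le> max (cmod (fst v)) (cmod (snd v)) * norm x"
proof -
  define m where "m = max (cmod (fst v)) (cmod (snd v))"
  have m: "(cmod (fst v))\<^sup>2 \<le> m\<^sup>2" "(cmod (snd v))\<^sup>2 \<le> m\<^sup>2" "0 \<le> m"
    by (auto simp: m_def intro: power_mono max.coboundedI1)
  have "(norm (diag_op v x))\<^sup>2 \<le> m\<^sup>2 * (cmod (cinner x e1))\<^sup>2 + m\<^sup>2 * (cmod (cinner x e2))\<^sup>2"
    unfolding norm_diag_op_sq using m by (intro add_mono mult_right_mono) auto
  also have "\<dots> = m\<^sup>2 * (\<Sum>e\<in>{e1, e2}. (cmod (cinner x e))\<^sup>2)"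
    using neq by (simp add: distrib_left)
  also have "\<dots> \<le> m\<^sup>2 * (norm x)\<^sup>2" by (intro mult_left_mono bessel orth) auto
  finally have "(norm (diag_op v x))\<^sup>2 \<le> (m * norm x)\<^sup>2" by (simp add: power_mult_distrib)
  then show ?thesis unfolding m_def[symmetric] by (rule power2_le_imp_le) (use m in simp)
qed

lemma bounded_clinear_diag_op: "bounded_clinear (diag_op v)"
  unfolding bounded_clinear_def
proof
  have scale: "diag_op v (c *\<^sub>C x) = c *\<^sub>C diag_op v x" for c x
    by (simp add: diag_op_def cinner_scaleC_left scaleC_add_right scaleC_scaleC mult_ac)
  then show "\<forall>c x. diag_op v (c *\<^sub>C x) = c *\<^sub>C diag_op v x" by blast
  show "bounded_linear (diag_op v)"
  proof (rule bounded_linear_intro)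
    show "diag_op v (x + y) = diag_op v x + diag_op v y" for x y
      by (simp add: diag_op_def cinner_add_left distrib_left scaleC_add_left)
    show "diag_op v (r *\<^sub>R x) = r *\<^sub>R diag_op v x" for r x
      by (simp only: scaleR_scaleC scale)
    show "norm (diag_op v x) \<le> norm x * max (cmod (fst v)) (cmod (snd v))" for x
      using norm_diag_op_le[of v x] by (simp only: mult.commute)
  qed
qed

text \<open>The image of the unit ball lies in a continuous image of a product of two closed
  discs.\<close>

lemma compact_diag_op: "compact_operator (diag_op v)"
  unfolding compact_operator_def
proof
  define g :: "complex \<times> complex \<Rightarrow> 'h" where "g q = fst q *\<^sub>C e1 + snd q *\<^sub>C e2" for q
  have bl: "bounded_linear (\<lambda>c. c *\<^sub>C e)" for e :: 'h
  proof (rule bounded_linear_intro)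
    show "norm (c *\<^sub>C e) \<le> norm c * norm e" for c by (simp only: norm_scaleC)
    show "(c + d) *\<^sub>C e = c *\<^sub>C e + d *\<^sub>C e" for c d by (rule scaleC_add_left)
    show "(r *\<^sub>R c) *\<^sub>C e = r *\<^sub>R c *\<^sub>C e" for r c
      by (simp only: scaleR_scaleC scaleC_scaleC scaleC_complex_def)
  qed
  have "continuous_on UNIV g"
    unfolding g_def
    by (intro continuous_intros bounded_linear.continuous_on[OF bl])
  define K where "K = g ` (cball 0 (cmod (fst v)) \<times> cball 0 (cmod (snd v)))"
  have K: "compact K"
    unfolding K_def by (intro compact_continuous_image compact_Times compact_cball)
      (rule continuous_on_subset[OF \<open>continuous_on UNIV g\<close>], simp)
  have "diag_op v ` cball 0 1 \<subseteq> K"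
  proof
    fix y assume "y \<in> diag_op v ` cball 0 1"
    then obtain x where x: "norm x \<le> 1" "y = diag_op v x" by auto
    have le: "cmod (c * cinner x e) \<le> cmod c" if "norm e = 1" for c e
    proof -
      have "cmod (cinner x e) \<le> 1" using cmod_cinner_le[of x e] x(1) that by simp
      then show ?thesis by (simp add: norm_mult mult_left_le)
    qed
    have "y = g (fst v * cinner x e1, snd v * cinner x e2)"
      by (simp add: x(2) diag_op_def g_def)
    then show "y \<in> K" unfolding K_def using le by auto
  qed
  then have "closure (diag_op v ` cball 0 1) \<subseteq> K"
    by (rule closure_minimal) (rule compact_imp_closed[OF K])
  then show "compact (closure (diag_op v ` cball 0 1))"
    using compact_Int_closed[OF K closed_closure, of "diag_op v ` cball 0 1"] by (simp add: Int_absorb1)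
qed (rule bounded_clinear_diag_op)

lemma cadjoint_diag_op: "cadjoint (diag_op v) x = diag_op (cnj (fst v), cnj (snd v)) x"
proof (rule cadjoint_unique[OF bounded_clinear_diag_op])
  fix y
  have "cinner e1 x = cnj (cinner x e1)" "cinner e2 x = cnj (cinner x e2)" by (rule cinner_commute)+
  then show "cinner (diag_op v y) x = cinner y (diag_op (cnj (fst v), cnj (snd v)) x)"
    by (simp add: diag_op_def cinner_add_left cinner_add_right cinner_scaleC_left cinner_scaleC_right)
qed

text \<open>On \<open>e1\<close> and \<open>e2\<close> this is the eigenvalue of the modulus of
  \<open>diag_op v\<close>. It is a function of the vector so that equal moduli are counted
  twice.\<close>

definition val :: "complex \<times> complex \<Rightarrow> 'h \<Rightarrow> real" where
  "val v e = (if e = e1 then cmod (fst v) else cmod (snd v))"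

text \<open>The square of the modulus of \<open>diag_op v\<close> is diagonal on the pair and 0 on
  the orthogonal complement. An eigenvector for s^2 > 0 is thus a combination of \<open>e1\<close>
  and \<open>e2\<close>, and its coefficient vanishes where \<open>val v e\<close> differs from
  s.\<close>

lemma singular_space_diag_op:
  assumes "0 < s"
  shows "singular_space (diag_op v) s = complex_vector.span {e \<in> {e1, e2}. val v e = s}"
proof -
  let ?B = "{e \<in> {e1, e2}. val v e = s}"
  have sq: "cadjoint (diag_op v) (diag_op v x)
      = (\<Sum>e\<in>{e1, e2}. (of_real ((val v e)\<^sup>2) * cinner x e) *\<^sub>C e)" for x
    unfolding cadjoint_diag_op using neq
    by (simp add: diag_op_def val_def cinner_add_left cinner_scaleC_left complex_norm_square mult_ac
        del: of_real_power)
  show ?thesis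
  proof
    have "complex_vector.subspace (singular_space (diag_op v) s)"
      by (rule subspace_singular_space[OF bounded_clinear_diag_op])
    moreover have "?B \<subseteq> singular_space (diag_op v) s"
      using neq complex_vector.scale_zero_left unfolding singular_space_def by (auto simp: sq)
    ultimately show "complex_vector.span ?B \<subseteq> singular_space (diag_op v) s"
      by (intro complex_vector.span_minimal)
  next
    show "singular_space (diag_op v) s \<subseteq> complex_vector.span ?B"
    proof
      fix x assume "x \<in> singular_space (diag_op v) s"
      then have x: "of_real (s\<^sup>2) *\<^sub>C x = (\<Sum>e\<in>{e1, e2}. (of_real ((val v e)\<^sup>2) * cinner x e) *\<^sub>C e)"
        by (simp only: singular_space_def mem_Collect_eq sq)
      have zero: "cinner x e = 0" if e: "e \<in> {e1, e2}" "val v e \<noteq> s" for e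
      proof -
        have "of_real (s\<^sup>2) * cinner x e = of_real ((val v e)\<^sup>2) * cinner x e"
          using arg_cong[OF x, of "\<lambda>y. cinner y e"] e(1) neq
          by (auto simp: cinner_scaleC_left cinner_add_left)
        moreover have "s\<^sup>2 \<noteq> (val v e)\<^sup>2"
          using e(2) assms by (auto simp: val_def power2_eq_iff_nonneg)
        ultimately show ?thesis unfolding mult_cancel_right of_real_eq_iff by simp
      qed
      have "(\<Sum>e\<in>{e1, e2}. (of_real ((val v e)\<^sup>2) * cinner x e) *\<^sub>C e) \<in> complex_vector.span ?B"
      proof (intro complex_vector.span_sum)
        fix e assume e: "e \<in> {e1, e2}"
        show "(of_real ((val v e)\<^sup>2) * cinner x e) *\<^sub>C e \<in> complex_vector.span ?B"
        proof (cases "val v e = s")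
          case True
          then show ?thesis using e by (intro complex_vector.span_scale complex_vector.span_base) simp
        next
          case False
          then show ?thesis
            using zero[OF e] complex_vector.scale_zero_left[of e] complex_vector.span_zero by simp
        qed
      qed
      then have "of_real (s\<^sup>2) *\<^sub>C x \<in> complex_vector.span ?B" by (simp only: x)
      then have "inverse (of_real (s\<^sup>2)) *\<^sub>C of_real (s\<^sup>2) *\<^sub>C x \<in> complex_vector.span ?B"
        by (rule complex_vector.span_scale)
      then show "x \<in> complex_vector.span ?B"
        using assms by (simp add: scaleC_scaleC scaleC_one)
    qed
  qed
qed

lemma cdim_singular_space_diag_op:
  assumes "0 < s"
  shows "cdim (singular_space (diag_op v) s) = enat (card {e \<in> {e1, e2}. val v e = s})"
proof -
  let ?B = "{e \<in> {e1, e2}. val v e = s}"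
  have fin: "finite ?B" by simp
  have "orthonormal ?B" using orth unfolding orthonormal_def by blast
  then have "complex_vector.independent ?B" using fin by (rule orthonormal_independent)
  then have "complex_vector.dim (complex_vector.span ?B) = card ?B"
    by (rule complex_vector.dim_span_eq_card_independent)
  moreover have "\<exists>B. finite B \<and> complex_vector.span ?B \<subseteq> complex_vector.span B"
    by (rule exI[of _ ?B]) simp
  ultimately show ?thesis unfolding singular_space_diag_op[OF assms] cdim_def by simp
qed

lemma singular_values_diag_op: "singular_values (diag_op v) = val v ` {e1, e2} - {0}"
proof -
  have "(\<exists>x\<in>singular_space (diag_op v) s. x \<noteq> 0) \<longleftrightarrow> s \<in> val v ` {e1, e2}" if "0 < s" for s
  proof
    assume "\<exists>x\<in>singular_space (diag_op v) s. x \<noteq> 0"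
    then have "{e \<in> {e1, e2}. val v e = s} \<noteq> {}"
      unfolding singular_space_diag_op[OF that] by (metis complex_vector.span_empty singletonD)
    then show "s \<in> val v ` {e1, e2}" by blast
  next
    assume "s \<in> val v ` {e1, e2}"
    then obtain e where e: "e \<in> {e1, e2}" "val v e = s" by blast
    then have "e \<in> singular_space (diag_op v) s"
      unfolding singular_space_diag_op[OF that] by (intro complex_vector.span_base) simp
    moreover have "norm e = 1" using e(1) norm_pair by auto
    then have "e \<noteq> 0" by auto
    ultimately show "\<exists>x\<in>singular_space (diag_op v) s. x \<noteq> 0" by blast
  qed
  moreover have "0 \<le> val v e" for e by (simp add: val_def)
  ultimately show ?thesis unfolding singular_values_def by (auto simp: less_le)
qed

lemma schatten_sum_diag_op:
  "schatten_sum p (diag_op v) = ennreal (cmod (fst v) powr p + cmod (snd v) powr p)"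
proof -
  let ?E = "{e1, e2}"
  let ?S = "val v ` ?E"
  have summand: "ennreal_of_enat (cdim (singular_space (diag_op v) s)) * ennreal (s powr p)
      = ennreal (\<Sum>e\<in>{e \<in> ?E. val v e = s}. val v e powr p)" if "s \<in> ?S - {0}" for s
  proof -
    have "0 < s" using that by (auto simp: val_def)
    have "(\<Sum>e\<in>{e \<in> ?E. val v e = s}. val v e powr p) = (\<Sum>e\<in>{e \<in> ?E. val v e = s}. s powr p)"
      by (intro sum.cong refl) simp
    also have "\<dots> = card {e \<in> ?E. val v e = s} * s powr p" by simp
    finally show ?thesis
      unfolding cdim_singular_space_diag_op[OF \<open>0 < s\<close>]
      by (simp only: ennreal_of_enat_enat ennreal_of_nat_eq_real_of_nat ennreal_mult[OF of_nat_0_le_iff powr_ge_zero])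
  qed
  have "schatten_sum p (diag_op v) = (\<Sum>s\<in>?S - {0}. ennreal (\<Sum>e\<in>{e \<in> ?E. val v e = s}. val v e powr p))"
    unfolding schatten_sum_def singular_values_diag_op
    by (subst infsum_finite, simp) (rule sum.cong[OF refl summand])
  also have "\<dots> = ennreal (\<Sum>s\<in>?S - {0}. \<Sum>e\<in>{e \<in> ?E. val v e = s}. val v e powr p)"
    by (intro sum_ennreal sum_nonneg) auto
  \<comment> \<open>The value 0 may be included because \<open>0 powr p = 0\<close>; grouping by
    values then collapses to a sum over the pair.\<close>
  also have "(\<Sum>s\<in>?S - {0}. \<Sum>e\<in>{e \<in> ?E. val v e = s}. val v e powr p)
      = (\<Sum>s\<in>?S. \<Sum>e\<in>{e \<in> ?E. val v e = s}. val v e powr p)"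
    by (intro sum.mono_neutral_left) (auto intro!: sum.neutral)
  also have "\<dots> = (\<Sum>e\<in>?E. val v e powr p)"
    by (rule sum.group) auto
  also have "\<dots> = cmod (fst v) powr p + cmod (snd v) powr p" using neq by (simp add: val_def)
  finally show ?thesis .
qed

lemma onorm_diag_op: "onorm (diag_op v) = max (cmod (fst v)) (cmod (snd v))"
proof (rule antisym)
  show "onorm (diag_op v) \<le> max (cmod (fst v)) (cmod (snd v))"
    by (rule onorm_bound) (auto simp: norm_diag_op_le max.coboundedI1)
  have "norm (diag_op v e) \<le> onorm (diag_op v) * norm e" for e
    by (rule bounded_clinearD(6)[OF bounded_clinear_diag_op])
  from this[of e1] this[of e2] show "max (cmod (fst v)) (cmod (snd v)) \<le> onorm (diag_op v)"
    by (simp add: diag_op_e norm_scaleC)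
qed

lemma diag_op_isometric:
  "isometric_embedding UNIV (ell_norm q) (schatten_class q) (schatten_norm q) diag_op"
  unfolding isometric_embedding_def
proof (intro conjI ballI allI)
  show "diag_op v \<in> schatten_class q" for v
    unfolding schatten_class_def by (simp add: compact_diag_op schatten_sum_diag_op)
  show "schatten_norm q (diag_op v) = ell_norm q v" for v
    unfolding schatten_norm_def ell_norm_def onorm_diag_op schatten_sum_diag_op by (simp del: ennreal_plus)
qed (simp_all add: diag_op_add diag_op_scaleC)

end

text \<open>A space spanned by at most one vector would have \<open>cdim\<close> at most 1, and this
  excludes finite and infinite dimension alike. Hence some vector lies outside the span of {} and
  another outside that of {e1}, and both are orthonormalised.\<close>

lemma orthonormal_pair_exists:
  assumes "2 \<le> cdim (UNIV :: 'h::chilbert_space set)"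
  obtains e1 e2 :: "'h::chilbert_space" where "orthonormal_pair e1 e2"
proof -
  have outside: "\<exists>x. x \<notin> complex_vector.span B" if B: "finite B" "card B \<le> 1" for B :: "'h set"
  proof (rule ccontr)
    assume "\<not> ?thesis"
    then have sub: "UNIV \<subseteq> complex_vector.span B" by blast
    then have "\<exists>B. finite B \<and> (UNIV :: 'h set) \<subseteq> complex_vector.span B" using B by blast
    then have "cdim (UNIV :: 'h set) = enat (complex_vector.dim (UNIV :: 'h set))"
      unfolding cdim_def by (rule if_P)
    moreover have "complex_vector.dim (UNIV :: 'h set) \<le> 1"
      using complex_vector.dim_le_card[OF sub B(1)] B(2) by simp
    ultimately show False using assms by (simp add: numeral_eq_enat)
  qed
  obtain x :: 'h where "x \<notin> complex_vector.span {}" using outside[of "{}"] by auto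
  then have "x \<noteq> 0" by simp
  define e1 where "e1 = (1 / norm x) *\<^sub>R x"
  have n1: "norm e1 = 1" using \<open>x \<noteq> 0\<close> by (simp add: e1_def)
  then have o1: "orthonormal {e1}" by (simp add: orthonormal_def cinner_self)
  obtain y :: 'h where y: "y \<notin> complex_vector.span {e1}" using outside[of "{e1}"] by auto
  define y' where "y' = y - fproj {e1} y"
  have "fproj {e1} y \<in> complex_vector.span {e1}"
    unfolding fproj_def by (simp add: complex_vector.span_scale complex_vector.span_base)
  then have "y' \<noteq> 0" using y by (auto simp: y'_def)
  have y'e: "cinner y' e1 = 0" unfolding y'_def using o1 by (intro cinner_diff_fproj) auto
  define e2 where "e2 = (1 / norm y') *\<^sub>R y'"
  have n2: "norm e2 = 1" using \<open>y' \<noteq> 0\<close> by (simp add: e2_def)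
  have e21: "cinner e2 e1 = 0" by (simp add: e2_def cinner_scaleR_left y'e)
  show thesis
  proof (rule that, unfold_locales)
    show "orthonormal {e1, e2}"
      using n1 n2 e21 cinner_eq_zero_swap[OF e21] by (auto simp: orthonormal_def cinner_self)
    show "e1 \<noteq> e2" using n1 e21 by (auto simp: cinner_self)
  qed
qed

subsection \<open>Matrices as operators\<close>

lemma bounded_clinear_matrix: "bounded_clinear (\<lambda>x. M *v (x :: complex ^ 'n))"
  for M :: "complex ^ 'n ^ 'n"
  unfolding bounded_clinear_def
  by (auto simp: Finite_Cartesian_Product.vec_eq_iff matrix_vector_mult_def scaleC_vec_def scaleC_complex_def sum_distrib_left mult_ac
      intro!: linear_conv_bounded_linear[THEN iffD1] linearI sum.cong sum.distrib[symmetric, THEN trans]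
      simp: distrib_left sum.distrib scaleR_conv_of_real)

lemma axis_expansion: "x = (\<Sum>i\<in>UNIV. (x $ i) *\<^sub>C axis i 1)" for x :: "complex ^ 'n"
  by (simp add: Finite_Cartesian_Product.vec_eq_iff scaleC_vec_def scaleC_complex_def axis_def if_distrib[of "\<lambda>c. _ * c"] cong: if_cong)

lemma span_axes: "complex_vector.span (range (\<lambda>i. axis i 1)) = (UNIV :: (complex ^ 'n) set)"
proof -
  have "x \<in> complex_vector.span (range (\<lambda>i. axis i 1))" for x :: "complex ^ 'n"
    by (subst axis_expansion)
       (intro complex_vector.span_sum complex_vector.span_scale complex_vector.span_base rangeI)
  then show ?thesis by blast
qed

text \<open>Unit singular vectors for different s are orthogonal, so there are no more singular
  values than axes, each of finite multiplicity. As all matrices lie in the class, an embedding into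
  matrices is also one into a Schatten class.\<close>

lemma matrix_in_schatten_class:
  fixes M :: "complex ^ 'n ^ 'n"
  shows "(\<lambda>x. M *v x) \<in> schatten_class p"
proof -
  let ?A = "\<lambda>x. M *v x"
  let ?B = "range (\<lambda>i. axis i 1) :: (complex ^ 'n) set"
  have b: "bounded_clinear ?A" by (rule bounded_clinear_matrix)
  have "compact_operator ?A"
    unfolding compact_operator_def
  proof
    have "bounded (?A ` cball 0 1)"
      using bounded_clinearD(1)[OF b] by (intro bounded_linear_image bounded_cball)
    then show "compact (closure (?A ` cball 0 1))" by (simp only: compact_closure)
  qed (rule b)
  moreover have "schatten_sum r ?A < \<infinity>" for r
  proof -
    have unit: "\<exists>e. e \<in> singular_space ?A s \<and> norm e = 1" if s: "s \<in> singular_values ?A" for s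
    proof -
      obtain x where x: "x \<in> singular_space ?A s" "x \<noteq> 0" using s by (auto simp: singular_values_def)
      then have "of_real (1 / norm x) *\<^sub>C x \<in> singular_space ?A s"
        by (intro complex_vector.subspace_scale[OF subspace_singular_space[OF b]])
      then show ?thesis using x(2) by (intro exI[of _ "of_real (1 / norm x) *\<^sub>C x"]) (simp add: norm_scaleC norm_divide)
    qed
    then obtain f where f: "\<And>s. s \<in> singular_values ?A \<Longrightarrow> f s \<in> singular_space ?A s \<and> norm (f s) = 1"
      by metis
    have pos: "0 < s" if "s \<in> singular_values ?A" for s using that by (simp add: singular_values_def)
    have ff: "cinner (f s) (f r) = (if s = r then 1 else 0)"
      if "s \<in> singular_values ?A" "r \<in> singular_values ?A" for s r
      using singular_spaces_orthogonal[OF b, of "f s" s "f r" r] f[OF that(1)] f[OF that(2)] pos that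
      by (auto simp: cinner_self)
    have inj: "inj_on f (singular_values ?A)"
    proof (rule inj_onI)
      fix s r assume "s \<in> singular_values ?A" "r \<in> singular_values ?A" "f s = f r"
      then show "s = r" using ff[of s s] ff[of s r] by (auto split: if_splits)
    qed
    have "finite (singular_values ?A)"
    proof (rule ccontr)
      assume "infinite (singular_values ?A)"
      then obtain F where F: "F \<subseteq> singular_values ?A" "finite F" "card F = Suc (card ?B)"
        using infinite_arbitrarily_large by metis
      have "orthonormal (f ` F)"
        unfolding orthonormal_def using ff F(1) inj by (auto simp: inj_on_eq_iff subset_iff)
      then have "complex_vector.independent (f ` F)" using F(2) by (intro orthonormal_independent) auto
      then have "card (f ` F) \<le> card ?B"
        using complex_vector.independent_span_bound[of ?B "f ` F"] by (simp add: span_axes)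
      moreover have "card (f ` F) = card F" using inj F(1) by (intro card_image) (rule inj_on_subset)
      ultimately show False using F(3) by simp
    qed
    moreover have "ennreal_of_enat (cdim (singular_space ?A s)) * ennreal (s powr r) < \<infinity>" for s
    proof -
      have "\<exists>B. finite B \<and> singular_space ?A s \<subseteq> complex_vector.span B"
        by (rule exI[of _ ?B]) (simp add: span_axes)
      then obtain d where "cdim (singular_space ?A s) = enat d" unfolding cdim_def by simp
      then show ?thesis by (simp add: ennreal_mult_less_top of_nat_less_top)
    qed
    ultimately show ?thesis unfolding schatten_sum_def by (subst infsum_finite) auto
  qed
  ultimately show ?thesis unfolding schatten_class_def by blast
qed

lemma cinner_axis: "cinner x (axis i 1) = x $ i" for x :: "complex ^ 'n"
proof -
  have "cinner x (axis i 1) = (\<Sum>j\<in>UNIV. if j = i then x $ j else 0)"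
    unfolding cinner_vec_def by (intro sum.cong refl) (simp add: cinner_complex_def axis_def)
  then show ?thesis by simp
qed

lemma matrix_diag_embedding:
  assumes "2 \<le> CARD('m::finite)"
  obtains D :: "complex \<times> complex \<Rightarrow> complex ^ 'm ^ 'm"
    where "isometric_embedding UNIV (ell_norm q) UNIV (matrix_schatten_norm q) D"
proof -
  obtain i j :: 'm where ij: "i \<noteq> j"
    using assms card_le_Suc0_iff_eq[of "UNIV :: 'm set"] by (auto simp: numeral_2_eq_2)
  interpret orthonormal_pair "axis i 1 :: complex ^ 'm" "axis j 1"
  proof
    have "cinner (axis a 1 :: complex ^ 'm) (axis b 1) = (if a = b then 1 else 0)" for a b :: 'm
      unfolding cinner_axis by (simp add: axis_def)
    then show "orthonormal {axis i 1 :: complex ^ 'm, axis j 1}"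
      using ij by (simp add: orthonormal_def axis_eq_axis)
    show "axis i 1 \<noteq> (axis j 1 :: complex ^ 'm)" using ij by (simp add: axis_eq_axis)
  qed
  define D :: "complex \<times> complex \<Rightarrow> complex ^ 'm ^ 'm" where
    "D v = (\<chi> r c. if r = c then (if r = i then fst v else if r = j then snd v else 0) else 0)" for v
  have Dv: "(\<lambda>x. D v *v x) = diag_op v" for v
  proof
    fix x :: "complex ^ 'm"
    show "D v *v x = diag_op v x"
      unfolding diag_op_def cinner_axis
      using ij by (auto simp: Finite_Cartesian_Product.vec_eq_iff D_def matrix_vector_mult_def scaleC_vec_def
          scaleC_complex_def axis_def if_distrib[of "\<lambda>c. c * _"] cong: if_cong)
  qed
  have "isometric_embedding UNIV (ell_norm q) UNIV (matrix_schatten_norm q) D"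
    unfolding isometric_embedding_def
  proof (intro conjI ballI allI)
    show "D (v + w) = D v + D w" for v w by (simp add: D_def Finite_Cartesian_Product.vec_eq_iff)
    show "D (c *\<^sub>C v) = c *\<^sub>C D v" for c v
      by (simp add: D_def Finite_Cartesian_Product.vec_eq_iff scaleC_vec_def scaleC_prod_def scaleC_complex_def)
    show "matrix_schatten_norm q (D v) = ell_norm q v" for v
      using diag_op_isometric[of q] unfolding matrix_schatten_norm_def Dv isometric_embedding_def by blast
  qed simp
  then show thesis by (rule that)
qed

lemma isometric_embedding_compose:
  assumes "isometric_embedding U nU V nV S" "isometric_embedding V nV W nW T"
  shows "isometric_embedding U nU W nW (\<lambda>x. T (S x))"
  using assms unfolding isometric_embedding_def by simp

lemma matrix_to_operator_embedding:
  "isometric_embedding UNIV (matrix_schatten_norm p) (schatten_class p) (schatten_norm p)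
    (\<lambda>M x. M *v (x :: complex ^ 'n))"
  unfolding isometric_embedding_def
proof (intro conjI ballI allI)
  show "(\<lambda>x. (M + N) *v x) = (\<lambda>x. M *v x) + (\<lambda>x. N *v x)" for M N :: "complex ^ 'n ^ 'n"
    by (rule ext) (simp add: matrix_vector_mult_add_rdistrib)
  show "(\<lambda>x. (c *\<^sub>C M) *v x) = c *\<^sub>C (\<lambda>x. M *v x)" for c and M :: "complex ^ 'n ^ 'n"
    by (rule ext) (simp add: scaleC_fun_def Finite_Cartesian_Product.vec_eq_iff matrix_vector_mult_def scaleC_vec_def scaleC_complex_def
        sum_distrib_left mult.assoc)
qed (simp_all add: matrix_in_schatten_class matrix_schatten_norm_def)

subsection \<open>Excluding two-dimensional sequence spaces\<close>

text \<open>For finite q take w = q: the exponent p / w is at most 1 and the base at least 1. For q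
  = \<infinity> the norm of (1, z) is 1 on the unit disc, and 3 is an arbitrary exponent above
  2.\<close>

lemma ell_norm_powr_le:
  assumes "2 < q" "0 < p" "p \<le> 2"
  obtains w :: real where "2 < w"
    "\<forall>z. cmod z \<le> 1 \<longrightarrow> ell_norm q (1, z) powr p \<le> 1 + cmod z powr w"
proof (cases q)
  case (real w)
  then have "2 < w" using assms(1) by simp
  have "ell_norm q (1, z) powr p \<le> 1 + cmod z powr w" for z
  proof -
    have "ell_norm q (1, z) powr p = (1 + cmod z powr w) powr (p / w)"
      using real by (simp add: ell_norm_def powr_powr)
    also have "\<dots> \<le> (1 + cmod z powr w) powr 1"
      using assms \<open>2 < w\<close> by (intro powr_mono) auto
    finally show ?thesis by simp
  qed
  then show thesis using that[of w] \<open>2 < w\<close> by blast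
next
  case PInf
  then show thesis by (intro that[of 3]) (auto simp: ell_norm_def max_def)
qed (use assms in auto)

lemma ell_norm_unit: "ell_norm q (1, 0) = 1" "0 < q \<Longrightarrow> ell_norm q (0, 1) = 1" "ell_norm q (0, 0) = 0"
  by (auto simp: ell_norm_def)

text \<open>The Schatten sum is 1 at A and at most 1 + t^w on the circle of radius t, so growth on
  circles gives c t^2 \<le> t^w for all t up to 1. This fails for small t because w > 2.\<close>

lemma no_ell_isometric_embedding:
  fixes p q :: ereal and T :: "complex \<times> complex \<Rightarrow> ('k::chilbert_space \<Rightarrow> 'k)"
  assumes "0 < p" "p \<le> 2" "2 < q"
    and T: "isometric_embedding UNIV (ell_norm q) (schatten_class p) (schatten_norm p) T"
  shows False
proof -
  obtain r where r: "p = ereal r" "0 < r" "r \<le> 2" using assms(1,2) by (cases p) auto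
  have add: "T (v + w) = T v + T w" for v w using T unfolding isometric_embedding_def by blast
  have scale: "T (c *\<^sub>C v) = c *\<^sub>C T v" for c v using T unfolding isometric_embedding_def by blast
  have nrm: "schatten_norm p (T v) = ell_norm q v" for v using T unfolding isometric_embedding_def by blast
  have cls: "T v \<in> schatten_class p" for v using T unfolding isometric_embedding_def by blast
  have compact: "compact_operator (T v)" and fin: "schatten_sum r (T v) < \<infinity>" for v
    using cls[of v] unfolding schatten_class_def r(1) by auto
  have sum_eq: "schatten_sum r (T v) = ennreal (ell_norm q v powr r)" for v
  proof -
    obtain S where S: "schatten_sum r (T v) = ennreal S" "0 \<le> S"
      using fin[of v] by (cases "schatten_sum r (T v)") auto
    have "ell_norm q v = S powr (1 / r)"
      using nrm[of v] S unfolding schatten_norm_def r(1) by simp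
    then have "ell_norm q v powr r = S" using r(2) S(2) by (simp add: powr_powr)
    then show ?thesis using S(1) by simp
  qed
  define A B where "A = T (1, 0)" and "B = T (0, 1)"
  have pencil: "(\<lambda>y. A y + z *\<^sub>C B y) = T (1, z)" for z
  proof -
    have "(1, z) = (1, 0) + z *\<^sub>C (0, 1 :: complex)"
      by (simp add: scaleC_prod_def scaleC_complex_def)
    then have "T (1, z) = T ((1, 0) + z *\<^sub>C (0, 1))" by (rule arg_cong)
    also have "\<dots> = A + z *\<^sub>C B" unfolding A_def B_def by (simp only: add scale)
    finally have "T (1, z) = A + z *\<^sub>C B" .
    then show ?thesis by (simp add: fun_eq_iff scaleC_fun_def)
  qed
  \<comment> \<open>The isometry gives B norm 1, whereas the image of 0 has norm 0.\<close>
  have "\<exists>x. B x \<noteq> 0"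
  proof (rule ccontr)
    assume "\<not> ?thesis"
    then have "B = 0" by (simp add: fun_eq_iff)
    moreover have "T (0, 0) = 0 *\<^sub>C T (0, 0)"
      unfolding scale[symmetric] by (simp add: scaleC_prod_def scaleC_complex_def)
    then have "T (0, 0) = 0" by simp
    ultimately have "ell_norm q (0, 1) = ell_norm q (0, 0)" unfolding nrm[symmetric] B_def by simp
    moreover have "0 < q" using assms(3) by (rule less_trans[rotated]) simp
    ultimately show False by (simp add: ell_norm_unit)
  qed
  then obtain x where x: "B x \<noteq> 0" by blast
  interpret circle_pencil A B r x
    using compact bounded_clinear_compact r x unfolding A_def B_def
    by unfold_locales (auto simp: pencil[unfolded A_def B_def])
  obtain c where c: "0 < c" "\<forall>t U. 0 < t \<longrightarrow> t \<le> 1 \<longrightarrow> 0 \<le> U \<longrightarrow>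
    (\<forall>z. cmod z = t \<longrightarrow> schatten_sum r (\<lambda>y. A y + z *\<^sub>C B y) \<le> ennreal U) \<longrightarrow>
    schatten_sum r A + ennreal (c * t\<^sup>2) \<le> ennreal U"
    using schatten_circle_growth r fin[of "(1, 0)"] unfolding A_def by blast
  obtain w where w: "2 < w" "\<forall>z. cmod z \<le> 1 \<longrightarrow> ell_norm q (1, z) powr r \<le> 1 + cmod z powr w"
    using ell_norm_powr_le[OF assms(3) r(2,3)] by blast
  have growth: "c * t\<^sup>2 \<le> t powr w" if t: "0 < t" "t \<le> 1" for t
  proof -
    have "schatten_sum r A + ennreal (c * t\<^sup>2) \<le> ennreal (1 + t powr w)"
    proof (rule c(2)[rule_format, OF t])
      fix z :: complex assume "cmod z = t"
      then show "schatten_sum r (\<lambda>y. A y + z *\<^sub>C B y) \<le> ennreal (1 + t powr w)"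
        unfolding pencil sum_eq using w(2) t by (intro ennreal_leI) auto
    qed simp
    then have "ennreal (1 + c * t\<^sup>2) \<le> ennreal (1 + t powr w)"
      using c(1) unfolding A_def sum_eq by (simp add: ell_norm_unit)
    then show ?thesis by (subst (asm) ennreal_le_iff) auto
  qed
  \<comment> \<open>This radius satisfies t^(w-2) \<le> c/2 < c as well as t \<le> 1.\<close>
  define t where "t = min 1 ((c / 2) powr (1 / (w - 2)))"
  have t: "0 < t" "t \<le> 1" using c(1) by (auto simp: t_def)
  have "t powr (w - 2) \<le> ((c / 2) powr (1 / (w - 2))) powr (w - 2)"
    using t w(1) by (intro powr_mono2) (auto simp: t_def)
  also have "\<dots> = c / 2" using c(1) w(1) by (simp add: powr_powr)
  finally have "t powr (w - 2) < c" using c(1) by simp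
  moreover have "t powr w = t powr (w - 2) * t\<^sup>2"
    using t(1) by (simp add: powr_diff)
  ultimately have "t powr w < c * t\<^sup>2" using t(1) by simp
  then show False using growth[OF t] by simp
qed

theorem theorem1p1:
  fixes p q :: ereal
  assumes "0 < p" and "p \<le> 2" and "2 < q"
  shows
    "(\<nexists>T :: complex \<times> complex \<Rightarrow> ('k::chilbert_space \<Rightarrow> 'k).
        isometric_embedding UNIV (ell_norm q) (schatten_class p) (schatten_norm p) T) \<and>
     (2 \<le> CARD('m::finite) \<longrightarrow>
        (\<nexists>T :: complex ^ 'm ^ 'm \<Rightarrow> complex ^ 'n ^ 'n.
           isometric_embedding UNIV (matrix_schatten_norm q) UNIV (matrix_schatten_norm p) T)) \<and>
     (2 \<le> cdim (UNIV :: 'h::chilbert_space set) \<longrightarrow>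
        (\<nexists>T :: ('h \<Rightarrow> 'h) \<Rightarrow> ('k \<Rightarrow> 'k).
           isometric_embedding (schatten_class q) (schatten_norm q)
             (schatten_class p) (schatten_norm p) T))"
proof (intro conjI impI notI; elim exE)
  fix T :: "complex \<times> complex \<Rightarrow> ('k \<Rightarrow> 'k)"
  assume "isometric_embedding UNIV (ell_norm q) (schatten_class p) (schatten_norm p) T"
  then show False by (rule no_ell_isometric_embedding[OF assms])
next
  fix T :: "complex ^ 'm ^ 'm \<Rightarrow> complex ^ 'n ^ 'n"
  assume m: "2 \<le> CARD('m)"
    and T: "isometric_embedding UNIV (matrix_schatten_norm q) UNIV (matrix_schatten_norm p) T"
  obtain D :: "complex \<times> complex \<Rightarrow> complex ^ 'm ^ 'm"
    where "isometric_embedding UNIV (ell_norm q) UNIV (matrix_schatten_norm q) D"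
    by (rule matrix_diag_embedding[OF m])
  \<comment> \<open>The exclusion of the sequence space holds in every Hilbert space and is applied
    to \<open>complex ^ 'n\<close>, with T placed between the diagonal matrices and the operators
    that matrices define.\<close>
  from isometric_embedding_compose[OF isometric_embedding_compose[OF this T] matrix_to_operator_embedding]
  show False by (rule no_ell_isometric_embedding[OF assms])
next
  fix T :: "('h \<Rightarrow> 'h) \<Rightarrow> ('k \<Rightarrow> 'k)"
  assume h: "2 \<le> cdim (UNIV :: 'h set)"
    and T: "isometric_embedding (schatten_class q) (schatten_norm q) (schatten_class p) (schatten_norm p) T"
  obtain e1 e2 :: 'h where "orthonormal_pair e1 e2" by (rule orthonormal_pair_exists[OF h])
  from isometric_embedding_compose[OF orthonormal_pair.diag_op_isometric[OF this] T]
  show False by (rule no_ell_isometric_embedding[OF assms])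
qed

end
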